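(* Suppose $G$ is a group, $\phi: B \to A$ is an isomorphism between subgroups $A,B \leq G$, and $k \geq 1$ is an integer. The following two conditions are equivalent. (1) $\mathrm{Hig}_k(G,\phi)$ has a sofic quotient $Q$ such that the composition $G \stackrel{\iota}{\to} \mathrm{Hig}_k(G,\phi) \to Q$ is injective. (2) For all finite subsets $S \subseteq G$ and all $\delta,\varepsilon >0$, there exist (for some $n$) an $(S,\delta,n)$-approximation $\psi$ of $G$ and a permutation $f \in \mathrm{Sym}(n)$ of order dividing $k$ such that for all $b \in S \cap \phi^{-1}(A \cap S)$, $$d( \psi(b) \circ f,\ f \circ \psi(\phi(b))) < \varepsilon.$$ If $G$ is amenable, then these are also equivalent to: (3) For all finite sets $S \subseteq G$ and all $\varepsilon >0$, there exist a finite set $S' \subseteq G$ with $S \subseteq S'$, a $\delta >0$, and an integer $N$ such that if $\psi$ is an $(S',\delta,n)$-approximation of $G$ with $n> N$, then there exists a permutation $f \in \mathrm{Sym}(n)$ of order dividing $k$ such that for all $b \in S \cap \phi^{-1}(A \cap S)$, $$d( \psi(b) \circ f,\ f \circ \psi(\phi(b))) < \varepsilon.$$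
   Context: Conventions: $b^t = t^{-1} b t$. For a group $G$, an isomorphism $\phi:B\to A$ between subgroups of $G$, and a positive integer $k$, $$\mathrm{Hig}_k(G,\phi) := \langle G, t \mid t^k=1,\ b^t=\phi(b)\ \forall b\in B\rangle,$$ the quotient of $G*\langle t\rangle$ ($\langle t\rangle$ infinite cyclic) by these relations. The map $\iota: G\to \mathrm{Hig}_k(G,\phi)$ is the natural map; it need not be injective in general. The normalized Hamming distance on $\mathrm{Sym}(n)$ (permutations of an $n$-element set, $n\ge 1$) is $d(\rho,\sigma) = \frac1n|\{1\le i\le n \mid \rho(i)\ne\sigma(i)\}|$. A permutation $f$ has order dividing $k$ when $f^k=\mathrm{id}$. For $n\in\mathbb{N}$, $\delta>0$, and $S$ a finite subset of a group $G$, an $(S,\delta,n)$-approximation of $G$ is a map (not necessarily a homomorphism) $\psi: G\to\mathrm{Sym}(n)$ such that $d(\psi(g)\psi(h),\psi(gh))<\delta$ for all $g,h\in S$ with $gh\in S$, and $d(\psi(g),\mathrm{id})>1-\delta$ for all $g\in S\smallsetminus\{e\}$. A group $G$ is sofic if for all finite $S\subseteq G$ and all $\delta>0$ there exists an $(S,\delta,n)$-approximation of $G$ for some $n$. A group $G$ is amenable if it satisfies the Følner condition: for all finite $S\subseteq G$ and all $\epsilon>0$ there is a finite (non-empty) $\Phi\subseteq G$ such that $|g\Phi\triangle\Phi|<\epsilon|\Phi|$ for each $g\in S$. *)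

theory Defs
  imports "HOL-Algebra.Algebra"
begin

section \<open>Free products of two groups\<close>

text \<open>
  Words are lists of letters from the disjoint union of the two carriers.  The free product is the
  quotient of the monoid of words by the smallest congruence which multiplies adjacent letters
  coming from the same factor and deletes identity letters.
\<close>

inductive free_product_eq ::
  "('a, 'c) monoid_scheme \<Rightarrow> ('b, 'd) monoid_scheme \<Rightarrow> ('a + 'b) list \<Rightarrow> ('a + 'b) list \<Rightarrow> bool"
  for G H where
  refl: "w \<in> lists (carrier G <+> carrier H) \<Longrightarrow> free_product_eq G H w w"
| sym: "free_product_eq G H v w \<Longrightarrow> free_product_eq G H w v"
| trans: "free_product_eq G H u v \<Longrightarrow> free_product_eq G H v w \<Longrightarrow> free_product_eq G H u w"
| append: "free_product_eq G H u u' \<Longrightarrow> free_product_eq G H v v' \<Longrightarrow>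
    free_product_eq G H (u @ v) (u' @ v')"
| one_left: "free_product_eq G H [Inl \<one>\<^bsub>G\<^esub>] []"
| one_right: "free_product_eq G H [Inr \<one>\<^bsub>H\<^esub>] []"
| mult_left: "g \<in> carrier G \<Longrightarrow> g' \<in> carrier G \<Longrightarrow>
    free_product_eq G H [Inl g, Inl g'] [Inl (g \<otimes>\<^bsub>G\<^esub> g')]"
| mult_right: "h \<in> carrier H \<Longrightarrow> h' \<in> carrier H \<Longrightarrow>
    free_product_eq G H [Inr h, Inr h'] [Inr (h \<otimes>\<^bsub>H\<^esub> h')]"

definition free_product_class ::
  "('a, 'c) monoid_scheme \<Rightarrow> ('b, 'd) monoid_scheme \<Rightarrow> ('a + 'b) list \<Rightarrow> ('a + 'b) list set"
  where "free_product_class G H w = {v. free_product_eq G H w v}"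

definition free_product ::
  "('a, 'c) monoid_scheme \<Rightarrow> ('b, 'd) monoid_scheme \<Rightarrow> ('a + 'b) list set monoid"
  where "free_product G H =
    \<lparr>carrier = free_product_class G H ` lists (carrier G <+> carrier H),
     monoid.mult = (\<lambda>C D. {w. \<exists>x\<in>C. \<exists>y\<in>D. free_product_eq G H (x @ y) w}),
     one = free_product_class G H []\<rparr>"

definition free_product_inl ::
  "('a, 'c) monoid_scheme \<Rightarrow> ('b, 'd) monoid_scheme \<Rightarrow> 'a \<Rightarrow> ('a + 'b) list set"
  where "free_product_inl G H g = free_product_class G H [Inl g]"

definition free_product_inr ::
  "('a, 'c) monoid_scheme \<Rightarrow> ('b, 'd) monoid_scheme \<Rightarrow> 'b \<Rightarrow> ('a + 'b) list set"
  where "free_product_inr G H h = free_product_class G H [Inr h]"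

lemma free_product_eq_in_words:
  assumes "group G" "group H" "free_product_eq G H v w"
  shows "v \<in> lists (carrier G <+> carrier H) \<and> w \<in> lists (carrier G <+> carrier H)"
proof -
  interpret G: group G by fact
  interpret H: group H by fact
  show ?thesis using assms(3) by (induction rule: free_product_eq.induct) auto
qed

lemma free_product_class_eq_iff:
  assumes "w \<in> lists (carrier G <+> carrier H)"
  shows "free_product_class G H v = free_product_class G H w \<longleftrightarrow> free_product_eq G H v w"
  using free_product_eq.refl[OF assms]
  by (auto simp: free_product_class_def intro: free_product_eq.sym free_product_eq.trans)

lemma free_product_mult_class:
  assumes "v \<in> lists (carrier G <+> carrier H)" "w \<in> lists (carrier G <+> carrier H)"
  shows "free_product_class G H v \<otimes>\<^bsub>free_product G H\<^esub> free_product_class G H w =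
    free_product_class G H (v @ w)"
  using free_product_eq.refl[OF assms(1)] free_product_eq.refl[OF assms(2)]
  by (auto simp: free_product_def free_product_class_def
      intro: free_product_eq.append free_product_eq.trans)

lemma carrier_free_product:
  "carrier (free_product G H) = free_product_class G H ` lists (carrier G <+> carrier H)"
  by (simp add: free_product_def)

lemma group_free_product:
  assumes "group G" "group H"
  shows "group (free_product G H)"
proof -
  interpret G: group G by fact
  interpret H: group H by fact
  let ?W = "lists (carrier G <+> carrier H)" and ?P = "free_product G H"
  let ?c = "free_product_class G H"
  have car: "carrier ?P = ?c ` ?W" and one: "\<one>\<^bsub>?P\<^esub> = ?c []"
    by (simp_all add: free_product_def)
  have mult: "?c v \<otimes>\<^bsub>?P\<^esub> ?c w = ?c (v @ w)" if "v \<in> ?W" "w \<in> ?W" for v w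
    using free_product_mult_class[OF that] .
  have linv: "\<exists>v\<in>?W. free_product_eq G H (v @ w) []" if "w \<in> ?W" for w
    using that
  proof (induction w)
    case Nil
    then show ?case by (intro bexI[of _ "[]"]) (auto intro: free_product_eq.refl)
  next
    case (Cons x w)
    then obtain v where v: "v \<in> ?W" "free_product_eq G H (v @ w) []" by auto
    obtain y where y: "y \<in> carrier G <+> carrier H" "free_product_eq G H [y, x] []"
    proof (cases x)
      case (Inl g)
      then have "g \<in> carrier G" using Cons.hyps by auto
      then show ?thesis
        using that[of "Inl (inv\<^bsub>G\<^esub> g)"] Inl free_product_eq.mult_left[of "inv\<^bsub>G\<^esub> g" G g H]
        by (auto intro: free_product_eq.trans free_product_eq.one_left)
    next
      case (Inr h)
      then have "h \<in> carrier H" using Cons.hyps by auto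
      then show ?thesis
        using that[of "Inr (inv\<^bsub>H\<^esub> h)"] Inr free_product_eq.mult_right[of "inv\<^bsub>H\<^esub> h" H h G]
        by (auto intro: free_product_eq.trans free_product_eq.one_right)
    qed
    have "w \<in> ?W" using Cons.hyps by auto
    then have "free_product_eq G H (v @ ([y, x] @ w)) (v @ ([] @ w))"
      by (intro free_product_eq.append free_product_eq.refl v y)
    then have "free_product_eq G H ((v @ [y]) @ (x # w)) []"
      using v(2) by (auto intro: free_product_eq.trans)
    then show ?case using v y by (intro bexI[of _ "v @ [y]"]) auto
  qed
  show ?thesis
  proof (rule groupI)
    fix x assume "x \<in> carrier ?P"
    then obtain w where w: "w \<in> ?W" "x = ?c w" by (auto simp: car)
    from linv[OF w(1)] obtain v where v: "v \<in> ?W" "free_product_eq G H (v @ w) []" by auto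
    then show "\<exists>y\<in>carrier ?P. y \<otimes>\<^bsub>?P\<^esub> x = \<one>\<^bsub>?P\<^esub>"
      using w v by (intro bexI[of _ "?c v"]) (auto simp: mult one car free_product_class_eq_iff)
  next
    fix x y assume "x \<in> carrier ?P" "y \<in> carrier ?P"
    then obtain v w where "v \<in> ?W" "w \<in> ?W" "x = ?c v" "y = ?c w" by (auto simp: car)
    then show "x \<otimes>\<^bsub>?P\<^esub> y \<in> carrier ?P" unfolding car by (simp only: mult) auto
  next
    fix x y z assume "x \<in> carrier ?P" "y \<in> carrier ?P" "z \<in> carrier ?P"
    then obtain u v w
      where "u \<in> ?W" "v \<in> ?W" "w \<in> ?W" "x = ?c u" "y = ?c v" "z = ?c w"
      by (auto simp: car)
    then show "x \<otimes>\<^bsub>?P\<^esub> y \<otimes>\<^bsub>?P\<^esub> z = x \<otimes>\<^bsub>?P\<^esub> (y \<otimes>\<^bsub>?P\<^esub> z)"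
      by (simp only: mult append_in_lists_conv append_assoc simp_thms)
  next
    fix x assume "x \<in> carrier ?P"
    then obtain w where "w \<in> ?W" "x = ?c w" by (auto simp: car)
    then show "\<one>\<^bsub>?P\<^esub> \<otimes>\<^bsub>?P\<^esub> x = x"
      by (simp only: one mult lists.Nil append_Nil)
  qed (auto simp: car one)
qed

lemma free_product_inl_hom:
  assumes "group G" shows "free_product_inl G H \<in> hom G (free_product G H)"
proof -
  interpret G: group G by fact
  show ?thesis
    by (rule homI)
      (auto simp: free_product_inl_def free_product_mult_class free_product_class_eq_iff
        carrier_free_product InlI
        intro: free_product_eq.mult_left[THEN free_product_eq.sym])
qed

lemma free_product_inr_hom:
  assumes "group H" shows "free_product_inr G H \<in> hom H (free_product G H)"
proof -
  interpret H: group H by fact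
  show ?thesis
    by (rule homI)
      (auto simp: free_product_inr_def free_product_mult_class free_product_class_eq_iff
        carrier_free_product InrI
        intro: free_product_eq.mult_right[THEN free_product_eq.sym])
qed

section \<open>Normal closures\<close>

definition normal_closure :: "('a, 'b) monoid_scheme \<Rightarrow> 'a set \<Rightarrow> 'a set"
  where "normal_closure G R = \<Inter> {N. N \<lhd> G \<and> R \<subseteq> N}"

lemma normal_closure_normal:
  assumes "group G" "R \<subseteq> carrier G"
  shows "normal_closure G R \<lhd> G" "R \<subseteq> normal_closure G R"
proof -
  interpret group G by fact
  have top: "carrier G \<lhd> G"
    by (rule normalI) (auto simp: subgroup_self coset_join2 coset_join3)
  have "subgroup (normal_closure G R) G"
    unfolding normal_closure_def
    by (rule subgroups_Inter) (use top assms in \<open>auto intro: normal_imp_subgroup\<close>)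
  then show "normal_closure G R \<lhd> G"
    unfolding normal_inv_iff by (auto simp: normal_closure_def normal_inv_iff)
  show "R \<subseteq> normal_closure G R" by (auto simp: normal_closure_def)
qed

section \<open>The groups Hig\<close>

text \<open>
  The infinite cyclic group \<open>\<langle>t\<rangle>\<close> is \<^const>\<open>integer_group\<close>, with \<open>t\<close> corresponding to \<open>1\<close>.
\<close>

definition hig_t :: "('a, 'b) monoid_scheme \<Rightarrow> ('a + int) list set"
  where "hig_t G = free_product_inr G integer_group 1"

definition hig_relators ::
  "nat \<Rightarrow> ('a, 'b) monoid_scheme \<Rightarrow> 'a set \<Rightarrow> ('a \<Rightarrow> 'a) \<Rightarrow> ('a + int) list set set"
  where "hig_relators k G B \<phi> =
    (let P = free_product G integer_group; i = free_product_inl G integer_group; t = hig_t G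
     in insert (t [^]\<^bsub>P\<^esub> k)
          {inv\<^bsub>P\<^esub> t \<otimes>\<^bsub>P\<^esub> i b \<otimes>\<^bsub>P\<^esub> t \<otimes>\<^bsub>P\<^esub> inv\<^bsub>P\<^esub> (i (\<phi> b)) | b. b \<in> B})"

definition Hig ::
  "nat \<Rightarrow> ('a, 'b) monoid_scheme \<Rightarrow> 'a set \<Rightarrow> ('a \<Rightarrow> 'a) \<Rightarrow> ('a + int) list set set monoid"
  where "Hig k G B \<phi> =
    free_product G integer_group
      Mod normal_closure (free_product G integer_group) (hig_relators k G B \<phi>)"

definition hig_iota ::
  "nat \<Rightarrow> ('a, 'b) monoid_scheme \<Rightarrow> 'a set \<Rightarrow> ('a \<Rightarrow> 'a) \<Rightarrow> 'a \<Rightarrow> ('a + int) list set set"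
  where "hig_iota k G B \<phi> g =
    normal_closure (free_product G integer_group) (hig_relators k G B \<phi>)
      #>\<^bsub>free_product G integer_group\<^esub> free_product_inl G integer_group g"

section \<open>Sofic and amenable groups\<close>

definition hamming_dist :: "nat \<Rightarrow> (nat \<Rightarrow> nat) \<Rightarrow> (nat \<Rightarrow> nat) \<Rightarrow> real"
  where "hamming_dist n \<rho> \<sigma> = real (card {i \<in> {1..n}. \<rho> i \<noteq> \<sigma> i}) / real n"

definition sofic_approximation ::
  "('a, 'b) monoid_scheme \<Rightarrow> 'a set \<Rightarrow> real \<Rightarrow> nat \<Rightarrow> ('a \<Rightarrow> nat \<Rightarrow> nat) \<Rightarrow> bool"
  where "sofic_approximation G S \<delta> n \<psi> \<longleftrightarrow>
    n \<ge> 1 \<and> \<psi> \<in> carrier G \<rightarrow> carrier (sym_group n) \<and>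
    (\<forall>g\<in>S. \<forall>h\<in>S. g \<otimes>\<^bsub>G\<^esub> h \<in> S \<longrightarrow>
       hamming_dist n (\<psi> g \<otimes>\<^bsub>sym_group n\<^esub> \<psi> h) (\<psi> (g \<otimes>\<^bsub>G\<^esub> h)) < \<delta>) \<and>
    (\<forall>g\<in>S - {\<one>\<^bsub>G\<^esub>}. hamming_dist n (\<psi> g) id > 1 - \<delta>)"

definition sofic :: "('a, 'b) monoid_scheme \<Rightarrow> bool"
  where "sofic G \<longleftrightarrow>
    (\<forall>S \<delta>. finite S \<and> S \<subseteq> carrier G \<and> \<delta> > 0 \<longrightarrow> (\<exists>n \<psi>. sofic_approximation G S \<delta> n \<psi>))"

definition amenable :: "('a, 'b) monoid_scheme \<Rightarrow> bool"
  where "amenable G \<longleftrightarrow>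
    (\<forall>S (\<epsilon>::real). finite S \<and> S \<subseteq> carrier G \<and> \<epsilon> > 0 \<longrightarrow>
       (\<exists>\<Phi>. finite \<Phi> \<and> \<Phi> \<noteq> {} \<and> \<Phi> \<subseteq> carrier G \<and>
          (\<forall>g\<in>S. real (card (sym_diff (g <#\<^bsub>G\<^esub> \<Phi>) \<Phi>)) < \<epsilon> * real (card \<Phi>))))"

end

theory Submission
  imports Defs "HOL-Analysis.Function_Topology"
begin

text \<open>
  (1) implies (2): the image of \<open>t\<close> under an approximation of \<open>Q\<close> satisfies \<open>f ^^ k \<approx> id\<close>, and replacing
  it by the identity off the fixed points of \<open>f ^^ k\<close> makes this exact.
  (2) implies (1): words in \<open>G\<close> and \<open>t\<close> act by permutations; a cluster point of the resulting Hamming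
  distances (Tychonoff) is a bi-invariant pseudometric on words whose null classes form a normal
  subgroup containing the relators.  Letting the permutations act on tuples pushes positive distances
  close to \<open>1\<close>, so the quotient is sofic.

  For amenable \<open>G\<close>, Foelner sets yield arbitrarily large approximations, so (3) implies (2).  For
  (2) implies (3) any two good approximations on equally many points are almost conjugate, and the
  given one is compared with many copies of a fixed approximation that has a twisting permutation.
  The conjugacy needs a single Foelner set \<open>F\<close> and no quasi-tilings: match translates \<open>F c\<close> and
  \<open>F c'\<close> along their parts that are still unmatched on both sides.  For random \<open>c\<close>, \<open>c'\<close> and an unmatched
  proportion \<open>u\<close>, the expected gain is \<open>u\<^sup>2\<close> per element of \<open>F\<close>, while the expected damage is \<open>2 u\<close> times
  the current density of defects, so the defects stay bounded by a constant multiple of the non-invariance of \<open>F\<close>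
  until almost everything is matched.
\<close>

section \<open>Hamming distance on finite sets\<close>

text \<open>The matching process multiplies the defect density by at most
  \<open>exp (3 / \<epsilon>)\<close>, a factor that depends neither on the number of points nor on
  \<open>F\<close>. This dictates the order of choices: tolerated unmatched proportion, initial
  allowance of defects, Foelner constant, \<open>F\<close>, quality of approximation, reference
  approximation with its twisting permutation, and last the bound \<open>N\<close>, which makes the
  remainder of dividing n by the reference size negligible. The damage is tied to the defects by
  conservation: a permutation sends as many points into a set as out of it, so unmatched points
  flowing into the matched region are paid for by matched pairs flowing out. On the sofic side no
  metric ultraproduct is formed. Every relation needed concerns finitely many word distances at a
  time, so one function on pairs of words, approached arbitrarily well on each finite set of pairs,
  carries all the information. Nontrivial elements of G get length 1, but other elements of the
  quotient are only known to have positive length; this is why distances must be amplified.\<close>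

definition ham :: "'x set \<Rightarrow> ('x \<Rightarrow> 'x) \<Rightarrow> ('x \<Rightarrow> 'x) \<Rightarrow> real"
  where "ham V \<rho> \<sigma> = real (card {x \<in> V. \<rho> x \<noteq> \<sigma> x}) / real (card V)"

lemma hamming_dist_eq_ham: "hamming_dist n = ham {1..n}"
  by (simp add: fun_eq_iff hamming_dist_def ham_def)

lemma ham_nonneg: "0 \<le> ham V \<rho> \<sigma>"
  by (simp add: ham_def)

lemma ham_le_1: "finite V \<Longrightarrow> ham V \<rho> \<sigma> \<le> 1"
  by (cases "card V = 0") (auto simp: ham_def divide_le_eq intro: card_mono)

lemma ham_refl [simp]: "ham V \<rho> \<rho> = 0"
  by (simp add: ham_def)

lemma ham_commute: "ham V \<rho> \<sigma> = ham V \<sigma> \<rho>"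
  by (simp add: ham_def eq_commute)

lemma ham_triangle:
  assumes "finite V"
  shows "ham V \<rho> \<tau> \<le> ham V \<rho> \<sigma> + ham V \<sigma> \<tau>"
proof -
  have "card {x \<in> V. \<rho> x \<noteq> \<tau> x} \<le> card ({x \<in> V. \<rho> x \<noteq> \<sigma> x} \<union> {x \<in> V. \<sigma> x \<noteq> \<tau> x})"
    by (rule card_mono) (use assms in auto)
  also have "\<dots> \<le> card {x \<in> V. \<rho> x \<noteq> \<sigma> x} + card {x \<in> V. \<sigma> x \<noteq> \<tau> x}"
    by (rule card_Un_le)
  finally show ?thesis
    unfolding ham_def add_divide_distrib[symmetric]
    by (intro divide_right_mono) linarith+
qed

lemma card_Collect_bij_betw:
  assumes "bij_betw \<tau> V Y"
  shows "card {x \<in> V. P (\<tau> x)} = card {y \<in> Y. P y}"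
proof -
  have "bij_betw \<tau> {x \<in> V. P (\<tau> x)} {y \<in> Y. P y}"
    using assms unfolding bij_betw_def inj_on_def by auto
  then show ?thesis by (rule bij_betw_same_card)
qed

lemma ham_comp_left:
  assumes "inj_on \<tau> V" "\<rho> ` V \<subseteq> V" "\<sigma> ` V \<subseteq> V"
  shows "ham V (\<tau> \<circ> \<rho>) (\<tau> \<circ> \<sigma>) = ham V \<rho> \<sigma>"
proof -
  have "{x \<in> V. (\<tau> \<circ> \<rho>) x \<noteq> (\<tau> \<circ> \<sigma>) x} = {x \<in> V. \<rho> x \<noteq> \<sigma> x}"
    using assms by (auto simp: inj_on_def image_subset_iff)
  then show ?thesis by (simp add: ham_def)
qed

lemma ham_comp_right:
  assumes "bij_betw \<tau> V V"
  shows "ham V (\<rho> \<circ> \<tau>) (\<sigma> \<circ> \<tau>) = ham V \<rho> \<sigma>"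
  using card_Collect_bij_betw[OF assms, of "\<lambda>x. \<rho> x \<noteq> \<sigma> x"] by (simp add: ham_def)

lemma bij_betw_extend:
  assumes "finite V" "finite Y" "card V = card Y" "D \<subseteq> V" "inj_on \<sigma> D" "\<sigma> ` D \<subseteq> Y"
  obtains \<tau> where "bij_betw \<tau> V Y" "\<And>x. x \<in> D \<Longrightarrow> \<tau> x = \<sigma> x"
proof -
  have "card (V - D) = card (Y - \<sigma> ` D)"
    using assms by (simp add: card_Diff_subset card_image finite_subset)
  then obtain h where h: "bij_betw h (V - D) (Y - \<sigma> ` D)"
    using assms by (meson finite_Diff finite_same_card_bij)
  define \<tau> where "\<tau> x = (if x \<in> D then \<sigma> x else h x)" for x
  have "bij_betw \<tau> D (\<sigma> ` D)"
    using assms(5) by (auto simp: bij_betw_def \<tau>_def inj_on_def)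
  moreover have "bij_betw \<tau> (V - D) (Y - \<sigma> ` D)"
    using h by (rule bij_betw_cong[THEN iffD1, rotated]) (auto simp: \<tau>_def)
  ultimately have "bij_betw \<tau> (D \<union> (V - D)) (\<sigma> ` D \<union> (Y - \<sigma> ` D))"
    by (rule bij_betw_combine) auto
  moreover have "D \<union> (V - D) = V" "\<sigma> ` D \<union> (Y - \<sigma> ` D) = Y" using assms by auto
  ultimately show ?thesis using that[of \<tau>] by (simp add: \<tau>_def)
qed

section \<open>Approximations on arbitrary finite sets\<close>

text \<open>Foelner sets, products with an index set and sets of lists occur as carriers, so
  \<open>{1..n}\<close> is too rigid. Only values on \<open>V\<close> matter, hence
  \<open>bij_betw\<close> where \<open>sofic_approximation\<close> uses
  \<open>sym_group\<close>.\<close>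

definition approx_on ::
  "('a, 'b) monoid_scheme \<Rightarrow> 'a set \<Rightarrow> real \<Rightarrow> 'x set \<Rightarrow> ('a \<Rightarrow> 'x \<Rightarrow> 'x) \<Rightarrow> bool"
  where "approx_on G S \<delta> V \<psi> \<longleftrightarrow>
    finite V \<and> V \<noteq> {} \<and> (\<forall>g\<in>carrier G. bij_betw (\<psi> g) V V) \<and>
    (\<forall>g\<in>S. \<forall>h\<in>S. g \<otimes>\<^bsub>G\<^esub> h \<in> S \<longrightarrow> ham V (\<psi> g \<circ> \<psi> h) (\<psi> (g \<otimes>\<^bsub>G\<^esub> h)) < \<delta>) \<and>
    (\<forall>g\<in>S - {\<one>\<^bsub>G\<^esub>}. ham V (\<psi> g) id > 1 - \<delta>)"

lemma sofic_approximation_imp_approx_on: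
  assumes "sofic_approximation G S \<delta> n \<psi>"
  shows "approx_on G S \<delta> {1..n} \<psi>"
  using assms
  by (auto simp: sofic_approximation_def approx_on_def hamming_dist_eq_ham sym_group_def Pi_iff
      intro: permutes_imp_bij)

lemma sofic_approximation_mono:
  assumes "sofic_approximation G S' \<delta>' n \<psi>" "S \<subseteq> S'" "\<delta>' \<le> \<delta>"
  shows "sofic_approximation G S \<delta> n \<psi>"
  unfolding sofic_approximation_def
proof (intro conjI ballI impI)
  fix g h assume "g \<in> S" "h \<in> S" "g \<otimes>\<^bsub>G\<^esub> h \<in> S"
  then have "hamming_dist n (\<psi> g \<otimes>\<^bsub>sym_group n\<^esub> \<psi> h) (\<psi> (g \<otimes>\<^bsub>G\<^esub> h)) < \<delta>'"
    using assms unfolding sofic_approximation_def by blast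
  with assms(3) show "hamming_dist n (\<psi> g \<otimes>\<^bsub>sym_group n\<^esub> \<psi> h) (\<psi> (g \<otimes>\<^bsub>G\<^esub> h)) < \<delta>"
    by linarith
next
  fix g assume "g \<in> S - {\<one>\<^bsub>G\<^esub>}"
  then have "hamming_dist n (\<psi> g) id > 1 - \<delta>'"
    using assms unfolding sofic_approximation_def by blast
  with assms(3) show "hamming_dist n (\<psi> g) id > 1 - \<delta>" by linarith
qed (use assms in \<open>auto simp: sofic_approximation_def\<close>)

text \<open>Conjugation by \<open>h\<close>, completed by the identity off the image of
  \<open>V\<close>, so that the result is a permutation in the sense of
  \<open>permutes\<close>.\<close>

definition relabel :: "'x set \<Rightarrow> ('x \<Rightarrow> 'y) \<Rightarrow> ('x \<Rightarrow> 'x) \<Rightarrow> 'y \<Rightarrow> 'y"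
  where "relabel V h \<rho> y = (if y \<in> h ` V then h (\<rho> (inv_into V h y)) else y)"

lemma relabel_apply: "inj_on h V \<Longrightarrow> x \<in> V \<Longrightarrow> relabel V h \<rho> (h x) = h (\<rho> x)"
  by (simp add: relabel_def)

lemma relabel_id: "relabel V h id = id"
  by (auto simp: relabel_def fun_eq_iff f_inv_into_f)

lemma relabel_comp:
  assumes "inj_on h V" "\<sigma> ` V \<subseteq> V"
  shows "relabel V h (\<rho> \<circ> \<sigma>) = relabel V h \<rho> \<circ> relabel V h \<sigma>"
proof
  fix y
  show "relabel V h (\<rho> \<circ> \<sigma>) y = (relabel V h \<rho> \<circ> relabel V h \<sigma>) y"
  proof (cases "y \<in> h ` V")
    case True
    then obtain x where "x \<in> V" "y = h x" by auto
    then show ?thesis using assms(2) by (simp add: relabel_apply[OF assms(1)] image_subset_iff)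
  qed (simp add: relabel_def)
qed

lemma relabel_permutes:
  assumes "inj_on h V" "bij_betw \<rho> V V"
  shows "relabel V h \<rho> permutes h ` V"
proof (rule bij_imp_permutes)
  have h: "bij_betw h V (h ` V)" using assms(1) by (rule inj_on_imp_bij_betw)
  have "bij_betw (relabel V h \<rho>) (h ` V) (h ` V) \<longleftrightarrow>
      bij_betw (h \<circ> \<rho> \<circ> inv_into V h) (h ` V) (h ` V)"
    by (rule bij_betw_cong) (simp add: relabel_def)
  then show "bij_betw (relabel V h \<rho>) (h ` V) (h ` V)"
    using bij_betw_trans[OF bij_betw_trans[OF bij_betw_inv_into[OF h] assms(2)] h]
    by (simp add: comp_assoc)
qed (simp add: relabel_def)

lemma ham_relabel:
  assumes "inj_on h V" "\<rho> ` V \<subseteq> V" "\<sigma> ` V \<subseteq> V"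
  shows "ham (h ` V) (relabel V h \<rho>) (relabel V h \<sigma>) = ham V \<rho> \<sigma>"
proof -
  have "{y \<in> h ` V. relabel V h \<rho> y \<noteq> relabel V h \<sigma> y} = h ` {x \<in> V. \<rho> x \<noteq> \<sigma> x}"
    using assms(2,3) inj_on_eq_iff[OF assms(1)]
    by (auto simp: relabel_apply[OF assms(1)] image_subset_iff)
  moreover have "inj_on h {x \<in> V. \<rho> x \<noteq> \<sigma> x}"
    using assms(1) by (rule inj_on_subset) auto
  ultimately show ?thesis by (simp add: ham_def card_image assms(1))
qed

lemma sofic_approximation_relabel:
  assumes "approx_on G S \<delta> V \<psi>" "bij_betw h V {1..n}" "group G" "S \<subseteq> carrier G"
  shows "sofic_approximation G S \<delta> n (\<lambda>g. relabel V h (\<psi> g))"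
proof -
  interpret group G by fact
  have h: "inj_on h V" "{1..n} = h ` V" using assms(2) by (auto simp: bij_betw_def)
  have V: "V \<noteq> {}" and \<psi>: "\<And>g. g \<in> carrier G \<Longrightarrow> bij_betw (\<psi> g) V V"
    using assms(1) by (auto simp: approx_on_def)
  have im: "\<psi> g ` V \<subseteq> V" if "g \<in> carrier G" for g using \<psi>[OF that] by (simp add: bij_betw_def)
  have n: "n \<ge> 1" using V h(2) by (cases n) auto
  have perm: "relabel V h (\<psi> g) permutes {1..n}" if "g \<in> carrier G" for g
    unfolding h(2) by (rule relabel_permutes[OF h(1) \<psi>[OF that]])
  have 1: "hamming_dist n (relabel V h (\<psi> g) \<circ> relabel V h (\<psi> g')) (relabel V h (\<psi> (g \<otimes>\<^bsub>G\<^esub> g')))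
      = ham V (\<psi> g \<circ> \<psi> g') (\<psi> (g \<otimes>\<^bsub>G\<^esub> g'))" if "g \<in> carrier G" "g' \<in> carrier G" for g g'
    using that im[of g] im[of g'] im[of "g \<otimes>\<^bsub>G\<^esub> g'"] unfolding hamming_dist_eq_ham h(2)
    by (subst relabel_comp[symmetric], simp add: h, simp, intro ham_relabel h) auto
  have 2: "hamming_dist n (relabel V h (\<psi> g)) id = ham V (\<psi> g) id" if "g \<in> carrier G" for g
    using ham_relabel[OF h(1) im[OF that], of id] h(2) by (simp add: hamming_dist_eq_ham relabel_id)
  show ?thesis
    unfolding sofic_approximation_def
  proof (intro conjI ballI impI)
    show "(\<lambda>g. relabel V h (\<psi> g)) \<in> carrier G \<rightarrow> carrier (sym_group n)"
      using perm by (simp add: sym_group_def)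
  next
    fix g g' assume "g \<in> S" "g' \<in> S" "g \<otimes>\<^bsub>G\<^esub> g' \<in> S"
    moreover from this have "g \<in> carrier G" "g' \<in> carrier G" using assms(4) by auto
    ultimately show "hamming_dist n (relabel V h (\<psi> g) \<otimes>\<^bsub>sym_group n\<^esub> relabel V h (\<psi> g'))
        (relabel V h (\<psi> (g \<otimes>\<^bsub>G\<^esub> g'))) < \<delta>"
      using assms(1) 1[of g g'] by (simp add: approx_on_def sym_group_def)
  next
    fix g assume "g \<in> S - {\<one>\<^bsub>G\<^esub>}"
    then show "1 - \<delta> < hamming_dist n (relabel V h (\<psi> g)) id"
      using assms(1,4) 2[of g] by (auto simp: approx_on_def)
  qed (rule n)
qed

section \<open>Almost equivariant matchings\<close>

text \<open>For fixed \<open>g\<close> the conditions on \<open>c\<close> and \<open>c'\<close> are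
  independent, so the count factors once the sum over \<open>g\<close> is moved outside. This
  replaces the expectation over a random pair of centres by exact counting.\<close>

lemma sum_card_product:
  assumes "finite F" "finite C" "finite C'"
  shows "(\<Sum>c\<in>C. \<Sum>c'\<in>C'. card {g \<in> F. P g c \<and> Q g c'}) =
    (\<Sum>g\<in>F. card {c \<in> C. P g c} * card {c' \<in> C'. Q g c'})"
proof -
  have card_eq: "card {x \<in> A. R x} = (\<Sum>x\<in>A. of_bool (R x))" if "finite A" for A :: "'x set" and R
    using that by (simp add: Int_def)
  have "(\<Sum>c\<in>C. \<Sum>c'\<in>C'. card {g \<in> F. P g c \<and> Q g c'}) =
      (\<Sum>c\<in>C. \<Sum>c'\<in>C'. \<Sum>g\<in>F. of_bool (P g c) * of_bool (Q g c'))"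
    using assms by (simp add: of_bool_conj[symmetric] Int_def)
  also have "\<dots> = (\<Sum>g\<in>F. \<Sum>c\<in>C. \<Sum>c'\<in>C'. of_bool (P g c) * of_bool (Q g c'))"
    by (rule HOL.trans[OF sum.cong[OF HOL.refl sum.swap] sum.swap])
  also have "\<dots> = (\<Sum>g\<in>F. card {c \<in> C. P g c} * card {c' \<in> C'. Q g c'})"
    using assms by (simp add: card_eq sum_product del: sum_of_bool_eq)
  finally show ?thesis .
qed

text \<open>The preimage of \<open>D\<close> under \<open>p\<close> has the size of
  \<open>D\<close>; remove from both the points that stay inside \<open>D\<close>.\<close>

lemma card_entering_eq_leaving:
  assumes "finite V" "bij_betw p V V" "D \<subseteq> V"
  shows "card {x \<in> V. x \<notin> D \<and> p x \<in> D} = card {x \<in> D. p x \<notin> D}"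
proof -
  have fin: "finite D" using assms finite_subset by blast
  have "card {x \<in> V. p x \<in> D} = card {x \<in> V. x \<in> D}"
    by (rule card_Collect_bij_betw[OF assms(2)])
  also have "{x \<in> V. x \<in> D} = {x \<in> D. p x \<in> D} \<union> {x \<in> D. p x \<notin> D}" using assms by auto
  also have "card \<dots> = card {x \<in> D. p x \<in> D} + card {x \<in> D. p x \<notin> D}"
    by (rule card_Un_disjoint) (use fin in auto)
  also have "{x \<in> V. p x \<in> D} = {x \<in> V. x \<notin> D \<and> p x \<in> D} \<union> {x \<in> D. p x \<in> D}"
    using assms by auto
  also have "card \<dots> = card {x \<in> V. x \<notin> D \<and> p x \<in> D} + card {x \<in> D. p x \<in> D}"
    by (rule card_Un_disjoint) (use fin assms in auto)
  finally show ?thesis by simp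
qed

text \<open>\<open>C\<close> and \<open>C'\<close> hold the good centres: acting on such a point,
  \<open>F\<close> has an injective image, and a step by \<open>s\<close> agrees with
  \<open>mul s\<close> as long as it stays in \<open>F\<close>. The process stops at the unmatched
  proportion \<epsilon>; \<eta> is the initial allowance of defects and \<theta> the non-invariance
  of \<open>F\<close>. Bad centres are limited to \<epsilon> / 20 so that at least 19/20 of the
  unmatched positions stay reachable from good centres.\<close>

locale folner_matching =
  fixes S F :: "'a set" and mul :: "'a \<Rightarrow> 'a \<Rightarrow> 'a" and V :: "'x set" and W :: "'y set"
    and \<alpha> :: "'a \<Rightarrow> 'x \<Rightarrow> 'x" and \<beta> :: "'a \<Rightarrow> 'y \<Rightarrow> 'y" and C :: "'x set" and C' :: "'y set"
    and n :: nat and \<epsilon> \<eta> \<theta> :: real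
  assumes finS: "finite S" and finF: "finite F" and F_ne: "F \<noteq> {}"
    and finV: "finite V" and finW: "finite W" and cardV: "card V = n" and cardW: "card W = n"
    and n_pos: "0 < n"
    and bij_\<alpha>: "\<And>g. g \<in> S \<union> F \<Longrightarrow> bij_betw (\<alpha> g) V V"
    and bij_\<beta>: "\<And>g. g \<in> S \<union> F \<Longrightarrow> bij_betw (\<beta> g) W W"
    and C: "C \<subseteq> V" "real (card (V - C)) \<le> \<epsilon> / 20 * n"
      "\<And>c. c \<in> C \<Longrightarrow> inj_on (\<lambda>g. \<alpha> g c) F"
      "\<And>c s g. c \<in> C \<Longrightarrow> s \<in> S \<Longrightarrow> g \<in> F \<Longrightarrow> mul s g \<in> F \<Longrightarrow> \<alpha> s (\<alpha> g c) = \<alpha> (mul s g) c"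
    and C': "C' \<subseteq> W" "real (card (W - C')) \<le> \<epsilon> / 20 * n"
      "\<And>c. c \<in> C' \<Longrightarrow> inj_on (\<lambda>g. \<beta> g c) F"
      "\<And>c s g. c \<in> C' \<Longrightarrow> s \<in> S \<Longrightarrow> g \<in> F \<Longrightarrow> mul s g \<in> F \<Longrightarrow> \<beta> s (\<beta> g c) = \<beta> (mul s g) c"
    and \<epsilon>: "0 < \<epsilon>" and \<eta>: "0 < \<eta>"
    and folner: "\<And>s. s \<in> S \<Longrightarrow> real (card {g \<in> F. mul s g \<notin> F}) \<le> \<theta> * card F"
    and \<theta>: "card S * \<theta> \<le> \<eta> * \<epsilon> / 2"
begin

section \<open>Matchings, their defects, and the effect of adding one tile\<close>

definition matching :: "('x \<times> 'y) set \<Rightarrow> bool"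
  where "matching M \<longleftrightarrow> M \<subseteq> V \<times> W \<and> inj_on fst M \<and> inj_on snd M"

text \<open>A pair is defective both when it leaves the matched points and when its two coordinates
  arrive at points matched to other partners.\<close>

definition defect :: "('x \<times> 'y) set \<Rightarrow> 'a \<Rightarrow> nat"
  where "defect M s = card {z \<in> M. map_prod (\<alpha> s) (\<beta> s) z \<notin> M}"

definition tile :: "('x \<times> 'y) set \<Rightarrow> 'x \<Rightarrow> 'y \<Rightarrow> 'a set"
  where "tile M c c' = {g \<in> F. \<alpha> g c \<notin> fst ` M \<and> \<beta> g c' \<notin> snd ` M}"

text \<open>The three ways in which a new pair can be defective at \<open>s\<close>: leaving
  \<open>F\<close>, or arriving at an already matched point on the first or on the second
  side.\<close>

definition cost :: "('x \<times> 'y) set \<Rightarrow> 'x \<Rightarrow> 'y \<Rightarrow> 'a \<Rightarrow> nat"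
  where "cost M c c' s = card {g \<in> F. mul s g \<notin> F} +
    (card {g \<in> tile M c c'. \<alpha> s (\<alpha> g c) \<in> fst ` M} +
     card {g \<in> tile M c c'. \<beta> s (\<beta> g c') \<in> snd ` M})"

lemma matching_finite: "matching M \<Longrightarrow> finite M"
  unfolding matching_def using finV finW by (meson finite_SigmaI finite_subset)

lemma matching_card:
  assumes "matching M"
  shows "card (fst ` M) = card M" "card (snd ` M) = card M"
    "card (V - fst ` M) = n - card M" "card (W - snd ` M) = n - card M" "card M \<le> n"
proof -
  have sub: "fst ` M \<subseteq> V" "snd ` M \<subseteq> W" using assms by (auto simp: matching_def)
  show 1: "card (fst ` M) = card M" "card (snd ` M) = card M"
    using assms by (auto simp: matching_def card_image)
  show "card (V - fst ` M) = n - card M" "card (W - snd ` M) = n - card M"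
    using sub 1 finV finW cardV cardW by (simp_all add: card_Diff_subset finite_subset)
  show "card M \<le> n" using card_mono[OF finV sub(1)] 1 cardV by simp
qed

text \<open>Enlarging a matching never makes an old pair defective. A new pair at \<open>g\<close>
  for which none of the three events in \<open>cost\<close> occurs has \<open>mul s g\<close> in the
  tile again, so its image was added along with it.\<close>

lemma extend_matching:
  assumes M: "matching M" and c: "c \<in> C" and c': "c' \<in> C'"
  defines "M' \<equiv> M \<union> (\<lambda>g. (\<alpha> g c, \<beta> g c')) ` tile M c c'"
  shows "matching M'" "card M' = card M + card (tile M c c')"
    "\<And>s. s \<in> S \<Longrightarrow> defect M' s \<le> defect M s + cost M c c' s"
proof -
  let ?E = "tile M c c'" and ?N = "(\<lambda>g. (\<alpha> g c, \<beta> g c')) ` tile M c c'"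
  have EF: "?E \<subseteq> F" and finE: "finite ?E" using finF by (auto simp: tile_def)
  have cV: "c \<in> V" "c' \<in> W" using c c' C C' by auto
  have \<alpha>V: "\<alpha> g x \<in> V" if "g \<in> S \<union> F" "x \<in> V" for g x
    using bij_\<alpha>[OF that(1)] that(2) by (auto simp: bij_betw_def)
  have \<beta>W: "\<beta> g y \<in> W" if "g \<in> S \<union> F" "y \<in> W" for g y
    using bij_\<beta>[OF that(1)] that(2) by (auto simp: bij_betw_def)
  have inj: "inj_on (\<lambda>g. \<alpha> g c) ?E" "inj_on (\<lambda>g. \<beta> g c') ?E"
    using C(3)[OF c] C'(3)[OF c'] EF by (auto intro: inj_on_subset)
  have injN: "inj_on fst ?N" "inj_on snd ?N"
    using inj by (auto simp: inj_on_def)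
  have dis: "fst ` M \<inter> fst ` ?N = {}" "snd ` M \<inter> snd ` ?N = {}"
    by (force simp: tile_def)+
  have NV: "?N \<subseteq> V \<times> W" using \<alpha>V \<beta>W cV EF by auto
  show "matching M'"
    unfolding matching_def M'_def
  proof (intro conjI)
    show "inj_on fst (M \<union> ?N)"
      using M injN(1) image_mono[of "M - ?N" M fst] image_mono[of "?N - M" ?N fst] dis(1)
      unfolding inj_on_Un matching_def by blast
    show "inj_on snd (M \<union> ?N)"
      using M injN(2) image_mono[of "M - ?N" M snd] image_mono[of "?N - M" ?N snd] dis(2)
      unfolding inj_on_Un matching_def by blast
  qed (use M NV in \<open>auto simp: matching_def\<close>)
  have "inj_on (\<lambda>g. (\<alpha> g c, \<beta> g c')) ?E" using inj by (auto simp: inj_on_def)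
  moreover have "M \<inter> ?N = {}" using dis by blast
  ultimately show "card M' = card M + card ?E"
    unfolding M'_def using matching_finite[OF M] finE by (simp add: card_Un_disjoint card_image)
  fix s assume s: "s \<in> S"
  let ?T = "map_prod (\<alpha> s) (\<beta> s)"
  let ?B1 = "{g \<in> F. mul s g \<notin> F}" and ?B2 = "{g \<in> ?E. \<alpha> s (\<alpha> g c) \<in> fst ` M}"
    and ?B3 = "{g \<in> ?E. \<beta> s (\<beta> g c') \<in> snd ` M}"
  have key: "g \<in> ?B1 \<union> (?B2 \<union> ?B3)"
    if "g \<in> ?E" "(\<alpha> s (\<alpha> g c), \<beta> s (\<beta> g c')) \<notin> ?N" for g
  proof (rule ccontr)
    assume not: "g \<notin> ?B1 \<union> (?B2 \<union> ?B3)"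
    then have g: "g \<in> F" "mul s g \<in> F" using that EF by auto
    have eq: "\<alpha> s (\<alpha> g c) = \<alpha> (mul s g) c" "\<beta> s (\<beta> g c') = \<beta> (mul s g) c'"
      using C(4)[OF c s g] C'(4)[OF c' s g] by auto
    have "mul s g \<in> ?E" using not that(1) g eq by (auto simp: tile_def)
    then show False using that(2) eq by auto
  qed
  have "{z \<in> M'. ?T z \<notin> M'} \<subseteq>
      {z \<in> M. ?T z \<notin> M} \<union> (\<lambda>g. (\<alpha> g c, \<beta> g c')) ` (?B1 \<union> (?B2 \<union> ?B3))"
    using key unfolding M'_def by auto
  then have "defect M' s \<le>
      card ({z \<in> M. ?T z \<notin> M} \<union> (\<lambda>g. (\<alpha> g c, \<beta> g c')) ` (?B1 \<union> (?B2 \<union> ?B3)))"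
    unfolding defect_def using matching_finite[OF M] finF finE by (intro card_mono) auto
  also have "\<dots> \<le> defect M s + card ((\<lambda>g. (\<alpha> g c, \<beta> g c')) ` (?B1 \<union> (?B2 \<union> ?B3)))"
    unfolding defect_def by (rule card_Un_le)
  also have "card ((\<lambda>g. (\<alpha> g c, \<beta> g c')) ` (?B1 \<union> (?B2 \<union> ?B3))) \<le> card (?B1 \<union> (?B2 \<union> ?B3))"
    using finF finE by (intro card_image_le) auto
  also have "\<dots> \<le> card ?B1 + card (?B2 \<union> ?B3)" by (rule card_Un_le)
  also have "card (?B2 \<union> ?B3) \<le> card ?B2 + card ?B3" by (rule card_Un_le)
  finally show "defect M' s \<le> defect M s + cost M c c' s" by (simp add: cost_def)
qed

text \<open>The points entering the matched set under \<alpha> s are as many as those leaving it,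
  and a pair whose coordinate leaves the matched set is defective.\<close>

lemma crossing_le_defect:
  assumes M: "matching M" and s: "s \<in> S"
  shows "card {x \<in> V. x \<notin> fst ` M \<and> \<alpha> s x \<in> fst ` M} \<le> defect M s"
    "card {y \<in> W. y \<notin> snd ` M \<and> \<beta> s y \<in> snd ` M} \<le> defect M s"
proof -
  let ?B = "{z \<in> M. map_prod (\<alpha> s) (\<beta> s) z \<notin> M}"
  have fin: "finite ?B" using matching_finite[OF M] by auto
  have sub: "fst ` M \<subseteq> V" "snd ` M \<subseteq> W" using M by (auto simp: matching_def)
  have "card {x \<in> fst ` M. \<alpha> s x \<notin> fst ` M} \<le> card (fst ` ?B)"
    using fin by (intro card_mono) force+
  also have "\<dots> \<le> card ?B" using fin by (rule card_image_le)
  finally show "card {x \<in> V. x \<notin> fst ` M \<and> \<alpha> s x \<in> fst ` M} \<le> defect M s"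
    using card_entering_eq_leaving[OF finV bij_\<alpha>, of s "fst ` M"] sub s
    by (simp add: defect_def)
  have "card {y \<in> snd ` M. \<beta> s y \<notin> snd ` M} \<le> card (snd ` ?B)"
    using fin by (intro card_mono) force+
  also have "\<dots> \<le> card ?B" using fin by (rule card_image_le)
  finally show "card {y \<in> W. y \<notin> snd ` M \<and> \<beta> s y \<in> snd ` M} \<le> defect M s"
    using card_entering_eq_leaving[OF finW bij_\<beta>, of s "snd ` M"] sub s
    by (simp add: defect_def)
qed

section \<open>Averages of gain and damage over all pairs of good centres\<close>

lemma sum_tile_ge:
  assumes M: "matching M" and large: "\<epsilon> * n \<le> card (V - fst ` M)"
  shows "(9/10) * card F * (real (card (V - fst ` M)))\<^sup>2 \<le>
    (\<Sum>c\<in>C. \<Sum>c'\<in>C'. real (card (tile M c c')))"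
proof -
  define u where "u = real (card (V - fst ` M))"
  have u: "u = n - card M" "real (card (W - snd ` M)) = u"
    using matching_card[OF M] by (auto simp: u_def of_nat_diff)
  \<comment> \<open>Since \<alpha> g is a bijection, exactly u points of \<open>V\<close> are
    carried by it to unmatched points, whatever \<open>g\<close> is; restricting to good centres
    loses at most \<epsilon> n / 20.\<close>
  have low: "u - \<epsilon> / 20 * n \<le> real (card {c \<in> C. \<alpha> g c \<notin> fst ` M})" if "g \<in> F" for g
  proof -
    have "card (V - fst ` M) = card {c \<in> V. \<alpha> g c \<notin> fst ` M}"
      using card_Collect_bij_betw[OF bij_\<alpha>, of g "\<lambda>x. x \<notin> fst ` M"] that by (simp add: set_diff_eq)
    also have "\<dots> \<le> card ({c \<in> C. \<alpha> g c \<notin> fst ` M} \<union> (V - C))"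
      using finV C(1) by (intro card_mono) (auto intro: finite_subset)
    also have "\<dots> \<le> card {c \<in> C. \<alpha> g c \<notin> fst ` M} + card (V - C)" by (rule card_Un_le)
    finally show ?thesis using C(2) unfolding u_def by linarith
  qed
  have low': "u - \<epsilon> / 20 * n \<le> real (card {c \<in> C'. \<beta> g c \<notin> snd ` M})" if "g \<in> F" for g
  proof -
    have "card (W - snd ` M) = card {c \<in> W. \<beta> g c \<notin> snd ` M}"
      using card_Collect_bij_betw[OF bij_\<beta>, of g "\<lambda>x. x \<notin> snd ` M"] that by (simp add: set_diff_eq)
    also have "\<dots> \<le> card ({c \<in> C'. \<beta> g c \<notin> snd ` M} \<union> (W - C'))"
      using finW C'(1) by (intro card_mono) (auto intro: finite_subset)
    also have "\<dots> \<le> card {c \<in> C'. \<beta> g c \<notin> snd ` M} + card (W - C')" by (rule card_Un_le)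
    finally show ?thesis using C'(2) u(2) by linarith
  qed
  have large': "\<epsilon> * n \<le> u" using large by (simp add: u_def)
  \<comment> \<open>Here \<epsilon> n \<le> u is used, and (19/20)^2 = 0.9025.\<close>
  have "(9/10) * u\<^sup>2 \<le> (19/20 * u)\<^sup>2" by (simp add: power2_eq_square)
  also have "\<dots> \<le> (u - \<epsilon> / 20 * n)\<^sup>2"
    using large' by (intro power_mono) (auto simp: u_def)
  finally have sq: "(9/10) * u\<^sup>2 \<le> (u - \<epsilon> / 20 * n)\<^sup>2" .
  have nonneg: "0 \<le> u - \<epsilon> / 20 * n"
    using large' \<epsilon> by (simp add: field_simps) (smt (verit) mult_nonneg_nonneg of_nat_0_le_iff)
  have "(9/10) * card F * u\<^sup>2 = (\<Sum>g\<in>F. (9/10) * u\<^sup>2)" by simp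
  also have "\<dots> \<le> (\<Sum>g\<in>F. (u - \<epsilon> / 20 * n)\<^sup>2)" by (intro sum_mono sq)
  also have "\<dots> \<le> (\<Sum>g\<in>F. real (card {c \<in> C. \<alpha> g c \<notin> fst ` M}) * real (card {c \<in> C'. \<beta> g c \<notin> snd ` M}))"
    unfolding power2_eq_square by (intro sum_mono mult_mono low low' nonneg) auto
  also have "\<dots> = real (\<Sum>c\<in>C. \<Sum>c'\<in>C'. card (tile M c c'))"
    unfolding tile_def using sum_card_product[of F C C'] finF finV finW C(1) C'(1)
    by (simp add: finite_subset)
  finally show ?thesis by (simp add: u_def)
qed

text \<open>Leaving \<open>F\<close> costs at most a proportion \<theta> of \<open>F\<close> for
  each of at most n^2 pairs of centres. For a collision on one side, each \<open>g\<close> allows at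
  most \<open>defect M s\<close> centres there, by \<open>crossing_le_defect\<close>, and at most u
  centres on the other side; the two sides give the factor 2.\<close>

lemma sum_cost_le:
  assumes M: "matching M" and s: "s \<in> S"
  shows "(\<Sum>c\<in>C. \<Sum>c'\<in>C'. real (cost M c c' s)) \<le>
    card F * (\<theta> * real n ^ 2 + 2 * real (defect M s) * card (V - fst ` M))"
proof -
  have fin: "finite C" "finite C'" using finV finW C(1) C'(1) by (auto intro: finite_subset)
  have u: "card (W - snd ` M) = card (V - fst ` M)" using matching_card[OF M] by simp
  have CV: "card C \<le> n" "card C' \<le> n"
    using card_mono[OF finV C(1)] card_mono[OF finW C'(1)] cardV cardW by auto
  have U: "card {c \<in> C. \<alpha> g c \<notin> fst ` M} \<le> card (V - fst ` M)"
    "card {c \<in> C'. \<beta> g c \<notin> snd ` M} \<le> card (V - fst ` M)" if "g \<in> F" for g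
  proof -
    have "card {c \<in> C. \<alpha> g c \<notin> fst ` M} \<le> card {c \<in> V. \<alpha> g c \<notin> fst ` M}"
      using finV C(1) by (intro card_mono) auto
    also have "\<dots> = card {x \<in> V. x \<notin> fst ` M}"
      using that by (intro card_Collect_bij_betw bij_\<alpha>) auto
    finally show "card {c \<in> C. \<alpha> g c \<notin> fst ` M} \<le> card (V - fst ` M)" by (simp add: set_diff_eq)
    have "card {c \<in> C'. \<beta> g c \<notin> snd ` M} \<le> card {c \<in> W. \<beta> g c \<notin> snd ` M}"
      using finW C'(1) by (intro card_mono) auto
    also have "\<dots> = card {x \<in> W. x \<notin> snd ` M}"
      using that by (intro card_Collect_bij_betw bij_\<beta>) auto
    finally show "card {c \<in> C'. \<beta> g c \<notin> snd ` M} \<le> card (V - fst ` M)"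
      unfolding u[symmetric] by (simp add: set_diff_eq)
  qed
  have X: "card {c \<in> C. \<alpha> g c \<notin> fst ` M \<and> \<alpha> s (\<alpha> g c) \<in> fst ` M} \<le> defect M s"
    "card {c \<in> C'. \<beta> g c \<notin> snd ` M \<and> \<beta> s (\<beta> g c) \<in> snd ` M} \<le> defect M s" if "g \<in> F" for g
  proof -
    have "card {c \<in> C. \<alpha> g c \<notin> fst ` M \<and> \<alpha> s (\<alpha> g c) \<in> fst ` M} \<le>
        card {c \<in> V. \<alpha> g c \<notin> fst ` M \<and> \<alpha> s (\<alpha> g c) \<in> fst ` M}"
      using finV C(1) by (intro card_mono) auto
    also have "\<dots> = card {x \<in> V. x \<notin> fst ` M \<and> \<alpha> s x \<in> fst ` M}"
      using card_Collect_bij_betw[OF bij_\<alpha>, of g "\<lambda>x. x \<notin> fst ` M \<and> \<alpha> s x \<in> fst ` M"] that by simp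
    also have "\<dots> \<le> defect M s" by (rule crossing_le_defect[OF M s])
    finally show "card {c \<in> C. \<alpha> g c \<notin> fst ` M \<and> \<alpha> s (\<alpha> g c) \<in> fst ` M} \<le> defect M s" .
    have "card {c \<in> C'. \<beta> g c \<notin> snd ` M \<and> \<beta> s (\<beta> g c) \<in> snd ` M} \<le>
        card {c \<in> W. \<beta> g c \<notin> snd ` M \<and> \<beta> s (\<beta> g c) \<in> snd ` M}"
      using finW C'(1) by (intro card_mono) auto
    also have "\<dots> = card {x \<in> W. x \<notin> snd ` M \<and> \<beta> s x \<in> snd ` M}"
      using card_Collect_bij_betw[OF bij_\<beta>, of g "\<lambda>x. x \<notin> snd ` M \<and> \<beta> s x \<in> snd ` M"] that by simp
    also have "\<dots> \<le> defect M s" by (rule crossing_le_defect[OF M s])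
    finally show "card {c \<in> C'. \<beta> g c \<notin> snd ` M \<and> \<beta> s (\<beta> g c) \<in> snd ` M} \<le> defect M s" .
  qed
  have 2: "(\<Sum>c\<in>C. \<Sum>c'\<in>C'. card {g \<in> tile M c c'. \<alpha> s (\<alpha> g c) \<in> fst ` M}) \<le>
      card F * (defect M s * card (V - fst ` M))"
  proof -
    have "(\<Sum>c\<in>C. \<Sum>c'\<in>C'. card {g \<in> tile M c c'. \<alpha> s (\<alpha> g c) \<in> fst ` M}) =
        (\<Sum>c\<in>C. \<Sum>c'\<in>C'. card {g \<in> F. (\<alpha> g c \<notin> fst ` M \<and> \<alpha> s (\<alpha> g c) \<in> fst ` M) \<and> \<beta> g c' \<notin> snd ` M})"
      by (intro sum.cong HOL.refl arg_cong[where f = card]) (auto simp: tile_def)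
    also have "\<dots> = (\<Sum>g\<in>F. card {c \<in> C. \<alpha> g c \<notin> fst ` M \<and> \<alpha> s (\<alpha> g c) \<in> fst ` M} *
        card {c \<in> C'. \<beta> g c \<notin> snd ` M})"
      by (rule sum_card_product[OF finF fin])
    also have "\<dots> \<le> (\<Sum>g\<in>F. defect M s * card (V - fst ` M))"
      by (intro sum_mono mult_mono X U) auto
    finally show ?thesis by simp
  qed
  have 3: "(\<Sum>c\<in>C. \<Sum>c'\<in>C'. card {g \<in> tile M c c'. \<beta> s (\<beta> g c') \<in> snd ` M}) \<le>
      card F * (defect M s * card (V - fst ` M))"
  proof -
    have "(\<Sum>c\<in>C. \<Sum>c'\<in>C'. card {g \<in> tile M c c'. \<beta> s (\<beta> g c') \<in> snd ` M}) =
        (\<Sum>c\<in>C. \<Sum>c'\<in>C'. card {g \<in> F. \<alpha> g c \<notin> fst ` M \<and> (\<beta> g c' \<notin> snd ` M \<and> \<beta> s (\<beta> g c') \<in> snd ` M)})"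
      by (intro sum.cong HOL.refl arg_cong[where f = card]) (auto simp: tile_def)
    also have "\<dots> = (\<Sum>g\<in>F. card {c \<in> C. \<alpha> g c \<notin> fst ` M} *
        card {c \<in> C'. \<beta> g c \<notin> snd ` M \<and> \<beta> s (\<beta> g c) \<in> snd ` M})"
      by (rule sum_card_product[OF finF fin])
    also have "\<dots> \<le> (\<Sum>g\<in>F. card (V - fst ` M) * defect M s)"
      by (intro sum_mono mult_mono X U) auto
    finally show ?thesis by (simp add: mult.commute)
  qed
  \<comment> \<open>Nonnegativity of \<theta> is recovered from \<open>folner\<close> and the
    nonemptiness of \<open>F\<close>.\<close>
  have "0 \<le> \<theta> * card F" using folner[OF s] by (meson of_nat_0_le_iff order_trans)
  then have "0 \<le> \<theta>" using finF F_ne by (simp add: zero_le_mult_iff)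
  then have "card C * (card C' * (\<theta> * card F)) \<le> n * (n * (\<theta> * card F))"
    using CV by (intro mult_mono) auto
  moreover have "(\<Sum>c\<in>C. \<Sum>c'\<in>C'. real (card {g \<in> F. mul s g \<notin> F})) \<le> card C * (card C' * (\<theta> * card F))"
    using folner[OF s] by (simp add: mult_left_mono)
  ultimately have 1: "(\<Sum>c\<in>C. \<Sum>c'\<in>C'. real (card {g \<in> F. mul s g \<notin> F})) \<le> card F * (\<theta> * real n ^ 2)"
    by (simp add: power2_eq_square mult_ac)
  have "(\<Sum>c\<in>C. \<Sum>c'\<in>C'. real (cost M c c' s)) =
      (\<Sum>c\<in>C. \<Sum>c'\<in>C'. real (card {g \<in> F. mul s g \<notin> F})) +
      (real (\<Sum>c\<in>C. \<Sum>c'\<in>C'. card {g \<in> tile M c c'. \<alpha> s (\<alpha> g c) \<in> fst ` M}) +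
       real (\<Sum>c\<in>C. \<Sum>c'\<in>C'. card {g \<in> tile M c c'. \<beta> s (\<beta> g c') \<in> snd ` M}))"
    by (simp add: cost_def sum.distrib)
  also have "\<dots> \<le> card F * (\<theta> * real n ^ 2) + (real (card F * (defect M s * card (V - fst ` M)))
      + real (card F * (defect M s * card (V - fst ` M))))"
    by (intro add_mono 1 of_nat_mono 2 3)
  also have "\<dots> = card F * (\<theta> * real n ^ 2 + 2 * real (defect M s) * card (V - fst ` M))"
    by (simp add: algebra_simps)
  finally show ?thesis .
qed

text \<open>
  In the continuum limit, matching \<open>du\<close> more points costs at most \<open>2 H / u du \<le> 3 H / \<epsilon> du\<close> new defects
  when the defect density is \<open>H\<close> and \<open>u \<ge> \<epsilon>\<close>, whence the exponential.
\<close>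

definition admissible :: "('x \<times> 'y) set \<Rightarrow> bool"
  where "admissible M \<longleftrightarrow> matching M \<and>
    real (\<Sum>s\<in>S. defect M s) \<le> \<eta> * n * exp (3 * card M / (\<epsilon> * n))"

text \<open>Summed over all pairs of good centres, the cost is less than 3 H / \<epsilon> times the
  gain, where H is the allowed defect density. Hence some single pair of centres satisfies the same
  inequality, and 1 + x \<le> exp x turns this into the exponential bound for the larger
  matching.\<close>

lemma admissible_improve:
  assumes M: "admissible M" and large: "\<epsilon> * n \<le> card (V - fst ` M)"
  obtains M' where "admissible M'" "card M < card M'"
proof -
  define u where "u = real (card (V - fst ` M))"
  define H where "H = \<eta> * exp (3 * card M / (\<epsilon> * n))"
  have mat: "matching M" and def: "real (\<Sum>s\<in>S. defect M s) \<le> H * n"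
    using M by (auto simp: admissible_def H_def mult_ac)
  have pos: "0 < \<epsilon> * n" using \<epsilon> n_pos by simp
  have u: "\<epsilon> * n \<le> u" "u \<le> n" "0 < u"
    using large matching_card[OF mat] pos by (auto simp: u_def)
  have H: "\<eta> \<le> H" "0 < H"
    using \<eta> pos by (auto simp: H_def)
  have F_pos: "0 < real (card F)" using finF F_ne by (simp add: card_gt_0_iff)
  have "(\<Sum>c\<in>C. \<Sum>c'\<in>C'. real (\<Sum>s\<in>S. cost M c c' s)) =
      (\<Sum>s\<in>S. \<Sum>c\<in>C. \<Sum>c'\<in>C'. real (cost M c c' s))"
    unfolding of_nat_sum by (rule HOL.trans[OF sum.cong[OF HOL.refl sum.swap] sum.swap])
  also have "\<dots> \<le> (\<Sum>s\<in>S. card F * (\<theta> * real n ^ 2 + 2 * real (defect M s) * u))"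
    unfolding u_def by (intro sum_mono sum_cost_le mat)
  also have "\<dots> = card F * ((card S * \<theta>) * real n ^ 2 + 2 * real (\<Sum>s\<in>S. defect M s) * u)"
    by (simp add: sum.distrib sum_distrib_left[symmetric] sum_distrib_right[symmetric] mult_ac)
  \<comment> \<open>27/10 is 3 times the factor 9/10 of \<open>sum_tile_ge\<close>. Of it, 2 pays
    for collisions, and 7/10 strictly exceeds the 1/2 that leaving \<open>F\<close> costs by the
    choice of \<theta>.\<close>
  also have "\<dots> < card F * ((27/10) * (H * n * u))"
  proof (rule mult_strict_left_mono[OF _ F_pos])
    have "(card S * \<theta>) * real n ^ 2 \<le> (\<eta> * \<epsilon> / 2) * real n ^ 2"
      using \<theta> by (rule mult_right_mono) simp
    also have "\<dots> = \<eta> * n * (\<epsilon> * n) / 2" by (simp add: power2_eq_square)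
    also have "\<dots> \<le> H * n * u / 2" using u H \<eta> pos
      by (intro divide_right_mono mult_mono) auto
    also have "\<dots> < (7/10) * (H * n * u)" using H u n_pos by simp
    finally have "(card S * \<theta>) * real n ^ 2 < (7/10) * (H * n * u)" .
    moreover have "2 * real (\<Sum>s\<in>S. defect M s) * u \<le> 2 * (H * n * u)"
      using mult_right_mono[OF def, of u] u by simp
    ultimately show "(card S * \<theta>) * real n ^ 2 + 2 * real (\<Sum>s\<in>S. defect M s) * u < (27/10) * (H * n * u)"
      by linarith
  qed
  also have "\<dots> \<le> 3 * H / \<epsilon> * ((9/10) * card F * u\<^sup>2)"
  proof -
    have "H * card F * u * (\<epsilon> * n) \<le> H * card F * u * u"
      using u H by (intro mult_left_mono) auto
    then show ?thesis using \<epsilon> by (simp add: field_simps power2_eq_square)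
  qed
  also have "\<dots> \<le> 3 * H / \<epsilon> * (\<Sum>c\<in>C. \<Sum>c'\<in>C'. real (card (tile M c c')))"
    using sum_tile_ge[OF mat large] H \<epsilon> unfolding u_def by (intro mult_left_mono) auto
  also have "\<dots> = (\<Sum>c\<in>C. \<Sum>c'\<in>C'. 3 * H / \<epsilon> * real (card (tile M c c')))"
    by (simp add: sum_distrib_left)
  finally have lt: "(\<Sum>c\<in>C. \<Sum>c'\<in>C'. real (\<Sum>s\<in>S. cost M c c' s)) <
    (\<Sum>c\<in>C. \<Sum>c'\<in>C'. 3 * H / \<epsilon> * real (card (tile M c c')))" .
  have "\<exists>c\<in>C. \<exists>c'\<in>C'. real (\<Sum>s\<in>S. cost M c c' s) < 3 * H / \<epsilon> * real (card (tile M c c'))"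
  proof (rule ccontr)
    assume "\<not> ?thesis"
    then have "(\<Sum>c\<in>C. \<Sum>c'\<in>C'. 3 * H / \<epsilon> * real (card (tile M c c'))) \<le>
        (\<Sum>c\<in>C. \<Sum>c'\<in>C'. real (\<Sum>s\<in>S. cost M c c' s))"
      by (intro sum_mono) (simp add: not_less)
    with lt show False by simp
  qed
  then obtain c c' where c: "c \<in> C" "c' \<in> C'"
    and less: "real (\<Sum>s\<in>S. cost M c c' s) < 3 * H / \<epsilon> * real (card (tile M c c'))" by blast
  define e where "e = real (card (tile M c c'))"
  define M' where "M' = M \<union> (\<lambda>g. (\<alpha> g c, \<beta> g c')) ` tile M c c'"
  note M' = extend_matching[OF mat c, folded M'_def]
  \<comment> \<open>The cost is nonnegative, so the strict inequality forces the tile to be nonempty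
    and the matching really grows.\<close>
  have "0 < 3 * H / \<epsilon> * e" using less unfolding e_def by (meson le_less_trans of_nat_0_le_iff)
  moreover have "0 < 3 * H / \<epsilon>" using H \<epsilon> by simp
  ultimately have e: "0 < e" by (rule zero_less_mult_pos)
  have "real (\<Sum>s\<in>S. defect M' s) \<le> real (\<Sum>s\<in>S. defect M s + cost M c c' s)"
    by (intro of_nat_mono sum_mono M'(3))
  also have "\<dots> \<le> H * n + 3 * H / \<epsilon> * e"
    using def less by (simp add: sum.distrib e_def)
  also have "\<dots> = H * n * (1 + 3 * e / (\<epsilon> * n))"
    using \<epsilon> n_pos by (simp add: field_simps)
  also have "\<dots> \<le> H * n * exp (3 * e / (\<epsilon> * n))"
    using H by (intro mult_left_mono exp_ge_add_one_self) auto
  also have "\<dots> = \<eta> * n * exp (3 * card M / (\<epsilon> * n) + 3 * e / (\<epsilon> * n))"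
    by (simp add: H_def exp_add)
  also have "3 * card M / (\<epsilon> * n) + 3 * e / (\<epsilon> * n) = 3 * card M' / (\<epsilon> * n)"
    unfolding M'(2) by (simp add: e_def add_divide_distrib distrib_left)
  finally have "admissible M'" using M'(1) by (simp add: admissible_def)
  moreover have "card M < card M'" using M'(2) e by (simp add: e_def)
  ultimately show ?thesis by (rule that)
qed

text \<open>By \<open>admissible_improve\<close>, a largest admissible matching leaves fewer than
  \<epsilon> n points unmatched. It has at most n pairs, which bounds its defects by \<eta> exp(3 /
  \<epsilon>) n. A bijection extending it can fail to intertwine only at unmatched points and at
  defective pairs.\<close>

lemma almost_equivariant_bijection:
  obtains \<tau> where "bij_betw \<tau> V W"
    "\<And>s. s \<in> S \<Longrightarrow> real (card {x \<in> V. \<tau> (\<alpha> s x) \<noteq> \<beta> s (\<tau> x)}) \<le> (\<epsilon> + \<eta> * exp (3 / \<epsilon>)) * n"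
proof -
  have "admissible {}"
    using \<eta> by (simp add: admissible_def matching_def defect_def)
  moreover have "card M < Suc n" if "admissible M" for M
    using that matching_card(5)[of M] by (simp add: admissible_def)
  ultimately obtain M where M: "admissible M" and max: "\<And>M'. admissible M' \<Longrightarrow> card M' \<le> card M"
    using ex_has_greatest_nat[of admissible "{}" card "Suc n"] by blast
  have mat: "matching M" using M by (simp add: admissible_def)
  have small: "card (V - fst ` M) < \<epsilon> * n"
  proof (rule ccontr)
    assume "\<not> ?thesis"
    then have "\<epsilon> * n \<le> card (V - fst ` M)" by simp
    from admissible_improve[OF M this] obtain M' where "admissible M'" "card M < card M'" .
    with max[of M'] show False by simp
  qed
  have "real (\<Sum>s\<in>S. defect M s) \<le> \<eta> * n * exp (3 * card M / (\<epsilon> * n))"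
    using M by (simp add: admissible_def)
  also have "\<dots> \<le> \<eta> * n * exp (3 * n / (\<epsilon> * n))"
    using matching_card(5)[OF mat] \<epsilon> \<eta>
    by (intro mult_left_mono exp_le_cancel_iff[THEN iffD2] divide_right_mono) auto
  also have "\<dots> = \<eta> * exp (3 / \<epsilon>) * n" using n_pos by simp
  finally have def: "real (\<Sum>s\<in>S. defect M s) \<le> \<eta> * exp (3 / \<epsilon>) * n" .
  define \<sigma> where "\<sigma> = (\<lambda>x. snd (inv_into M fst x))"
  have \<sigma>: "\<sigma> x = y" if "(x, y) \<in> M" for x y
    using inv_into_f_f[of fst M "(x, y)"] that mat by (simp add: \<sigma>_def matching_def)
  have "inj_on \<sigma> (fst ` M)"
    using mat \<sigma> by (auto simp: matching_def inj_on_def) (metis snd_conv fst_conv)+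
  moreover have "\<sigma> ` fst ` M \<subseteq> W" using mat \<sigma> by (force simp: matching_def)
  moreover have "fst ` M \<subseteq> V" using mat by (auto simp: matching_def)
  ultimately obtain \<tau> where \<tau>: "bij_betw \<tau> V W" "\<And>x. x \<in> fst ` M \<Longrightarrow> \<tau> x = \<sigma> x"
    using bij_betw_extend[OF finV finW] cardV cardW by metis
  have \<tau>M: "\<tau> x = y" if "(x, y) \<in> M" for x y using \<tau>(2)[of x] \<sigma>[OF that] that by force
  show ?thesis
  proof (rule that[OF \<tau>(1)])
    fix s assume s: "s \<in> S"
    let ?B = "{z \<in> M. map_prod (\<alpha> s) (\<beta> s) z \<notin> M}"
    have fin: "finite ?B" using matching_finite[OF mat] by simp
    have "{x \<in> V. \<tau> (\<alpha> s x) \<noteq> \<beta> s (\<tau> x)} \<subseteq> (V - fst ` M) \<union> fst ` ?B"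
    proof
      fix x assume x: "x \<in> {x \<in> V. \<tau> (\<alpha> s x) \<noteq> \<beta> s (\<tau> x)}"
      show "x \<in> (V - fst ` M) \<union> fst ` ?B"
      proof (cases "x \<in> fst ` M")
        case True
        then obtain y where y: "(x, y) \<in> M" by auto
        then have "(\<alpha> s x, \<beta> s y) \<notin> M" using x \<tau>M by auto
        then have "(x, y) \<in> ?B" using y by simp
        then show ?thesis by force
      qed (use x in auto)
    qed
    then have "card {x \<in> V. \<tau> (\<alpha> s x) \<noteq> \<beta> s (\<tau> x)} \<le> card ((V - fst ` M) \<union> fst ` ?B)"
      using finV fin by (intro card_mono) auto
    also have "\<dots> \<le> card (V - fst ` M) + card (fst ` ?B)" by (rule card_Un_le)
    also have "card (fst ` ?B) \<le> defect M s" unfolding defect_def using fin by (rule card_image_le)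
    also have "defect M s \<le> (\<Sum>s\<in>S. defect M s)" using finS s by (rule member_le_sum[rotated -1]) auto
    finally have "card {x \<in> V. \<tau> (\<alpha> s x) \<noteq> \<beta> s (\<tau> x)} \<le> card (V - fst ` M) + (\<Sum>s\<in>S. defect M s)"
      by simp
    then show "real (card {x \<in> V. \<tau> (\<alpha> s x) \<noteq> \<beta> s (\<tau> x)}) \<le> (\<epsilon> + \<eta> * exp (3 / \<epsilon>)) * n"
      using small def unfolding distrib_right by linarith
  qed
qed

end

section \<open>Approximations of amenable groups\<close>

lemma ham_eq_1_minus:
  assumes "finite V" "V \<noteq> {}"
  shows "ham V \<rho> \<sigma> = 1 - real (card {x \<in> V. \<rho> x = \<sigma> x}) / real (card V)"
proof -
  have "{x \<in> V. \<rho> x \<noteq> \<sigma> x} = V - {x \<in> V. \<rho> x = \<sigma> x}" by auto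
  then have "real (card {x \<in> V. \<rho> x \<noteq> \<sigma> x}) = card V - real (card {x \<in> V. \<rho> x = \<sigma> x})"
    using assms by (simp add: card_Diff_subset card_mono of_nat_diff)
  then show ?thesis using assms by (simp add: ham_def diff_divide_distrib)
qed

lemma card_not_mem_translate:
  assumes "group G" "s \<in> carrier G" "F \<subseteq> carrier G" "finite F"
  shows "card {g \<in> F. s \<otimes>\<^bsub>G\<^esub> g \<notin> F} \<le> card (sym_diff (s <#\<^bsub>G\<^esub> F) F)"
proof -
  interpret group G by fact
  have fin: "finite (s <#\<^bsub>G\<^esub> F)" using assms(4) by (simp add: l_coset_def)
  have "card {g \<in> F. s \<otimes>\<^bsub>G\<^esub> g \<notin> F} = card ((\<otimes>\<^bsub>G\<^esub>) s ` {g \<in> F. s \<otimes>\<^bsub>G\<^esub> g \<notin> F})"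
    using assms by (intro card_image[symmetric]) (auto simp: inj_on_def subset_iff)
  also have "\<dots> \<le> card (sym_diff (s <#\<^bsub>G\<^esub> F) F)"
    using fin assms(4) by (intro card_mono) (auto simp: l_coset_def)
  finally show ?thesis .
qed

lemma amenable_folner:
  assumes "group G" "amenable G" "finite S" "S \<subseteq> carrier G" "(\<theta> :: real) > 0"
  obtains F where "finite F" "F \<noteq> {}" "F \<subseteq> carrier G"
    "\<And>s. s \<in> S \<Longrightarrow> real (card {g \<in> F. s \<otimes>\<^bsub>G\<^esub> g \<notin> F}) < \<theta> * card F"
proof -
  obtain F where F: "finite F" "F \<noteq> {}" "F \<subseteq> carrier G"
    "\<And>s. s \<in> S \<Longrightarrow> real (card (sym_diff (s <#\<^bsub>G\<^esub> F) F)) < \<theta> * card F"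
    using assms unfolding amenable_def by metis
  have "real (card {g \<in> F. s \<otimes>\<^bsub>G\<^esub> g \<notin> F}) < \<theta> * card F" if "s \<in> S" for s
  proof -
    have "s \<in> carrier G" using that assms(4) by auto
    then have "card {g \<in> F. s \<otimes>\<^bsub>G\<^esub> g \<notin> F} \<le> card (sym_diff (s <#\<^bsub>G\<^esub> F) F)"
      using card_not_mem_translate[OF assms(1)] F by simp
    then show ?thesis using F(4)[OF that] by linarith
  qed
  then show ?thesis using that F by blast
qed

text \<open>Left translation by \<open>g\<close> is a partial injection of a Foelner set into
  itself, completed arbitrarily to a bijection. Multiplicativity can fail at x only if h x or g h x
  leaves the set; these two events account for the \<delta> / 2.\<close>

lemma amenable_approx_on:
  fixes G :: "('a, 'b) monoid_scheme"
  assumes "group G" "amenable G" "finite S" "S \<subseteq> carrier G" "(\<delta> :: real) > 0"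
  obtains F :: "'a set" and \<psi> where "approx_on G S \<delta> F \<psi>"
proof -
  interpret group G by fact
  obtain F where F: "finite F" "F \<noteq> {}" "F \<subseteq> carrier G"
    and small: "\<And>s. s \<in> S \<Longrightarrow> real (card {g \<in> F. s \<otimes>\<^bsub>G\<^esub> g \<notin> F}) < \<delta> / 2 * card F"
    using amenable_folner[OF assms(1-4), of "\<delta> / 2"] assms(5) by auto
  have F_pos: "0 < real (card F)" using F by (simp add: card_gt_0_iff)
  have "\<exists>\<tau>. bij_betw \<tau> F F \<and> (\<forall>x\<in>F. g \<otimes>\<^bsub>G\<^esub> x \<in> F \<longrightarrow> \<tau> x = g \<otimes>\<^bsub>G\<^esub> x)" if g: "g \<in> carrier G" for g
  proof -
    have "inj_on ((\<otimes>\<^bsub>G\<^esub>) g) {x \<in> F. g \<otimes>\<^bsub>G\<^esub> x \<in> F}"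
      using F g by (auto simp: inj_on_def subset_iff)
    from bij_betw_extend[OF F(1) F(1) HOL.refl _ this] show ?thesis
      by (metis (no_types, lifting) image_Collect_subsetI mem_Collect_eq subsetI)
  qed
  then obtain \<psi> where \<psi>: "\<And>g. g \<in> carrier G \<Longrightarrow> bij_betw (\<psi> g) F F"
    "\<And>g x. g \<in> carrier G \<Longrightarrow> x \<in> F \<Longrightarrow> g \<otimes>\<^bsub>G\<^esub> x \<in> F \<Longrightarrow> \<psi> g x = g \<otimes>\<^bsub>G\<^esub> x"
    by metis
  have "approx_on G S \<delta> F \<psi>"
    unfolding approx_on_def
  proof (intro conjI ballI impI)
    fix g h assume gh: "g \<in> S" "h \<in> S" "g \<otimes>\<^bsub>G\<^esub> h \<in> S"
    then have car: "g \<in> carrier G" "h \<in> carrier G" using assms(4) by auto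
    have "{x \<in> F. (\<psi> g \<circ> \<psi> h) x \<noteq> \<psi> (g \<otimes>\<^bsub>G\<^esub> h) x} \<subseteq>
        {x \<in> F. h \<otimes>\<^bsub>G\<^esub> x \<notin> F} \<union> {x \<in> F. (g \<otimes>\<^bsub>G\<^esub> h) \<otimes>\<^bsub>G\<^esub> x \<notin> F}"
    proof (rule subsetI, rule ccontr)
      fix x assume x: "x \<in> {x \<in> F. (\<psi> g \<circ> \<psi> h) x \<noteq> \<psi> (g \<otimes>\<^bsub>G\<^esub> h) x}"
        "x \<notin> {x \<in> F. h \<otimes>\<^bsub>G\<^esub> x \<notin> F} \<union> {x \<in> F. (g \<otimes>\<^bsub>G\<^esub> h) \<otimes>\<^bsub>G\<^esub> x \<notin> F}"
      then have "x \<in> carrier G" using F by auto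
      with x show False using car \<psi>(2)[of h x] \<psi>(2)[of g "h \<otimes>\<^bsub>G\<^esub> x"] \<psi>(2)[of "g \<otimes>\<^bsub>G\<^esub> h" x]
        by (simp add: m_assoc)
    qed
    then have "card {x \<in> F. (\<psi> g \<circ> \<psi> h) x \<noteq> \<psi> (g \<otimes>\<^bsub>G\<^esub> h) x} \<le>
        card ({x \<in> F. h \<otimes>\<^bsub>G\<^esub> x \<notin> F} \<union> {x \<in> F. (g \<otimes>\<^bsub>G\<^esub> h) \<otimes>\<^bsub>G\<^esub> x \<notin> F})"
      using F(1) by (intro card_mono) auto
    also have "\<dots> \<le> card {x \<in> F. h \<otimes>\<^bsub>G\<^esub> x \<notin> F} + card {x \<in> F. (g \<otimes>\<^bsub>G\<^esub> h) \<otimes>\<^bsub>G\<^esub> x \<notin> F}"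
      by (rule card_Un_le)
    finally show "ham F (\<psi> g \<circ> \<psi> h) (\<psi> (g \<otimes>\<^bsub>G\<^esub> h)) < \<delta>"
      using small[OF gh(2)] small[OF gh(3)] F_pos unfolding ham_def
      by (simp add: divide_less_eq)
  next
    fix g assume g: "g \<in> S - {\<one>\<^bsub>G\<^esub>}"
    \<comment> \<open>Translation by a nontrivial element has no fixed points, so every fixed point
      comes from the arbitrary completion.\<close>
    have "card {x \<in> F. \<psi> g x = id x} \<le> card {x \<in> F. g \<otimes>\<^bsub>G\<^esub> x \<notin> F}"
    proof (intro card_mono subsetI)
      fix x assume x: "x \<in> {x \<in> F. \<psi> g x = id x}"
      have "g \<in> carrier G" "x \<in> carrier G" using x g assms(4) F by auto
      then show "x \<in> {x \<in> F. g \<otimes>\<^bsub>G\<^esub> x \<notin> F}"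
        using x g \<psi>(2)[of g x] by (auto simp: r_cancel_one')
    qed (use F in auto)
    then have "real (card {x \<in> F. \<psi> g x = id x}) < \<delta> * card F"
      using small[of g] g F_pos assms(5) mult_pos_pos[OF assms(5) F_pos] by auto
    then show "1 - \<delta> < ham F (\<psi> g) id"
      using F_pos unfolding ham_eq_1_minus[OF F(1,2)] by (simp add: divide_less_eq)
  qed (use F \<psi> in auto)
  then show ?thesis by (rule that)
qed

lemma ham_copies:
  assumes "finite J" "J \<noteq> {}"
  shows "ham (V \<times> J) (map_prod \<rho> id) (map_prod \<sigma> id) = ham V \<rho> \<sigma>"
proof -
  have "{z \<in> V \<times> J. map_prod \<rho> id z \<noteq> map_prod \<sigma> id z} = {x \<in> V. \<rho> x \<noteq> \<sigma> x} \<times> J"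
    by auto
  moreover have "0 < real (card J)" using assms by (simp add: card_gt_0_iff)
  ultimately show ?thesis by (simp add: ham_def card_cartesian_product)
qed

lemma approx_on_copies:
  assumes "approx_on G S \<delta> V \<psi>" "finite J" "J \<noteq> {}"
  shows "approx_on G S \<delta> (V \<times> J) (\<lambda>g. map_prod (\<psi> g) id)"
proof -
  have "ham (V \<times> J) (map_prod (\<psi> g) id \<circ> map_prod (\<psi> h) id) (map_prod (\<psi> (g \<otimes>\<^bsub>G\<^esub> h)) id) =
      ham V (\<psi> g \<circ> \<psi> h) (\<psi> (g \<otimes>\<^bsub>G\<^esub> h))" for g h
    using ham_copies[OF assms(2,3), of V "\<psi> g \<circ> \<psi> h"] by (simp add: map_prod_compose[symmetric])
  moreover have "ham (V \<times> J) (map_prod (\<psi> g) id) id = ham V (\<psi> g) id" for g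
    using ham_copies[OF assms(2,3), of V "\<psi> g" id] by (simp add: prod.map_id0)
  moreover have "bij_betw (map_prod (\<psi> g) id) (V \<times> J) (V \<times> J)" if "g \<in> carrier G" for g
    using assms(1) that by (intro bij_betw_map_prod) (auto simp: approx_on_def)
  ultimately show ?thesis using assms by (simp add: approx_on_def)
qed

text \<open>Disjoint copies leave all normalized distances unchanged, and \<open>Suc N\<close>
  copies of a nonempty set have more than \<open>N\<close> points.\<close>

lemma amenable_large_sofic_approximation:
  fixes G :: "('a, 'b) monoid_scheme"
  assumes "group G" "amenable G" "finite S" "S \<subseteq> carrier G" "(\<delta> :: real) > 0"
  obtains n \<psi> where "n > N" "sofic_approximation G S \<delta> n \<psi>"
proof -
  obtain F :: "'a set" and \<psi> where F: "approx_on G S \<delta> F \<psi>" using amenable_approx_on[OF assms] .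
  let ?V = "F \<times> {..N}"
  have V: "approx_on G S \<delta> ?V (\<lambda>g. map_prod (\<psi> g) id)" using F by (intro approx_on_copies) auto
  have "finite ?V" using F by (auto simp: approx_on_def)
  then obtain h where h: "bij_betw h ?V {1..card ?V}"
    by (metis finite_same_card_bij finite_atLeastAtMost card_atLeastAtMost diff_Suc_1)
  have "0 < card F" using F by (auto simp: approx_on_def card_gt_0_iff)
  then have "1 * Suc N \<le> card F * Suc N" by (intro mult_le_mono1) simp
  then have "N < card ?V" by (simp only: card_cartesian_product card_atMost mult_1)
  then show ?thesis using that sofic_approximation_relabel[OF V h assms(1,4)] by blast
qed

lemma card_UN_le_mult:
  fixes b :: real
  assumes "finite I" "\<And>i. i \<in> I \<Longrightarrow> real (card (A i)) \<le> b"
  shows "real (card (\<Union>i\<in>I. A i)) \<le> card I * b"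
proof -
  have "real (card (\<Union>i\<in>I. A i)) \<le> real (\<Sum>i\<in>I. card (A i))"
    by (intro of_nat_mono card_UN_le assms(1))
  also have "\<dots> \<le> (\<Sum>i\<in>I. b)" unfolding of_nat_sum by (intro sum_mono assms(2))
  finally show ?thesis by simp
qed

text \<open>If \<open>g\<close> and \<open>h\<close> sent c to the same point, and the product of h
  with h^{-1} g were exact at c, then h^{-1} g would fix c. So it suffices to discard the failures
  of products s g, the failures of products h (h^{-1} g), and the fixed points of nontrivial
  quotients h^{-1} g. These are at most |S| |F|, |F|^2 and |F|^2 sets, each of proportion at most
  \<delta>.\<close>

lemma approx_on_good_points:
  fixes \<delta> :: real
  assumes "group G" and ap: "approx_on G S' \<delta> V \<psi>" and "finite S" "finite F"
    and S: "S \<subseteq> carrier G" "S \<subseteq> S'" and F: "F \<subseteq> carrier G" "F \<subseteq> S'"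
    and div: "\<And>g h. g \<in> F \<Longrightarrow> h \<in> F \<Longrightarrow> inv\<^bsub>G\<^esub> h \<otimes>\<^bsub>G\<^esub> g \<in> S'" and "\<delta> > 0"
  obtains C where "C \<subseteq> V"
    "real (card (V - C)) \<le> real (card S * card F + 2 * (card F * card F)) * \<delta> * card V"
    "\<And>c. c \<in> C \<Longrightarrow> inj_on (\<lambda>g. \<psi> g c) F"
    "\<And>c s g. c \<in> C \<Longrightarrow> s \<in> S \<Longrightarrow> g \<in> F \<Longrightarrow> s \<otimes>\<^bsub>G\<^esub> g \<in> F \<Longrightarrow> \<psi> s (\<psi> g c) = \<psi> (s \<otimes>\<^bsub>G\<^esub> g) c"
proof -
  interpret group G by fact
  have V: "finite V" "V \<noteq> {}" using ap by (auto simp: approx_on_def)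
  then have V_pos: "0 < real (card V)" by (simp add: card_gt_0_iff)
  define Bad where "Bad = (\<lambda>(g, h). {c \<in> V. \<psi> g (\<psi> h c) \<noteq> \<psi> (g \<otimes>\<^bsub>G\<^esub> h) c})"
  define Fix where "Fix g = {c \<in> V. \<psi> g c = c}" for g
  have Bad: "real (card (Bad (g, h))) \<le> \<delta> * card V" if "g \<in> S'" "h \<in> S'" "g \<otimes>\<^bsub>G\<^esub> h \<in> S'" for g h
  proof -
    have "ham V (\<psi> g \<circ> \<psi> h) (\<psi> (g \<otimes>\<^bsub>G\<^esub> h)) < \<delta>" using ap that by (simp add: approx_on_def)
    then show ?thesis using V_pos by (simp add: Bad_def ham_def divide_less_eq)
  qed
  have Fix: "real (card (Fix g)) \<le> \<delta> * card V" if "g \<in> S'" "g \<noteq> \<one>\<^bsub>G\<^esub>" for g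
  proof -
    have "ham V (\<psi> g) id > 1 - \<delta>" using ap that by (simp add: approx_on_def)
    then show ?thesis using V_pos unfolding ham_eq_1_minus[OF V] by (simp add: Fix_def divide_less_eq)
  qed
  define I where "I = {(s, g) \<in> S \<times> F. s \<otimes>\<^bsub>G\<^esub> g \<in> F}"
  define J where "J = {(h, g) \<in> F \<times> F. h \<noteq> g}"
  define B1 where "B1 = (\<Union>i\<in>I. Bad i)"
  define B2 where "B2 = (\<Union>(h, g)\<in>J. Bad (h, inv\<^bsub>G\<^esub> h \<otimes>\<^bsub>G\<^esub> g))"
  define B3 where "B3 = (\<Union>(h, g)\<in>J. Fix (inv\<^bsub>G\<^esub> h \<otimes>\<^bsub>G\<^esub> g))"
  have sub: "I \<subseteq> S \<times> F" "J \<subseteq> F \<times> F" by (auto simp: I_def J_def)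
  have fin: "finite I" "finite J"
    using finite_subset[OF sub(1)] finite_subset[OF sub(2)] assms(3,4) by auto
  have cI: "card I \<le> card S * card F" and cJ: "card J \<le> card F * card F"
    using card_mono[OF _ sub(1)] card_mono[OF _ sub(2)] assms(3,4)
    by (auto simp: card_cartesian_product)
  have neq: "inv\<^bsub>G\<^esub> h \<otimes>\<^bsub>G\<^esub> g \<noteq> \<one>\<^bsub>G\<^esub>" if "(h, g) \<in> J" for h g
    using that F by (auto simp: J_def subset_iff) (metis inv_closed inv_equality inv_inv inv_comm)
  have cancel: "h \<otimes>\<^bsub>G\<^esub> (inv\<^bsub>G\<^esub> h \<otimes>\<^bsub>G\<^esub> g) = g" if "h \<in> F" "g \<in> F" for h g
    using that F by (simp add: subset_iff m_assoc[symmetric])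
  have \<delta>V: "0 \<le> \<delta> * card V" using assms(10) by simp
  have "real (card B1) \<le> card I * (\<delta> * card V)"
    unfolding B1_def using S F by (intro card_UN_le_mult fin) (auto simp: I_def intro!: Bad)
  also have "\<dots> \<le> (card S * card F) * (\<delta> * card V)"
    using cI by (intro mult_right_mono \<delta>V of_nat_mono)
  finally have b1: "real (card B1) \<le> (card S * card F) * (\<delta> * card V)" .
  have "real (card B2) \<le> card J * (\<delta> * card V)"
    unfolding B2_def using F div cancel by (intro card_UN_le_mult fin) (auto simp: J_def intro!: Bad)
  also have "\<dots> \<le> (card F * card F) * (\<delta> * card V)"
    using cJ by (intro mult_right_mono \<delta>V of_nat_mono)
  finally have b2: "real (card B2) \<le> (card F * card F) * (\<delta> * card V)" .
  have "real (card B3) \<le> card J * (\<delta> * card V)"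
    unfolding B3_def using F div neq by (intro card_UN_le_mult fin) (auto simp: J_def intro!: Fix)
  also have "\<dots> \<le> (card F * card F) * (\<delta> * card V)"
    using cJ by (intro mult_right_mono \<delta>V of_nat_mono)
  finally have b3: "real (card B3) \<le> (card F * card F) * (\<delta> * card V)" .
  define C where "C = V - (B1 \<union> (B2 \<union> B3))"
  show ?thesis
  proof (rule that[of C])
    show "C \<subseteq> V" by (auto simp: C_def)
    have sub: "B1 \<union> (B2 \<union> B3) \<subseteq> V"
      by (auto simp: B1_def B2_def B3_def Bad_def Fix_def)
    then have "card (V - C) = card (B1 \<union> (B2 \<union> B3))" by (simp add: C_def double_diff)
    also have "\<dots> \<le> card B1 + card (B2 \<union> B3)" by (rule card_Un_le)
    also have "card (B2 \<union> B3) \<le> card B2 + card B3" by (rule card_Un_le)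
    finally have "real (card (V - C)) \<le> real (card B1) + (real (card B2) + real (card B3))" by simp
    then show "real (card (V - C)) \<le> real (card S * card F + 2 * (card F * card F)) * \<delta> * card V"
      using b1 b2 b3 by (simp add: algebra_simps)
  next
    fix c s g assume "c \<in> C" "s \<in> S" "g \<in> F" "s \<otimes>\<^bsub>G\<^esub> g \<in> F"
    then show "\<psi> s (\<psi> g c) = \<psi> (s \<otimes>\<^bsub>G\<^esub> g) c"
      by (auto simp: C_def B1_def I_def Bad_def)
  next
    fix c assume c: "c \<in> C"
    show "inj_on (\<lambda>g. \<psi> g c) F"
    proof (rule inj_onI, rule ccontr)
      fix g h assume gh: "g \<in> F" "h \<in> F" "\<psi> g c = \<psi> h c" "g \<noteq> h"
      let ?q = "inv\<^bsub>G\<^esub> h \<otimes>\<^bsub>G\<^esub> g"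
      have J: "(h, g) \<in> J" using gh by (auto simp: J_def)
      have "c \<in> V" "c \<notin> Bad (h, ?q)" "c \<notin> Fix ?q" using c J by (auto simp: C_def B2_def B3_def)
      then have "\<psi> h (\<psi> ?q c) = \<psi> h c" "\<psi> ?q c \<noteq> c"
        using gh cancel[of h g] by (auto simp: Bad_def Fix_def)
      moreover have "inj_on (\<psi> h) V" "\<psi> ?q c \<in> V"
      proof -
        have "h \<in> carrier G" "?q \<in> carrier G" using gh F by auto
        then show "inj_on (\<psi> h) V" "\<psi> ?q c \<in> V"
          using ap \<open>c \<in> V\<close> unfolding approx_on_def bij_betw_def by auto
      qed
      ultimately show False using \<open>c \<in> V\<close> by (auto dest: inj_onD)
    qed
  qed
qed

lemma sym_group_pow: "f [^]\<^bsub>sym_group n\<^esub> (k :: nat) = f ^^ k"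
  by (induction k) (simp_all add: sym_group_def nat_pow_def funpow_Suc_right del: funpow.simps(2))

lemma relabel_funpow:
  assumes "inj_on h V" "\<rho> ` V \<subseteq> V"
  shows "relabel V h (\<rho> ^^ k) = relabel V h \<rho> ^^ k"
proof (induction k)
  case (Suc k)
  have "(\<rho> ^^ k) ` V \<subseteq> V" using assms(2) by (induction k) auto
  then show ?case using relabel_comp[OF assms(1), of "\<rho> ^^ k" \<rho>] Suc by (simp only: funpow.simps(2))
qed (simp only: funpow.simps relabel_id)

section \<open>Twisting permutations\<close>

text \<open>The clause on \<open>f\<close> common to conditions (2) and (3): \<open>f\<close> plays
  the role of t, up to \<epsilon> in the conjugation relation but exactly in the relation on its
  order.\<close>

definition twisting_perm ::
  "nat \<Rightarrow> nat \<Rightarrow> 'a set \<Rightarrow> 'a set \<Rightarrow> 'a set \<Rightarrow> ('a \<Rightarrow> 'a) \<Rightarrow> real \<Rightarrow> ('a \<Rightarrow> nat \<Rightarrow> nat) \<Rightarrow> (nat \<Rightarrow> nat) \<Rightarrow> bool"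
  where "twisting_perm k n S A B \<phi> \<epsilon> \<psi> f \<longleftrightarrow>
    f \<in> carrier (sym_group n) \<and> f [^]\<^bsub>sym_group n\<^esub> k = \<one>\<^bsub>sym_group n\<^esub> \<and>
    (\<forall>b \<in> S \<inter> {b \<in> B. \<phi> b \<in> A \<inter> S}. hamming_dist n (\<psi> b \<circ> f) (f \<circ> \<psi> (\<phi> b)) < \<epsilon>)"

lemma twisting_perm_mono:
  assumes "twisting_perm k n S' A B \<phi> \<epsilon>' \<psi> f" "S \<subseteq> S'" "\<epsilon>' \<le> \<epsilon>"
  shows "twisting_perm k n S A B \<phi> \<epsilon> \<psi> f"
  unfolding twisting_perm_def
proof (intro conjI ballI)
  fix b assume "b \<in> S \<inter> {b \<in> B. \<phi> b \<in> A \<inter> S}"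
  then have "hamming_dist n (\<psi> b \<circ> f) (f \<circ> \<psi> (\<phi> b)) < \<epsilon>'"
    using assms(1,2) unfolding twisting_perm_def by blast
  with assms(3) show "hamming_dist n (\<psi> b \<circ> f) (f \<circ> \<psi> (\<phi> b)) < \<epsilon>" by linarith
qed (use assms in \<open>auto simp: twisting_perm_def\<close>)

section \<open>Filling n points with copies of a fixed approximation\<close>

definition copies_with_rest :: "nat \<Rightarrow> nat \<Rightarrow> (nat \<times> nat + nat) set"
  where "copies_with_rest n\<^sub>0 n = ({1..n\<^sub>0} \<times> {..<n div n\<^sub>0}) <+> {..<n mod n\<^sub>0}"

definition copy_perm :: "(nat \<Rightarrow> nat) \<Rightarrow> nat \<times> nat + nat \<Rightarrow> nat \<times> nat + nat"
  where "copy_perm \<rho> = map_sum (map_prod \<rho> id) id"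

lemma finite_copies_with_rest: "finite (copies_with_rest n\<^sub>0 n)"
  by (simp add: copies_with_rest_def)

lemma card_copies_with_rest: "card (copies_with_rest n\<^sub>0 n) = n"
  by (simp add: copies_with_rest_def card_Plus card_cartesian_product)

lemma copy_perm_comp: "copy_perm (\<rho> \<circ> \<sigma>) = copy_perm \<rho> \<circ> copy_perm \<sigma>"
  by (simp add: copy_perm_def map_sum.comp map_prod_compose[symmetric])

lemma copy_perm_id: "copy_perm id = id"
  by (simp add: copy_perm_def prod.map_id0 sum.map_id0)

lemma copy_perm_funpow: "copy_perm \<rho> ^^ k = copy_perm (\<rho> ^^ k)"
  by (induction k) (simp_all only: funpow.simps copy_perm_id copy_perm_comp)

lemma bij_betw_copy_perm:
  assumes "bij_betw \<rho> {1..n\<^sub>0} {1..n\<^sub>0}"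
  shows "bij_betw (copy_perm \<rho>) (copies_with_rest n\<^sub>0 n) (copies_with_rest n\<^sub>0 n)"
proof -
  have inj: "inj_on \<rho> {1..n\<^sub>0}" using assms by (rule bij_betw_imp_inj_on)
  have "inj_on (copy_perm \<rho>) (copies_with_rest n\<^sub>0 n)"
  proof (rule inj_onI)
    fix v w assume "v \<in> copies_with_rest n\<^sub>0 n" "w \<in> copies_with_rest n\<^sub>0 n" "copy_perm \<rho> v = copy_perm \<rho> w"
    then show "v = w"
      using inj_onD[OF inj] by (auto simp: copy_perm_def copies_with_rest_def)
  qed
  moreover have "copy_perm \<rho> ` copies_with_rest n\<^sub>0 n \<subseteq> copies_with_rest n\<^sub>0 n"
    using bij_betw_apply[OF assms] by (auto simp: copy_perm_def copies_with_rest_def)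
  ultimately show ?thesis
    unfolding bij_betw_def using endo_inj_surj[OF finite_copies_with_rest] by blast
qed

text \<open>Any two \<open>copy_perm\<close> agree on the left-over points, and the copies occupy at
  most n points in total, so distances can only shrink. Approximate equations thus survive the
  remainder.\<close>

lemma ham_copy_perm_le:
  "ham (copies_with_rest n\<^sub>0 n) (copy_perm \<rho>) (copy_perm \<sigma>) \<le> ham {1..n\<^sub>0} \<rho> \<sigma>"
proof (cases "n = 0 \<or> n\<^sub>0 = 0")
  case True
  then have "{w \<in> copies_with_rest n\<^sub>0 n. copy_perm \<rho> w \<noteq> copy_perm \<sigma> w} = {}"
    by (auto simp: copies_with_rest_def copy_perm_def)
  then have "ham (copies_with_rest n\<^sub>0 n) (copy_perm \<rho>) (copy_perm \<sigma>) = 0"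
    by (simp only: ham_def card.empty of_nat_0 div_0)
  then show ?thesis by (simp add: ham_nonneg)
next
  case False
  let ?D = "{i \<in> {1..n\<^sub>0}. \<rho> i \<noteq> \<sigma> i}"
  have "{w \<in> copies_with_rest n\<^sub>0 n. copy_perm \<rho> w \<noteq> copy_perm \<sigma> w} = Inl ` (?D \<times> {..<n div n\<^sub>0})"
    by (auto simp: copies_with_rest_def copy_perm_def)
  then have "card {w \<in> copies_with_rest n\<^sub>0 n. copy_perm \<rho> w \<noteq> copy_perm \<sigma> w} = card ?D * (n div n\<^sub>0)"
    by (simp add: card_image card_cartesian_product)
  moreover have "real (n div n\<^sub>0) \<le> n / n\<^sub>0" by (rule of_nat_div_le_of_nat)
  then have "real (card ?D) * real (n div n\<^sub>0) \<le> real (card ?D) * (n / n\<^sub>0)"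
    by (rule mult_left_mono) simp
  ultimately show ?thesis
    using False by (simp add: ham_def card_copies_with_rest field_simps)
qed

text \<open>One reference approximation with a twisting permutation is fixed in advance. A given
  large approximation is almost conjugate to copies of it, and the copied twisting permutation is
  pulled back through the conjugacy; being an exact conjugate, it keeps its order.\<close>

lemma amenable_twisting_perm_transfer:
  fixes G :: "('a, 'b) monoid_scheme"
  assumes "group G" "amenable G" and S: "finite S" "S \<subseteq> carrier G" and "\<epsilon> > 0"
    and ex: "\<And>S' \<delta> \<epsilon>'. finite S' \<Longrightarrow> S' \<subseteq> carrier G \<Longrightarrow> \<delta> > 0 \<Longrightarrow> \<epsilon>' > 0 \<Longrightarrow>
      \<exists>n \<psi> f. sofic_approximation G S' \<delta> n \<psi> \<and> twisting_perm k n S' A B \<phi> \<epsilon>' \<psi> f"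
  obtains S' \<delta> N where "finite S'" "S' \<subseteq> carrier G" "S \<subseteq> S'" "\<delta> > 0"
    "\<And>n \<psi>. n > N \<Longrightarrow> sofic_approximation G S' \<delta> n \<psi> \<Longrightarrow> \<exists>f. twisting_perm k n S A B \<phi> \<epsilon> \<psi> f"
proof -
  interpret group G by fact
  \<comment> \<open>The matching error is e + \<eta> exp(3 / e) = 2 e = \<epsilon> / 4. It is
    incurred for \<open>b\<close> and for \<open>\<phi> b\<close>; with the reference error
    \<epsilon> / 3 the total is 5 \<epsilon> / 6.\<close>
  define e where "e = \<epsilon> / 8"
  define \<eta> where "\<eta> = e * exp (- 3 / e)"
  \<comment> \<open>The summand 1 keeps the denominator positive when \<open>S\<close> is
    empty.\<close>
  define \<theta> where "\<theta> = \<eta> * e / 2 / (card S + 1)"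
  define \<kappa> where "\<kappa> = e / 20"
  have pos: "0 < e" "0 < \<eta>" "0 < \<theta>" "0 < \<kappa>"
    using assms(5) by (auto simp: e_def \<eta>_def \<theta>_def \<kappa>_def intro!: divide_pos_pos mult_pos_pos)
  obtain F where F: "finite F" "F \<noteq> {}" "F \<subseteq> carrier G"
    and folner: "\<And>s. s \<in> S \<Longrightarrow> real (card {g \<in> F. s \<otimes>\<^bsub>G\<^esub> g \<notin> F}) < \<theta> * card F"
    using amenable_folner[OF assms(1,2) S pos(3)] by blast
  define S' where "S' = S \<union> F \<union> (\<lambda>(g, h). inv\<^bsub>G\<^esub> h \<otimes>\<^bsub>G\<^esub> g) ` (F \<times> F)"
  define c where "c = real (card S * card F + 2 * (card F * card F))"
  define \<delta> where "\<delta> = \<kappa> / 2 / (c + 1)"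
  have S': "finite S'" "S' \<subseteq> carrier G" "S \<subseteq> S'" "F \<subseteq> S'"
    "\<And>g h. g \<in> F \<Longrightarrow> h \<in> F \<Longrightarrow> inv\<^bsub>G\<^esub> h \<otimes>\<^bsub>G\<^esub> g \<in> S'"
    using S F by (auto simp: S'_def subset_iff)
  have c: "0 \<le> c" by (simp add: c_def)
  then have \<delta>: "0 < \<delta>" "c * \<delta> \<le> \<kappa> / 2"
    using pos by (auto simp: \<delta>_def field_simps)
  obtain n\<^sub>0 \<psi>\<^sub>0 f\<^sub>0 where ap\<^sub>0: "sofic_approximation G S' \<delta> n\<^sub>0 \<psi>\<^sub>0"
    and tw\<^sub>0: "twisting_perm k n\<^sub>0 S' A B \<phi> (\<epsilon> / 3) \<psi>\<^sub>0 f\<^sub>0"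
    using ex[OF S'(1,2) \<delta>(1), of "\<epsilon> / 3"] assms(5) by auto
  have n\<^sub>0: "0 < n\<^sub>0" using ap\<^sub>0 by (simp add: sofic_approximation_def)
  obtain C\<^sub>0 where C\<^sub>0: "C\<^sub>0 \<subseteq> {1..n\<^sub>0}" "real (card ({1..n\<^sub>0} - C\<^sub>0)) \<le> c * \<delta> * card {1..n\<^sub>0}"
    "\<And>c. c \<in> C\<^sub>0 \<Longrightarrow> inj_on (\<lambda>g. \<psi>\<^sub>0 g c) F"
    "\<And>c s g. c \<in> C\<^sub>0 \<Longrightarrow> s \<in> S \<Longrightarrow> g \<in> F \<Longrightarrow> s \<otimes>\<^bsub>G\<^esub> g \<in> F \<Longrightarrow> \<psi>\<^sub>0 s (\<psi>\<^sub>0 g c) = \<psi>\<^sub>0 (s \<otimes>\<^bsub>G\<^esub> g) c"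
    unfolding c_def
    using approx_on_good_points[OF assms(1) sofic_approximation_imp_approx_on[OF ap\<^sub>0] S(1) F(1) S(2) S'(3)
        F(3) S'(4,5) \<delta>(1)] by blast
  \<comment> \<open>Of the proportion \<kappa> of points allowed not to be good centres, one half is
    for bad points in the copies and the other for the fewer than \<open>n\<^sub>0\<close> left-over
    points, none of which is used as a centre. Hence the requirement \<open>n\<^sub>0\<close> \<le>
    \<kappa> n / 2.\<close>
  define N where "N = nat \<lceil>2 * n\<^sub>0 / \<kappa>\<rceil>"
  have main: "\<exists>f. twisting_perm k n S A B \<phi> \<epsilon> \<psi> f"
    if n: "n > N" and ap: "sofic_approximation G S' \<delta> n \<psi>" for n \<psi>
  proof -
    have n_pos: "0 < n" using n by simp
    have "2 * n\<^sub>0 / \<kappa> \<le> n" using n unfolding N_def by linarith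
    then have nn\<^sub>0: "n\<^sub>0 \<le> \<kappa> / 2 * n" using pos by (simp add: field_simps)
    let ?V = "{1..n}" and ?W = "copies_with_rest n\<^sub>0 n"
    define \<beta> where "\<beta> g = copy_perm (\<psi>\<^sub>0 g)" for g
    have bij_\<psi>: "bij_betw (\<psi> g) ?V ?V" if "g \<in> carrier G" for g
      using sofic_approximation_imp_approx_on[OF ap] that by (simp add: approx_on_def)
    have bij_\<beta>: "bij_betw (\<beta> g) ?W ?W" if "g \<in> carrier G" for g
      using sofic_approximation_imp_approx_on[OF ap\<^sub>0] that
      unfolding \<beta>_def by (intro bij_betw_copy_perm) (simp add: approx_on_def)
    obtain C where C: "C \<subseteq> ?V" "real (card (?V - C)) \<le> c * \<delta> * card ?V"
      "\<And>c. c \<in> C \<Longrightarrow> inj_on (\<lambda>g. \<psi> g c) F"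
      "\<And>c s g. c \<in> C \<Longrightarrow> s \<in> S \<Longrightarrow> g \<in> F \<Longrightarrow> s \<otimes>\<^bsub>G\<^esub> g \<in> F \<Longrightarrow> \<psi> s (\<psi> g c) = \<psi> (s \<otimes>\<^bsub>G\<^esub> g) c"
      unfolding c_def
      using approx_on_good_points[OF assms(1) sofic_approximation_imp_approx_on[OF ap] S(1) F(1) S(2) S'(3)
          F(3) S'(4,5) \<delta>(1)] by blast
    define C' where "C' = (Inl ` (C\<^sub>0 \<times> {..<n div n\<^sub>0}) :: (nat \<times> nat + nat) set)"
    have fm: "folner_matching S F (\<otimes>\<^bsub>G\<^esub>) ?V ?W \<psi> \<beta> C C' n e \<eta> \<theta>"
    proof
      show "finite ?W" "card ?W = n" by (rule finite_copies_with_rest card_copies_with_rest)+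
      show "bij_betw (\<psi> g) ?V ?V" "bij_betw (\<beta> g) ?W ?W" if "g \<in> S \<union> F" for g
        using that S F bij_\<psi> bij_\<beta> by auto
      have "c * \<delta> * n \<le> \<kappa> / 2 * n" using \<delta>(2) by (intro mult_right_mono) auto
      also have "\<dots> \<le> \<kappa> * n" using pos by simp
      finally show "real (card (?V - C)) \<le> e / 20 * n" using C(2) by (simp add: \<kappa>_def)
      show "C' \<subseteq> ?W" using C\<^sub>0(1) by (auto simp: C'_def copies_with_rest_def)
      have "?W - C' \<subseteq> (({1..n\<^sub>0} - C\<^sub>0) \<times> {..<n div n\<^sub>0}) <+> {..<n mod n\<^sub>0}"
        by (auto simp: C'_def copies_with_rest_def)
      then have "card (?W - C') \<le> card ((({1..n\<^sub>0} - C\<^sub>0) \<times> {..<n div n\<^sub>0}) <+> {..<n mod n\<^sub>0})"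
        by (intro card_mono) auto
      also have "\<dots> = card ({1..n\<^sub>0} - C\<^sub>0) * (n div n\<^sub>0) + n mod n\<^sub>0"
        by (simp add: card_Plus card_cartesian_product)
      finally have "real (card (?W - C')) \<le> real (card ({1..n\<^sub>0} - C\<^sub>0)) * real (n div n\<^sub>0) + real (n mod n\<^sub>0)"
        by (metis of_nat_add of_nat_le_iff of_nat_mult)
      also have "\<dots> \<le> (\<kappa> / 2 * n\<^sub>0) * real (n div n\<^sub>0) + n\<^sub>0"
      proof (intro add_mono mult_right_mono)
        have "c * \<delta> * n\<^sub>0 \<le> \<kappa> / 2 * n\<^sub>0" using \<delta>(2) by (intro mult_right_mono) auto
        then show "real (card ({1..n\<^sub>0} - C\<^sub>0)) \<le> \<kappa> / 2 * n\<^sub>0" using C\<^sub>0(2) by simp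
        show "real (n mod n\<^sub>0) \<le> real n\<^sub>0" using n\<^sub>0 by (simp add: less_imp_le)
      qed simp
      also have "\<dots> = \<kappa> / 2 * real (n\<^sub>0 * (n div n\<^sub>0)) + n\<^sub>0" by simp
      also have "\<dots> \<le> \<kappa> / 2 * n + \<kappa> / 2 * n"
        using pos nn\<^sub>0 by (intro add_mono mult_left_mono of_nat_mono) auto
      finally show "real (card (?W - C')) \<le> e / 20 * n" by (simp add: \<kappa>_def)
      show "inj_on (\<lambda>g. \<beta> g w) F" if "w \<in> C'" for w
        using that C\<^sub>0(3) by (fastforce simp: C'_def \<beta>_def copy_perm_def inj_on_def)
      show "\<beta> s (\<beta> g w) = \<beta> (s \<otimes>\<^bsub>G\<^esub> g) w" if "w \<in> C'" "s \<in> S" "g \<in> F" "s \<otimes>\<^bsub>G\<^esub> g \<in> F" for w s g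
        using that C\<^sub>0(4) by (auto simp: C'_def \<beta>_def copy_perm_def)
      show "real (card {g \<in> F. s \<otimes>\<^bsub>G\<^esub> g \<notin> F}) \<le> \<theta> * card F" if "s \<in> S" for s
        using folner[OF that] by simp
      have "card S * \<theta> \<le> (card S + 1) * \<theta>" using pos by (intro mult_right_mono) auto
      also have "\<dots> = \<eta> * e / 2"
        using nonzero_mult_div_cancel_left[of "real (card S + 1)" "\<eta> * e / 2"]
        unfolding \<theta>_def times_divide_eq_right[symmetric] by simp
      finally show "card S * \<theta> \<le> \<eta> * e / 2" .
    qed (use S F n_pos pos C(1,3,4) in auto)
    obtain \<tau> where \<tau>: "bij_betw \<tau> ?V ?W"
      "\<And>s. s \<in> S \<Longrightarrow> real (card {x \<in> ?V. \<tau> (\<psi> s x) \<noteq> \<beta> s (\<tau> x)}) \<le> (e + \<eta> * exp (3 / e)) * n"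
      using folner_matching.almost_equivariant_bijection[OF fm] by blast
    have \<eta>_exp: "\<eta> * exp (3 / e) = e" by (simp add: \<eta>_def exp_minus)
    have bad: "real (card {x \<in> ?V. \<tau> (\<psi> s x) \<noteq> \<beta> s (\<tau> x)}) \<le> \<epsilon> / 4 * n" if "s \<in> S" for s
      using \<tau>(2)[OF that] unfolding \<eta>_exp by (simp add: e_def)
    define h where "h = inv_into ?V \<tau>"
    have h: "bij_betw h ?W ?V" unfolding h_def by (rule bij_betw_inv_into[OF \<tau>(1)])
    then have h_inj: "inj_on h ?W" and h_im: "h ` ?W = ?V" by (auto simp: bij_betw_def)
    define g where "g = copy_perm f\<^sub>0"
    have f\<^sub>0: "f\<^sub>0 permutes {1..n\<^sub>0}" "f\<^sub>0 ^^ k = id"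
      using tw\<^sub>0 by (auto simp: twisting_perm_def sym_group_pow sym_group_carrier sym_group_one)
    have g: "bij_betw g ?W ?W" unfolding g_def by (intro bij_betw_copy_perm permutes_imp_bij f\<^sub>0)
    have gk: "g ^^ k = id" by (simp add: g_def copy_perm_funpow f\<^sub>0 copy_perm_id)
    define f where "f = relabel ?W h g"
    have f: "f permutes ?V" using relabel_permutes[OF h_inj g] by (simp add: f_def h_im)
    have \<tau>f: "\<tau> (f x) = g (\<tau> x)" if "x \<in> ?V" for x
    proof -
      have "\<tau> x \<in> ?W" "h (\<tau> x) = x"
        using \<tau>(1) that by (auto simp: h_def bij_betw_def inv_into_f_f)
      then have "f x = h (g (\<tau> x))" using relabel_apply[OF h_inj, of "\<tau> x" g] by (simp add: f_def)
      moreover have "g (\<tau> x) \<in> ?W" using g \<open>\<tau> x \<in> ?W\<close> by (auto simp: bij_betw_def)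
      ultimately show ?thesis using \<tau>(1) by (simp add: h_def bij_betw_inv_into_right)
    qed
    have "twisting_perm k n S A B \<phi> \<epsilon> \<psi> f"
      unfolding twisting_perm_def sym_group_pow sym_group_carrier sym_group_one
    proof (intro conjI ballI f)
      show "f ^^ k = id"
        using relabel_funpow[OF h_inj, of g k] g gk by (simp add: f_def relabel_id bij_betw_def)
    next
      fix b assume b: "b \<in> S \<inter> {b \<in> B. \<phi> b \<in> A \<inter> S}"
      let ?bad = "\<lambda>s. {x \<in> ?V. \<tau> (\<psi> s x) \<noteq> \<beta> s (\<tau> x)}"
      let ?D = "{w \<in> ?W. (\<beta> b \<circ> g) w \<noteq> (g \<circ> \<beta> (\<phi> b)) w}"
      have car: "b \<in> carrier G" "\<phi> b \<in> carrier G" and bS: "b \<in> S" "\<phi> b \<in> S" using b S by auto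
      \<comment> \<open>The relation holds at x if \<tau> intertwines \<open>b\<close> at f x and
        \<open>\<phi> b\<close> at x, and the reference relation holds at \<tau> x. The first and
        last failure sets are pulled back along bijections, so their sizes are unchanged.\<close>
      have "{x \<in> ?V. (\<psi> b \<circ> f) x \<noteq> (f \<circ> \<psi> (\<phi> b)) x} \<subseteq>
          {x \<in> ?V. f x \<in> ?bad b} \<union> (?bad (\<phi> b) \<union> {x \<in> ?V. \<tau> x \<in> ?D})"
      proof (rule subsetI, rule ccontr)
        fix x assume x: "x \<in> {x \<in> ?V. (\<psi> b \<circ> f) x \<noteq> (f \<circ> \<psi> (\<phi> b)) x}"
          "x \<notin> {x \<in> ?V. f x \<in> ?bad b} \<union> (?bad (\<phi> b) \<union> {x \<in> ?V. \<tau> x \<in> ?D})"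
        have fx: "x \<in> ?V" "f x \<in> ?V" using x permutes_in_image[OF f] by auto
        have px: "\<psi> b (f x) \<in> ?V" "\<psi> (\<phi> b) x \<in> ?V" "\<tau> x \<in> ?W"
          using bij_betw_apply[OF bij_\<psi>] bij_betw_apply[OF \<tau>(1)] car fx by blast+
        have "\<tau> (\<psi> b (f x)) = \<beta> b (g (\<tau> x))" using x fx \<tau>f by auto
        also have "\<dots> = g (\<beta> (\<phi> b) (\<tau> x))" using x fx px by auto
        also have "\<dots> = \<tau> (f (\<psi> (\<phi> b) x))" using x fx px \<tau>f by auto
        finally have "\<psi> b (f x) = f (\<psi> (\<phi> b) x)"
          using \<tau>(1) px permutes_in_image[OF f] by (auto simp: bij_betw_def dest!: inj_onD)
        then show False using x by simp
      qed
      then have "card {x \<in> ?V. (\<psi> b \<circ> f) x \<noteq> (f \<circ> \<psi> (\<phi> b)) x} \<le>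
          card ({x \<in> ?V. f x \<in> ?bad b} \<union> (?bad (\<phi> b) \<union> {x \<in> ?V. \<tau> x \<in> ?D}))"
        by (intro card_mono) auto
      also have "\<dots> \<le> card {x \<in> ?V. f x \<in> ?bad b} + card (?bad (\<phi> b) \<union> {x \<in> ?V. \<tau> x \<in> ?D})"
        by (rule card_Un_le)
      also have "card (?bad (\<phi> b) \<union> {x \<in> ?V. \<tau> x \<in> ?D}) \<le> card (?bad (\<phi> b)) + card {x \<in> ?V. \<tau> x \<in> ?D}"
        by (rule card_Un_le)
      also have "card {x \<in> ?V. f x \<in> ?bad b} = card {x \<in> ?V. x \<in> ?bad b}"
        by (rule card_Collect_bij_betw[OF permutes_imp_bij[OF f]])
      also have "{x \<in> ?V. x \<in> ?bad b} = ?bad b" by auto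
      also have "card {x \<in> ?V. \<tau> x \<in> ?D} = card {w \<in> ?W. w \<in> ?D}"
        by (rule card_Collect_bij_betw[OF \<tau>(1)])
      also have "{w \<in> ?W. w \<in> ?D} = ?D" by auto
      finally have "real (card {x \<in> ?V. (\<psi> b \<circ> f) x \<noteq> (f \<circ> \<psi> (\<phi> b)) x}) \<le>
          real (card (?bad b)) + (real (card (?bad (\<phi> b))) + real (card ?D))"
        by simp
      moreover have "ham ?W (\<beta> b \<circ> g) (g \<circ> \<beta> (\<phi> b)) < \<epsilon> / 3"
      proof -
        have "ham ?W (\<beta> b \<circ> g) (g \<circ> \<beta> (\<phi> b)) \<le> ham {1..n\<^sub>0} (\<psi>\<^sub>0 b \<circ> f\<^sub>0) (f\<^sub>0 \<circ> \<psi>\<^sub>0 (\<phi> b))"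
          unfolding \<beta>_def g_def copy_perm_comp[symmetric] by (rule ham_copy_perm_le)
        also have "\<dots> < \<epsilon> / 3"
          using tw\<^sub>0 b S'(3) unfolding twisting_perm_def hamming_dist_eq_ham by blast
        finally show ?thesis .
      qed
      then have "real (card ?D) < \<epsilon> / 3 * n"
        using n_pos by (simp add: ham_def card_copies_with_rest divide_less_eq)
      ultimately have "real (card {x \<in> ?V. (\<psi> b \<circ> f) x \<noteq> (f \<circ> \<psi> (\<phi> b)) x}) <
          \<epsilon> / 4 * n + (\<epsilon> / 4 * n + \<epsilon> / 3 * n)"
        using bad[OF bS(1)] bad[OF bS(2)] by linarith
      also have "\<dots> \<le> \<epsilon> * n" using assms(5) by (simp add: field_simps)
      finally show "hamming_dist n (\<psi> b \<circ> f) (f \<circ> \<psi> (\<phi> b)) < \<epsilon>"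
        using n_pos by (simp add: hamming_dist_def divide_less_eq)
    qed
    then show ?thesis by blast
  qed
  show ?thesis by (rule that[OF S'(1,2,3) \<delta>(1) main])
qed

section \<open>From sofic quotients to twisting permutations\<close>

text \<open>\<open>f\<close> commutes with its powers, so the fixed points of \<open>f ^^ k\<close>
  form a set invariant under \<open>f\<close> in both directions, as does its complement. On the
  former \<open>g\<close> is \<open>f\<close>, on the latter the identity.\<close>

lemma permutes_funpow_truncate:
  fixes k :: nat
  assumes f: "f permutes A" and "finite A"
  defines "g \<equiv> \<lambda>i. if (f ^^ k) i = i then f i else i"
  shows "g permutes A" "g ^^ k = id" "ham A g f \<le> ham A (f ^^ k) id"
proof -
  have fix_iff: "(f ^^ k) (f i) = f i \<longleftrightarrow> (f ^^ k) i = i" for i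
    using permutes_inj[OF f] by (simp add: funpow_swap1[symmetric] inj_eq)
  have "inj_on g A"
  proof (rule inj_onI)
    fix x y assume "g x = g y"
    then show "x = y"
      using fix_iff[of x] fix_iff[of y]
      by (auto simp: g_def inj_eq[OF permutes_inj[OF f]] split: if_splits)
  qed
  moreover have "g ` A \<subseteq> A" using permutes_in_image[OF f] by (auto simp: g_def)
  ultimately have "bij_betw g A A"
    unfolding bij_betw_def using endo_inj_surj[OF \<open>finite A\<close>] by blast
  then show "g permutes A"
    by (rule bij_imp_permutes) (use permutes_not_in[OF f] in \<open>auto simp: g_def\<close>)
  show "g ^^ k = id"
  proof
    fix i
    show "(g ^^ k) i = id i"
    proof (cases "(f ^^ k) i = i")
      case True
      have "(g ^^ j) i = (f ^^ j) i \<and> (f ^^ k) ((f ^^ j) i) = (f ^^ j) i" for j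
        by (induction j) (use True fix_iff in \<open>auto simp: g_def\<close>)
      then show ?thesis using True by simp
    next
      case False
      then have "(g ^^ j) i = i" for j by (induction j) (auto simp: g_def)
      then show ?thesis by simp
    qed
  qed
  have "card {i \<in> A. g i \<noteq> f i} \<le> card {i \<in> A. (f ^^ k) i \<noteq> id i}"
    using \<open>finite A\<close> by (intro card_mono) (auto simp: g_def)
  then show "ham A g f \<le> ham A (f ^^ k) id" by (simp add: ham_def divide_right_mono)
qed

lemma sofic_imp_twisting_perm:
  fixes G :: "('a, 'b) monoid_scheme" and Q :: "('c, 'd) monoid_scheme"
  assumes "group G" "group Q" "sofic Q" and q: "q \<in> hom G Q" "inj_on q (carrier G)"
    and t: "t \<in> carrier Q" "t [^]\<^bsub>Q\<^esub> k = \<one>\<^bsub>Q\<^esub>"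
    and rel: "\<And>b. b \<in> B \<Longrightarrow> q b \<otimes>\<^bsub>Q\<^esub> t = t \<otimes>\<^bsub>Q\<^esub> q (\<phi> b)"
    and S: "finite S" "S \<subseteq> carrier G" and pos: "\<delta> > 0" "\<epsilon> > 0"
  shows "\<exists>n \<psi> f. sofic_approximation G S \<delta> n \<psi> \<and> twisting_perm k n S A B \<phi> \<epsilon> \<psi> f"
proof -
  interpret G: group G by fact
  interpret Q: group Q by fact
  interpret q: group_hom G Q q by unfold_locales (rule q)
  \<comment> \<open>2 k + 6 = 2 (k + 2) + 2: truncating the image of t costs (k + 2) d on each side
    of the relation, and each of the two products q b t and t q(\<phi> b) costs d.\<close>
  define d where "d = min \<delta> (\<epsilon> / (2 * k + 6))"
  define T where "T = q ` S \<union> (\<lambda>j::nat. t [^]\<^bsub>Q\<^esub> j) ` {..k} \<union> {t, \<one>\<^bsub>Q\<^esub>} \<union> (\<lambda>b. q b \<otimes>\<^bsub>Q\<^esub> t) ` S"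
  have "d \<le> \<epsilon> / (2 * real k + 6)" by (simp add: d_def)
  then have "(2 * real k + 6) * d \<le> \<epsilon>" by (subst (asm) pos_le_divide_eq) (simp_all add: mult.commute)
  then have d: "0 < d" "d \<le> \<delta>" "(2 * real k + 6) * d \<le> \<epsilon>"
    using pos by (simp_all add: d_def)
  have T: "finite T" "T \<subseteq> carrier Q" using S t(1) by (auto simp: T_def)
  then obtain n \<Psi> where ap: "sofic_approximation Q T d n \<Psi>"
    using assms(3) d(1) unfolding sofic_def by blast
  have n: "n \<ge> 1" and perm: "\<And>x. x \<in> carrier Q \<Longrightarrow> \<Psi> x permutes {1..n}"
    using ap by (auto simp: sofic_approximation_def sym_group_def Pi_iff)
  have mult: "ham {1..n} (\<Psi> x \<circ> \<Psi> y) (\<Psi> (x \<otimes>\<^bsub>Q\<^esub> y)) < d"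
    if "x \<in> T" "y \<in> T" "x \<otimes>\<^bsub>Q\<^esub> y \<in> T" for x y
    using ap that by (auto simp: sofic_approximation_def sym_group_def hamming_dist_eq_ham)
  have im: "\<Psi> x ` {1..n} \<subseteq> {1..n}" if "x \<in> carrier Q" for x
    using permutes_image[OF perm[OF that]] by simp
  have left: "ham {1..n} (\<Psi> x \<circ> \<rho>) (\<Psi> x \<circ> \<sigma>) = ham {1..n} \<rho> \<sigma>"
    if "x \<in> carrier Q" "\<rho> permutes {1..n}" "\<sigma> permutes {1..n}" for x \<rho> \<sigma>
    using that perm permutes_image[OF that(2)] permutes_image[OF that(3)]
    by (intro ham_comp_left) (auto intro: permutes_inj_on)
  have right: "ham {1..n} (\<rho> \<circ> \<Psi> x) (\<sigma> \<circ> \<Psi> x) = ham {1..n} \<rho> \<sigma>" if "x \<in> carrier Q" for x \<rho> \<sigma>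
    by (rule ham_comp_right[OF permutes_imp_bij[OF perm[OF that]]])
  \<comment> \<open>An approximation need not send the unit to the identity, but its value there is
    nearly idempotent, and cancelling one factor gives the claim.\<close>
  have one: "ham {1..n} (\<Psi> \<one>\<^bsub>Q\<^esub>) id < d"
    using mult[of "\<one>\<^bsub>Q\<^esub>" "\<one>\<^bsub>Q\<^esub>"] left[of "\<one>\<^bsub>Q\<^esub>" "\<Psi> \<one>\<^bsub>Q\<^esub>" id] perm by (simp add: T_def permutes_id)
  define f\<^sub>0 where "f\<^sub>0 = \<Psi> t"
  have f\<^sub>0: "f\<^sub>0 permutes {1..n}" using perm t(1) by (simp add: f\<^sub>0_def)
  have pow: "ham {1..n} (f\<^sub>0 ^^ j) (\<Psi> (t [^]\<^bsub>Q\<^esub> j)) \<le> (j + 1) * d" if "j \<le> k" for j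
    using that
  proof (induction j)
    case 0
    then show ?case using one by (simp add: ham_commute id_def)
  next
    case (Suc j)
    have eq: "f\<^sub>0 ^^ Suc j = (f\<^sub>0 ^^ j) \<circ> \<Psi> t" by (simp add: f\<^sub>0_def funpow_Suc_right del: funpow.simps)
    have "ham {1..n} (f\<^sub>0 ^^ Suc j) (\<Psi> (t [^]\<^bsub>Q\<^esub> Suc j)) \<le>
        ham {1..n} (f\<^sub>0 ^^ Suc j) (\<Psi> (t [^]\<^bsub>Q\<^esub> j) \<circ> \<Psi> t) +
        ham {1..n} (\<Psi> (t [^]\<^bsub>Q\<^esub> j) \<circ> \<Psi> t) (\<Psi> (t [^]\<^bsub>Q\<^esub> Suc j))"
      by (rule ham_triangle) simp
    also have "ham {1..n} (f\<^sub>0 ^^ Suc j) (\<Psi> (t [^]\<^bsub>Q\<^esub> j) \<circ> \<Psi> t) = ham {1..n} (f\<^sub>0 ^^ j) (\<Psi> (t [^]\<^bsub>Q\<^esub> j))"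
      unfolding eq by (rule right[OF t(1)])
    also have "\<dots> \<le> (j + 1) * d" using Suc by (simp add: add.commute)
    also have "ham {1..n} (\<Psi> (t [^]\<^bsub>Q\<^esub> j) \<circ> \<Psi> t) (\<Psi> (t [^]\<^bsub>Q\<^esub> Suc j)) \<le> d"
    proof -
      have "t [^]\<^bsub>Q\<^esub> j \<in> T" using Suc.prems by (auto simp: T_def)
      moreover have "t [^]\<^bsub>Q\<^esub> Suc j \<in> T" using Suc.prems unfolding T_def by blast
      ultimately show ?thesis using mult[of "t [^]\<^bsub>Q\<^esub> j" t] by (simp add: T_def)
    qed
    finally show ?case by (simp add: distrib_right)
  qed
  define f where "f i = (if (f\<^sub>0 ^^ k) i = i then f\<^sub>0 i else i)" for i
  note f = permutes_funpow_truncate[OF f\<^sub>0 finite_atLeastAtMost, of k, folded f_def]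
  \<comment> \<open>By \<open>pow\<close>, the k-th power is within (k + 1) d of the value at t^k,
    which is the unit of Q; a further d leads to the identity.\<close>
  have "ham {1..n} (f\<^sub>0 ^^ k) id \<le> ham {1..n} (f\<^sub>0 ^^ k) (\<Psi> \<one>\<^bsub>Q\<^esub>) + ham {1..n} (\<Psi> \<one>\<^bsub>Q\<^esub>) id"
    by (rule ham_triangle) simp
  also have "\<dots> \<le> (k + 1) * d + d" using pow[of k] one by (simp add: t(2) add.commute)
  finally have close: "ham {1..n} f f\<^sub>0 \<le> (real k + 2) * d" using f(3) by (simp add: distrib_right)
  let ?\<psi> = "\<lambda>g. \<Psi> (q g)"
  have "sofic_approximation G S \<delta> n ?\<psi>"
    unfolding sofic_approximation_def
  proof (intro conjI ballI impI n)
    show "?\<psi> \<in> carrier G \<rightarrow> carrier (sym_group n)" using perm by (simp add: sym_group_def)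
  next
    fix g h assume "g \<in> S" "h \<in> S" "g \<otimes>\<^bsub>G\<^esub> h \<in> S"
    then have "q g \<in> T" "q h \<in> T" "q g \<otimes>\<^bsub>Q\<^esub> q h \<in> T" "q (g \<otimes>\<^bsub>G\<^esub> h) = q g \<otimes>\<^bsub>Q\<^esub> q h"
      using S(2) by (auto simp: T_def subset_iff q.hom_mult[symmetric] simp del: q.hom_mult)
    with mult[of "q g" "q h"] d(2)
    show "hamming_dist n (?\<psi> g \<otimes>\<^bsub>sym_group n\<^esub> ?\<psi> h) (?\<psi> (g \<otimes>\<^bsub>G\<^esub> h)) < \<delta>"
      by (simp add: sym_group_def hamming_dist_eq_ham)
  next
    fix g assume g: "g \<in> S - {\<one>\<^bsub>G\<^esub>}"
    then have "q g \<noteq> q \<one>\<^bsub>G\<^esub>" using S(2) inj_onD[OF q(2), of g "\<one>\<^bsub>G\<^esub>"] by auto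
    then have "q g \<in> T - {\<one>\<^bsub>Q\<^esub>}" using g by (auto simp: T_def)
    then have "hamming_dist n (?\<psi> g) id > 1 - d" using ap by (simp add: sofic_approximation_def)
    with d(2) show "1 - \<delta> < hamming_dist n (?\<psi> g) id" by simp
  qed
  moreover have "twisting_perm k n S A B \<phi> \<epsilon> ?\<psi> f"
    unfolding twisting_perm_def sym_group_pow sym_group_carrier sym_group_one hamming_dist_eq_ham
  proof (intro conjI ballI f(1,2))
    fix b assume b: "b \<in> S \<inter> {b \<in> B. \<phi> b \<in> A \<inter> S}"
    then have car: "q b \<in> carrier Q" "q (\<phi> b) \<in> carrier Q" using S(2) by auto
    have inT: "q b \<in> T" "q (\<phi> b) \<in> T" "t \<in> T" "q b \<otimes>\<^bsub>Q\<^esub> t \<in> T" using b by (auto simp: T_def)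
    \<comment> \<open>The chain passes through the value at q b t = t q(\<phi> b), the only place
      where the relation in Q enters.\<close>
    have "ham {1..n} (?\<psi> b \<circ> f) (f \<circ> ?\<psi> (\<phi> b)) \<le>
        ham {1..n} (?\<psi> b \<circ> f) (?\<psi> b \<circ> f\<^sub>0) + ham {1..n} (?\<psi> b \<circ> f\<^sub>0) (f \<circ> ?\<psi> (\<phi> b))"
      by (rule ham_triangle) simp
    also have "ham {1..n} (?\<psi> b \<circ> f\<^sub>0) (f \<circ> ?\<psi> (\<phi> b)) \<le>
        ham {1..n} (?\<psi> b \<circ> f\<^sub>0) (\<Psi> (q b \<otimes>\<^bsub>Q\<^esub> t)) + ham {1..n} (\<Psi> (q b \<otimes>\<^bsub>Q\<^esub> t)) (f \<circ> ?\<psi> (\<phi> b))"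
      by (rule ham_triangle) simp
    also have "ham {1..n} (\<Psi> (q b \<otimes>\<^bsub>Q\<^esub> t)) (f \<circ> ?\<psi> (\<phi> b)) \<le>
        ham {1..n} (\<Psi> (q b \<otimes>\<^bsub>Q\<^esub> t)) (f\<^sub>0 \<circ> ?\<psi> (\<phi> b)) + ham {1..n} (f\<^sub>0 \<circ> ?\<psi> (\<phi> b)) (f \<circ> ?\<psi> (\<phi> b))"
      by (rule ham_triangle) simp
    also have "ham {1..n} (?\<psi> b \<circ> f) (?\<psi> b \<circ> f\<^sub>0) = ham {1..n} f f\<^sub>0"
      using left[OF car(1) f(1) f\<^sub>0] .
    also have "ham {1..n} (f\<^sub>0 \<circ> ?\<psi> (\<phi> b)) (f \<circ> ?\<psi> (\<phi> b)) = ham {1..n} f f\<^sub>0"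
      using right[OF car(2), of f\<^sub>0 f] by (simp add: ham_commute)
    finally have "ham {1..n} (?\<psi> b \<circ> f) (f \<circ> ?\<psi> (\<phi> b)) \<le>
        ham {1..n} f f\<^sub>0 + (ham {1..n} (?\<psi> b \<circ> f\<^sub>0) (\<Psi> (q b \<otimes>\<^bsub>Q\<^esub> t)) +
        (ham {1..n} (\<Psi> (q b \<otimes>\<^bsub>Q\<^esub> t)) (f\<^sub>0 \<circ> ?\<psi> (\<phi> b)) + ham {1..n} f f\<^sub>0))" by linarith
    moreover have "ham {1..n} (?\<psi> b \<circ> f\<^sub>0) (\<Psi> (q b \<otimes>\<^bsub>Q\<^esub> t)) < d"
      unfolding f\<^sub>0_def by (intro mult inT)
    moreover have "ham {1..n} (\<Psi> (q b \<otimes>\<^bsub>Q\<^esub> t)) (f\<^sub>0 \<circ> ?\<psi> (\<phi> b)) < d"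
      using mult[of t "q (\<phi> b)"] inT rel[of b] b by (simp add: f\<^sub>0_def ham_commute)
    moreover have "(real k + 2) * d + (d + (d + (real k + 2) * d)) = (2 * real k + 6) * d"
      by (simp add: algebra_simps)
    ultimately show "ham {1..n} (?\<psi> b \<circ> f) (f \<circ> ?\<psi> (\<phi> b)) < \<epsilon>" using close d(3) by linarith
  qed
  ultimately show ?thesis by blast
qed

section \<open>Limits of word lengths\<close>

text \<open>The members of \<open>\<A>\<close> act as a filter base. In the compact cube of
  functions into [0,1] the closures of their images under \<open>D\<close> have the finite
  intersection property, and any common point serves as \<open>L\<close>: fixing finitely many
  coordinates up to \<eta> gives an open neighbourhood of it.\<close>

lemma cluster_point:
  fixes D :: "'i \<Rightarrow> 'p \<Rightarrow> real"
  assumes ne: "\<A> \<noteq> {}" "\<And>A. A \<in> \<A> \<Longrightarrow> A \<noteq> {}"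
    and dir: "\<And>A B. A \<in> \<A> \<Longrightarrow> B \<in> \<A> \<Longrightarrow> \<exists>C\<in>\<A>. C \<subseteq> A \<inter> B"
    and bounded: "\<And>i p. 0 \<le> D i p" "\<And>i p. D i p \<le> 1"
  obtains L where "\<And>A P \<eta>. A \<in> \<A> \<Longrightarrow> finite P \<Longrightarrow> \<eta> > 0 \<Longrightarrow> \<exists>i\<in>A. \<forall>p\<in>P. \<bar>D i p - L p\<bar> < \<eta>"
proof -
  let ?K = "PiE UNIV (\<lambda>_. {0..1}) :: ('p \<Rightarrow> real) set"
  have "compactin (product_topology (\<lambda>_. euclidean) UNIV) ?K"
    unfolding compactin_PiE by simp
  then have "compact ?K" by (simp add: euclidean_product_topology)
  then have "?K \<inter> (\<Inter>A\<in>\<A>. closure (D ` A)) \<noteq> {}"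
  proof (rule compact_imp_fip_image)
    fix \<F> assume "finite \<F>" "\<F> \<subseteq> \<A>"
    then have "\<exists>C\<in>\<A>. \<forall>A\<in>\<F>. C \<subseteq> A"
    proof (induction \<F>)
      case empty
      then show ?case using ne by auto
    next
      case (insert A \<F>)
      then obtain C where "C \<in> \<A>" "\<forall>A\<in>\<F>. C \<subseteq> A" by auto
      then show ?case using dir[of A C] insert.prems by (metis insert_iff insert_subset le_inf_iff order_trans)
    qed
    then obtain C where C: "C \<in> \<A>" "\<forall>A\<in>\<F>. C \<subseteq> A" by blast
    then obtain i where i: "i \<in> C" using ne(2)[OF C(1)] by blast
    have "D i \<in> ?K" using bounded by auto
    moreover have "D i \<in> closure (D ` A)" if "A \<in> \<F>" for A
      using that C i closure_subset[of "D ` A"] by auto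
    ultimately show "?K \<inter> (\<Inter>A\<in>\<F>. closure (D ` A)) \<noteq> {}" by blast
  qed simp
  then obtain L where L: "\<And>A. A \<in> \<A> \<Longrightarrow> L \<in> closure (D ` A)" by blast
  show ?thesis
  proof (rule that[of L])
    fix A and P :: "'p set" and \<eta> :: real assume A: "A \<in> \<A>" "finite P" "\<eta> > 0"
    let ?U = "{l. \<forall>p\<in>P. l p \<in> {L p - \<eta><..<L p + \<eta>}}"
    have "open ?U" using product_topology_basis'[OF A(2), of "\<lambda>p. {L p - \<eta><..<L p + \<eta>}" "\<lambda>p. p"] by simp
    moreover have "L \<in> ?U" using A(3) by simp
    ultimately have "?U \<inter> D ` A \<noteq> {}" using L[OF A(1)] open_Int_closure_eq_empty by blast
    then obtain i where "i \<in> A" "D i \<in> ?U" by blast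
    then show "\<exists>i\<in>A. \<forall>p\<in>P. \<bar>D i p - L p\<bar> < \<eta>"
      by (intro bexI[of _ i] ballI) (auto simp: abs_less_iff algebra_simps)
  qed
qed

text \<open>Two maps agree on a list exactly if they agree on each entry, so proportions of
  agreement are multiplied. Large m pushes any positive distance towards 1 while distance 0 stays
  0.\<close>

lemma ham_lists:
  assumes "finite V" "V \<noteq> {}"
  shows "ham {xs. set xs \<subseteq> V \<and> length xs = m} (map \<rho>) (map \<sigma>) = 1 - (1 - ham V \<rho> \<sigma>) ^ m"
proof -
  let ?Y = "{xs. set xs \<subseteq> V \<and> length xs = m}" and ?E = "{x \<in> V. \<rho> x = \<sigma> x}"
  have card_Y: "card ?Y = card V ^ m" using card_lists_length_eq[OF assms(1)] .
  have fin: "finite ?Y" using finite_lists_length_eq[OF assms(1)] .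
  moreover have "?Y \<noteq> {}" using card_Y assms by (metis card.empty card_0_eq power_not_zero)
  ultimately have "ham ?Y (map \<rho>) (map \<sigma>) = 1 - real (card {xs \<in> ?Y. map \<rho> xs = map \<sigma> xs}) / card ?Y"
    by (rule ham_eq_1_minus)
  also have "{xs \<in> ?Y. map \<rho> xs = map \<sigma> xs} = {xs. set xs \<subseteq> ?E \<and> length xs = m}" by auto
  also have "card \<dots> = card ?E ^ m" using assms(1) by (intro card_lists_length_eq) simp
  finally show ?thesis unfolding card_Y ham_eq_1_minus[OF assms] by (simp add: power_divide)
qed

section \<open>From twisting permutations to sofic quotients\<close>

text \<open>A power of t is reduced modulo k, so negative exponents need no inverse of
  \<open>f\<close>; for \<open>f ^^ k = id\<close> and k \<ge> 1 this is a homomorphism in the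
  exponent.\<close>

definition eval_letter :: "nat \<Rightarrow> ('a \<Rightarrow> nat \<Rightarrow> nat) \<Rightarrow> (nat \<Rightarrow> nat) \<Rightarrow> 'a + int \<Rightarrow> nat \<Rightarrow> nat"
  where "eval_letter k \<psi> f l = (case l of Inl g \<Rightarrow> \<psi> g | Inr z \<Rightarrow> f ^^ nat (z mod int k))"

definition eval_word :: "nat \<Rightarrow> ('a \<Rightarrow> nat \<Rightarrow> nat) \<Rightarrow> (nat \<Rightarrow> nat) \<Rightarrow> ('a + int) list \<Rightarrow> nat \<Rightarrow> nat"
  where "eval_word k \<psi> f w = foldr (\<lambda>l p. eval_letter k \<psi> f l \<circ> p) w id"

lemma eval_word_Nil [simp]: "eval_word k \<psi> f [] = id"
  by (simp add: eval_word_def)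

lemma eval_word_Cons [simp]: "eval_word k \<psi> f (l # w) = eval_letter k \<psi> f l \<circ> eval_word k \<psi> f w"
  by (simp add: eval_word_def)

lemma eval_word_append: "eval_word k \<psi> f (v @ w) = eval_word k \<psi> f v \<circ> eval_word k \<psi> f w"
  by (induction v) (simp_all add: comp_assoc)

lemma funpow_mod_id:
  assumes "f ^^ k = id"
  shows "f ^^ (m mod k) = f ^^ m"
proof
  fix x show "(f ^^ (m mod k)) x = (f ^^ m) x"
    using assms by (intro funpow_mod_eq) simp
qed

lemma eval_letter_Inr_add:
  assumes "f ^^ k = id" "k \<ge> 1"
  shows "eval_letter k \<psi> f (Inr z) \<circ> eval_letter k \<psi> f (Inr z') = eval_letter k \<psi> f (Inr (z + z'))"
proof -
  have "nat ((z + z') mod int k) = (nat (z mod int k) + nat (z' mod int k)) mod k"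
    using assms(2) nat_mod_distrib[of "z mod int k + z' mod int k" "int k"]
    by (simp add: mod_add_eq nat_add_distrib)
  then show ?thesis
    using assms by (simp add: eval_letter_def funpow_mod_id funpow_add[symmetric])
qed

lemma eval_word_permutes:
  assumes "\<psi> \<in> carrier G \<rightarrow> carrier (sym_group n)" "f permutes {1..n}"
    "w \<in> lists (carrier G <+> carrier integer_group)"
  shows "eval_word k \<psi> f w permutes {1..n}"
  using assms(3)
proof (induction w)
  case Nil
  then show ?case by (simp add: permutes_id[unfolded id_def] id_def)
next
  case (Cons l w)
  have "f ^^ m permutes {1..n}" for m
    using assms(2) by (rule permutes_funpow)
  then have "eval_letter k \<psi> f l permutes {1..n}"
    using Cons.hyps(1) assms(1) by (auto simp: eval_letter_def sym_group_def Pi_iff)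
  with Cons.IH show ?case unfolding eval_word_Cons by (rule permutes_compose)
qed

text \<open>\<open>approx\<close> is the link between \<open>L\<close> and permutations:
  approximations of any prescribed quality exist whose word distances agree with \<open>L\<close> up
  to \<eta> on a given finite set of pairs. Hence linear inequalities valid for all good
  approximations pass to \<open>L\<close>.\<close>

locale limit_length =
  fixes G :: "('a, 'b) monoid_scheme" and A B :: "'a set" and \<phi> :: "'a \<Rightarrow> 'a" and k :: nat
    and L :: "('a + int) list \<times> ('a + int) list \<Rightarrow> real"
  assumes group: "group G" and k: "k \<ge> 1"
    and B: "B \<subseteq> carrier G" and \<phi>: "\<And>b. b \<in> B \<Longrightarrow> \<phi> b \<in> A" and A: "A \<subseteq> carrier G"
    and approx: "\<And>S \<delta> P \<eta>. finite S \<Longrightarrow> S \<subseteq> carrier G \<Longrightarrow> \<delta> > 0 \<Longrightarrow> finite P \<Longrightarrow> \<eta> > 0 \<Longrightarrow>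
      \<exists>n \<psi> f. sofic_approximation G S \<delta> n \<psi> \<and> twisting_perm k n S A B \<phi> \<delta> \<psi> f \<and>
        (\<forall>(v, w)\<in>P. \<bar>ham {1..n} (eval_word k \<psi> f v) (eval_word k \<psi> f w) - L (v, w)\<bar> < \<eta>)"
begin

sublocale G: group G by (rule group)

abbreviation "words \<equiv> lists (carrier G <+> carrier integer_group)"

text \<open>\<open>P\<close> is a finite set of pairs of words, each tagged with its coefficient in a linear inequality.\<close>

lemma limit_le:
  assumes "finite S" "S \<subseteq> carrier G" "\<delta> > 0" "finite P"
    and bound: "\<And>n \<psi> f. sofic_approximation G S \<delta> n \<psi> \<Longrightarrow> twisting_perm k n S A B \<phi> \<delta> \<psi> f \<Longrightarrow>
      (\<Sum>(p, c)\<in>P. c * ham {1..n} (eval_word k \<psi> f (fst p)) (eval_word k \<psi> f (snd p))) \<le> C"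
  shows "(\<Sum>(p, c)\<in>P. c * L p) \<le> C"
proof (rule field_le_epsilon)
  fix e :: real assume e: "0 < e"
  \<comment> \<open>The total weight of the coefficients, plus 1 so that e / M makes sense even for
    zero weights.\<close>
  define M where "M = (\<Sum>(p, c)\<in>P. \<bar>c\<bar>) + 1"
  have M: "0 < M" unfolding M_def by (intro add_nonneg_pos sum_nonneg) auto
  obtain n \<psi> f where ap: "sofic_approximation G S \<delta> n \<psi>" "twisting_perm k n S A B \<phi> \<delta> \<psi> f"
    and close: "\<forall>(v, w)\<in>fst ` P. \<bar>ham {1..n} (eval_word k \<psi> f v) (eval_word k \<psi> f w) - L (v, w)\<bar> < e / M"
    using approx[OF assms(1-3), of "fst ` P" "e / M"] assms(4) e M by auto
  have "(\<Sum>(p, c)\<in>P. c * L p) \<le> (\<Sum>(p, c)\<in>P.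
      c * ham {1..n} (eval_word k \<psi> f (fst p)) (eval_word k \<psi> f (snd p)) + \<bar>c\<bar> * (e / M))"
  proof (intro sum_mono, clarify)
    fix v w c assume "((v, w), c) \<in> P"
    then have "\<bar>L (v, w) - ham {1..n} (eval_word k \<psi> f v) (eval_word k \<psi> f w)\<bar> \<le> e / M"
      using close by (force simp: abs_minus_commute)
    then have "\<bar>c\<bar> * \<bar>L (v, w) - ham {1..n} (eval_word k \<psi> f v) (eval_word k \<psi> f w)\<bar> \<le> \<bar>c\<bar> * (e / M)"
      by (rule mult_left_mono) simp
    then have "\<bar>c * (L (v, w) - ham {1..n} (eval_word k \<psi> f v) (eval_word k \<psi> f w))\<bar> \<le> \<bar>c\<bar> * (e / M)"
      by (simp add: abs_mult)
    then have "c * (L (v, w) - ham {1..n} (eval_word k \<psi> f v) (eval_word k \<psi> f w)) \<le> \<bar>c\<bar> * (e / M)"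
      by linarith
    then show "c * L (v, w) \<le> c * ham {1..n} (eval_word k \<psi> f (fst (v, w))) (eval_word k \<psi> f (snd (v, w)))
        + \<bar>c\<bar> * (e / M)"
      by (simp add: algebra_simps)
  qed
  also have "\<dots> = (\<Sum>(p, c)\<in>P. c * ham {1..n} (eval_word k \<psi> f (fst p)) (eval_word k \<psi> f (snd p)))
      + (\<Sum>(p, c)\<in>P. \<bar>c\<bar>) * (e / M)"
    by (simp add: case_prod_beta sum.distrib sum_distrib_right sum_divide_distrib)
  also have "\<dots> \<le> C + e"
  proof (rule add_mono[OF bound[OF ap]])
    have "(\<Sum>(p, c)\<in>P. \<bar>c\<bar>) * (e / M) \<le> M * (e / M)"
      using e M by (intro mult_right_mono) (auto simp: M_def)
    then show "(\<Sum>(p, c)\<in>P. \<bar>c\<bar>) * (e / M) \<le> e" using M by simp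
  qed
  finally show "(\<Sum>(p, c)\<in>P. c * L p) \<le> C + e" .
qed

lemma L_le:
  assumes "finite S" "S \<subseteq> carrier G" "\<delta> > 0"
    and "\<And>n \<psi> f. sofic_approximation G S \<delta> n \<psi> \<Longrightarrow> twisting_perm k n S A B \<phi> \<delta> \<psi> f \<Longrightarrow>
      ham {1..n} (eval_word k \<psi> f v) (eval_word k \<psi> f w) \<le> C"
  shows "L (v, w) \<le> C"
  using limit_le[OF assms(1-3), of "{((v, w), 1)}" C] assms(4) by simp

lemma L_ge:
  assumes "finite S" "S \<subseteq> carrier G" "\<delta> > 0"
    and "\<And>n \<psi> f. sofic_approximation G S \<delta> n \<psi> \<Longrightarrow> twisting_perm k n S A B \<phi> \<delta> \<psi> f \<Longrightarrow>
      C \<le> ham {1..n} (eval_word k \<psi> f v) (eval_word k \<psi> f w)"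
  shows "C \<le> L (v, w)"
  using limit_le[OF assms(1-3), of "{((v, w), -1)}" "- C"] assms(4) by simp

lemma L_nonneg: "0 \<le> L (v, w)"
  by (rule L_ge[of "{}" 1]) (auto simp: ham_nonneg)

lemma L_refl [simp]: "L (w, w) = 0"
  by (rule antisym[OF L_le[of "{}" 1] L_nonneg]) auto

lemma L_triangle: "L (u, w) \<le> L (u, v) + L (v, w)"
\<comment> \<open>The case split keeps the two pairs tagged -1 distinct; in a set they would
  otherwise be counted once.\<close>
proof (cases "u = v \<or> v = w")
  case False
  have tri: "ham {1..n} (eval_word k \<psi> f u) (eval_word k \<psi> f w) \<le>
      ham {1..n} (eval_word k \<psi> f u) (eval_word k \<psi> f v) + ham {1..n} (eval_word k \<psi> f v) (eval_word k \<psi> f w)"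
    for n \<psi> f
    by (rule ham_triangle) simp
  have "(\<Sum>(p, c)\<in>{((u, w), 1), ((u, v), -1), ((v, w), -1)}. c * L p) \<le> 0"
    by (rule limit_le[of "{}" 1]) (use False tri in \<open>auto simp: algebra_simps\<close>)
  then show ?thesis using False by (auto simp: algebra_simps)
qed auto

lemma L_commute: "L (v, w) = L (w, v)"
proof (cases "v = w")
  case False
  have "L (v, w) \<le> L (w, v)" if "v \<noteq> w" for v w
  proof -
    have "(\<Sum>(p, c)\<in>{((v, w), 1), ((w, v), -1)}. c * L p) \<le> 0"
      by (rule limit_le[of "{}" 1]) (use that in \<open>auto simp: ham_commute\<close>)
    then show ?thesis using that by simp
  qed
  then show ?thesis using False by (metis antisym)
qed simp

lemma L_trans_0: "L (u, v) = 0 \<Longrightarrow> L (v, w) = 0 \<Longrightarrow> L (u, w) = 0"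
  using L_triangle[of u w v] L_nonneg[of u w] by simp

lemma approx_permutes:
  assumes "sofic_approximation G S \<delta> n \<psi>" "twisting_perm k n S A B \<phi> \<delta> \<psi> f" "w \<in> words"
  shows "eval_word k \<psi> f w permutes {1..n}"
  using assms by (intro eval_word_permutes) (auto simp: sofic_approximation_def twisting_perm_def sym_group_def)

lemma L_append_left_le:
  assumes "u \<in> words" "v \<in> words" "w \<in> words"
  shows "L (u @ v, u @ w) \<le> L (v, w)"
proof (cases "u = []")
  case False
  have "(\<Sum>(p, c)\<in>{((u @ v, u @ w), 1), ((v, w), -1)}. c * L p) \<le> 0"
  proof (rule limit_le[of "{}" 1])
    fix n \<psi> f assume ap: "sofic_approximation G {} 1 n \<psi>" "twisting_perm k n {} A B \<phi> 1 \<psi> f"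
    note perm = approx_permutes[OF ap]
    have "ham {1..n} (eval_word k \<psi> f (u @ v)) (eval_word k \<psi> f (u @ w)) =
        ham {1..n} (eval_word k \<psi> f v) (eval_word k \<psi> f w)"
      unfolding eval_word_append
      using perm[OF assms(1)] permutes_image[OF perm[OF assms(2)]] permutes_image[OF perm[OF assms(3)]]
      by (intro ham_comp_left) (auto intro: permutes_inj_on)
    then show "(\<Sum>(p, c)\<in>{((u @ v, u @ w), 1), ((v, w), - 1)}.
        c * ham {1..n} (eval_word k \<psi> f (fst p)) (eval_word k \<psi> f (snd p))) \<le> 0"
      using False by simp
  qed auto
  then show ?thesis using False by simp
qed simp

lemma L_append_right_le:
  assumes "u \<in> words" "v \<in> words" "w \<in> words"
  shows "L (v @ u, w @ u) \<le> L (v, w)"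
proof (cases "u = []")
  case False
  have "(\<Sum>(p, c)\<in>{((v @ u, w @ u), 1), ((v, w), -1)}. c * L p) \<le> 0"
  proof (rule limit_le[of "{}" 1])
    fix n \<psi> f assume ap: "sofic_approximation G {} 1 n \<psi>" "twisting_perm k n {} A B \<phi> 1 \<psi> f"
    have "ham {1..n} (eval_word k \<psi> f (v @ u)) (eval_word k \<psi> f (w @ u)) =
        ham {1..n} (eval_word k \<psi> f v) (eval_word k \<psi> f w)"
      unfolding eval_word_append
      by (rule ham_comp_right[OF permutes_imp_bij[OF approx_permutes[OF ap assms(1)]]])
    then show "(\<Sum>(p, c)\<in>{((v @ u, w @ u), 1), ((v, w), - 1)}.
        c * ham {1..n} (eval_word k \<psi> f (fst p)) (eval_word k \<psi> f (snd p))) \<le> 0"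
      using False by simp
  qed auto
  then show ?thesis using False by simp
qed simp

text \<open>Change one factor at a time: composing with a permutation on either side preserves the
  Hamming distance. With \<open>L_trans_0\<close> and symmetry this makes distance 0 a congruence on
  words.\<close>

lemma L_append_0:
  assumes "u \<in> words" "u' \<in> words" "v \<in> words" "v' \<in> words" "L (u, u') = 0" "L (v, v') = 0"
  shows "L (u @ v, u' @ v') = 0"
proof (rule L_trans_0)
  show "L (u @ v, u @ v') = 0"
    using L_append_left_le[OF assms(1,3,4)] assms(6) L_nonneg[of "u @ v" "u @ v'"] by simp
  show "L (u @ v', u' @ v') = 0"
    using L_append_right_le[OF assms(4,1,2)] assms(5) L_nonneg[of "u @ v'" "u' @ v'"] by simp
qed

lemma L_eq_0I:
  assumes "finite S" "S \<subseteq> carrier G"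
    and "\<And>\<delta> n \<psi> f. sofic_approximation G S \<delta> n \<psi> \<Longrightarrow> twisting_perm k n S A B \<phi> \<delta> \<psi> f \<Longrightarrow>
      ham {1..n} (eval_word k \<psi> f v) (eval_word k \<psi> f w) \<le> \<delta>"
  shows "L (v, w) = 0"
proof -
  have "L (v, w) \<le> 0 + \<delta>" if "\<delta> > 0" for \<delta>
    using L_le[OF assms(1,2) that, of v w \<delta>] assms(3) by simp
  then have "L (v, w) \<le> 0" by (rule field_le_epsilon)
  then show ?thesis using L_nonneg[of v w] by simp
qed

lemma L_mult_left:
  assumes "g \<in> carrier G" "h \<in> carrier G"
  shows "L ([Inl g, Inl h], [Inl (g \<otimes>\<^bsub>G\<^esub> h)]) = 0"
  by (rule L_eq_0I[of "{g, h, g \<otimes>\<^bsub>G\<^esub> h}"])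
    (use assms in \<open>auto simp: eval_letter_def sofic_approximation_def sym_group_def hamming_dist_eq_ham less_imp_le\<close>)

text \<open>The unit acts almost idempotently, so cancelling one factor brings it near the
  identity.\<close>

lemma L_one_left: "L ([Inl \<one>\<^bsub>G\<^esub>], []) = 0"
proof (rule L_eq_0I[of "{\<one>\<^bsub>G\<^esub>}"])
  fix \<delta> n \<psi> f assume ap: "sofic_approximation G {\<one>\<^bsub>G\<^esub>} \<delta> n \<psi>"
  have p: "\<psi> \<one>\<^bsub>G\<^esub> permutes {1..n}" using ap by (auto simp: sofic_approximation_def sym_group_def Pi_iff)
  have "ham {1..n} (\<psi> \<one>\<^bsub>G\<^esub>) id = ham {1..n} (\<psi> \<one>\<^bsub>G\<^esub> \<circ> \<psi> \<one>\<^bsub>G\<^esub>) (\<psi> \<one>\<^bsub>G\<^esub> \<circ> id)"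
    using permutes_image[OF p] by (intro ham_comp_left[symmetric]) (auto intro: permutes_inj_on[OF p])
  also have "\<dots> < \<delta>" using ap by (simp add: sofic_approximation_def sym_group_def hamming_dist_eq_ham)
  finally show "ham {1..n} (eval_word k \<psi> f [Inl \<one>\<^bsub>G\<^esub>]) (eval_word k \<psi> f []) \<le> \<delta>"
    by (simp add: eval_letter_def)
qed auto

lemma L_Inr_eq_0:
  assumes "\<And>\<psi> f. f ^^ k = id \<Longrightarrow> eval_word k \<psi> f v = eval_word k \<psi> f w"
  shows "L (v, w) = 0"
proof -
  have "L (v, w) \<le> 0"
    by (rule L_le[of "{}" 1]) (use assms in \<open>auto simp: twisting_perm_def sym_group_pow sym_group_one\<close>)
  then show ?thesis using L_nonneg[of v w] by simp
qed

lemma L_mult_right: "L ([Inr z, Inr z'], [Inr (z + z')]) = 0"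
  by (rule L_Inr_eq_0) (simp add: eval_letter_Inr_add[OF _ k])

lemma L_power: "L ([Inr (int k)], []) = 0"
  by (rule L_Inr_eq_0) (simp add: eval_letter_def)

lemma L_one_right: "L ([Inr 0], []) = 0"
  by (rule L_Inr_eq_0) (simp add: eval_letter_def)

lemma L_twist:
  assumes "b \<in> B"
  shows "L ([Inl b, Inr 1], [Inr 1, Inl (\<phi> b)]) = 0"
proof (rule L_eq_0I[of "{b, \<phi> b}"])
  show "{b, \<phi> b} \<subseteq> carrier G" using assms A B \<phi> by auto
next
  fix \<delta> n \<psi> f assume tw: "twisting_perm k n {b, \<phi> b} A B \<phi> \<delta> \<psi> f"
  have fk: "f ^^ k = id" using tw by (simp add: twisting_perm_def sym_group_pow sym_group_one)
  \<comment> \<open>For k = 1 the reduced exponent is 0, and the equation still holds because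
    \<open>f\<close> is then the identity.\<close>
  have "f ^^ nat (1 mod int k) = f"
    using funpow_mod_id[OF fk, of 1] by (simp add: nat_mod_distrib)
  moreover have "ham {1..n} (\<psi> b \<circ> f) (f \<circ> \<psi> (\<phi> b)) < \<delta>"
    using tw assms \<phi> by (simp add: twisting_perm_def hamming_dist_eq_ham)
  ultimately show "ham {1..n} (eval_word k \<psi> f [Inl b, Inr 1]) (eval_word k \<psi> f [Inr 1, Inl (\<phi> b)]) \<le> \<delta>"
    by (simp add: eval_letter_def)
qed simp

lemma L_nontrivial:
  assumes "g \<in> carrier G" "g \<noteq> \<one>\<^bsub>G\<^esub>"
  shows "L ([Inl g], []) = 1"
proof (rule antisym)
  show "L ([Inl g], []) \<le> 1" by (rule L_le[of "{}" 1]) (auto intro: ham_le_1)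
  show "1 \<le> L ([Inl g], [])"
  proof (rule field_le_epsilon)
    fix e :: real assume e: "0 < e"
    have "1 - e \<le> L ([Inl g], [])"
      by (rule L_ge[of "{g}" e])
        (use assms e in \<open>auto simp: eval_letter_def sofic_approximation_def hamming_dist_eq_ham less_imp_le\<close>)
    then show "1 \<le> L ([Inl g], []) + e" by simp
  qed
qed

text \<open>Distance 0 is a congruence containing the generating relations of the free product,
  hence contains the smallest one.\<close>

lemma free_product_eq_imp_L_eq_0:
  assumes "free_product_eq G integer_group v w"
  shows "L (v, w) = 0"
  using assms
proof (induction rule: free_product_eq.induct)
  case (append u u' v v')
  then show ?case
    using free_product_eq_in_words[OF group group_integer_group] by (intro L_append_0) blast+
next
  case (sym v w)
  then show ?case by (simp only: L_commute[of w v])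
qed (auto simp: L_mult_left L_one_left L_mult_right L_one_right intro: L_trans_0)

text \<open>Representing words turn approximations of G into maps that are almost multiplicative on
  \<open>T\<close> and move a proportion bounded below for nontrivial elements. Acting on m-tuples
  raises this proportion above 1 - \<delta>; m is fixed before \<eta>, so the multiplicative error,
  which grows at most m-fold, can still be made small.\<close>

lemma sofic_if_word_length:
  fixes Q :: "('c, 'd) monoid_scheme"
  assumes Q: "group Q" and surj: "\<theta> ` words = carrier Q"
    and mult: "\<And>v w. v \<in> words \<Longrightarrow> w \<in> words \<Longrightarrow> \<theta> (v @ w) = \<theta> v \<otimes>\<^bsub>Q\<^esub> \<theta> w"
    and inj: "\<And>v w. v \<in> words \<Longrightarrow> w \<in> words \<Longrightarrow> \<theta> v = \<theta> w \<Longrightarrow> L (v, w) = 0"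
    and null: "\<And>w. w \<in> words \<Longrightarrow> L (w, []) = 0 \<Longrightarrow> \<theta> w = \<one>\<^bsub>Q\<^esub>"
  shows "sofic Q"
  unfolding sofic_def
proof (intro allI impI, elim conjE)
  fix T and \<delta> :: real assume T: "finite T" "T \<subseteq> carrier Q" and \<delta>: "\<delta> > 0"
  interpret Q: group Q by fact
  define wd where "wd = inv_into words \<theta>"
  have wd: "wd x \<in> words" "\<theta> (wd x) = x" if "x \<in> carrier Q" for x
    using that surj by (auto simp: wd_def inv_into_into f_inv_into_f)
  define T' where "T' = T - {\<one>\<^bsub>Q\<^esub>}"
  have "\<exists>c>0. \<forall>x\<in>T'. c \<le> L (wd x, [])"
  proof (intro exI conjI ballI)
    \<comment> \<open>The inserted 1 keeps the minimum defined when \<open>T\<close> has no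
      nontrivial element.\<close>
    let ?M = "insert 1 ((\<lambda>x. L (wd x, [])) ` T')"
    have fin: "finite ?M" using T by (auto simp: T'_def)
    have "0 < L (wd x, [])" if "x \<in> T'" for x
      using that T wd[of x] null[of "wd x"] L_nonneg[of "wd x" "[]"] by (auto simp: T'_def less_le)
    then show "0 < Min ?M" using fin by (subst Min_gr_iff) auto
    show "Min ?M \<le> L (wd x, [])" if "x \<in> T'" for x using fin that by (intro Min_le) auto
  qed
  then obtain c where c: "0 < c" "\<And>x. x \<in> T' \<Longrightarrow> c \<le> L (wd x, [])" by blast
  \<comment> \<open>Limit lengths are at least c and are met within \<eta> \<le> c' \<le> c / 2, so
    actual distances stay above c'.\<close>
  define c' where "c' = min c 1 / 2"
  have c': "0 < c'" "c' \<le> c / 2" "c' < 1" using c(1) by (auto simp: c'_def)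
  obtain m where m: "(1 - c') ^ m < \<delta>" using real_arch_pow_inv[OF \<delta>, of "1 - c'"] c' by auto
  define \<eta> where "\<eta> = min c' (\<delta> / (m + 1))"
  have \<eta>: "0 < \<eta>" "\<eta> \<le> c'" using c' \<delta> by (auto simp: \<eta>_def)
  have "(real m + 1) * \<eta> \<le> \<delta>"
  proof -
    have "\<eta> \<le> \<delta> / (real m + 1)" by (simp add: \<eta>_def add.commute)
    then show ?thesis by (subst (asm) pos_le_divide_eq) (simp_all add: mult.commute)
  qed
  then have m\<eta>: "m * \<eta> < \<delta>" using \<eta>(1) by (simp add: distrib_right)
  define P where "P = (\<lambda>(x, y). (wd x @ wd y, wd (x \<otimes>\<^bsub>Q\<^esub> y))) ` (T \<times> T) \<union> (\<lambda>x. (wd x, [])) ` T'"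
  have "finite P" using T by (auto simp: P_def T'_def)
  then obtain n \<psi> f where ap: "sofic_approximation G {} 1 n \<psi>" "twisting_perm k n {} A B \<phi> 1 \<psi> f"
    and close': "\<forall>(v, w)\<in>P. \<bar>ham {1..n} (eval_word k \<psi> f v) (eval_word k \<psi> f w) - L (v, w)\<bar> < \<eta>"
    using approx[of "{}" 1 P \<eta>] \<eta> by auto
  have close: "\<bar>ham {1..n} (eval_word k \<psi> f v) (eval_word k \<psi> f w) - L (v, w)\<bar> < \<eta>" if "(v, w) \<in> P" for v w
    using bspec[OF close' that] by simp
  let ?V = "{1..n}"
  let ?Y = "{xs. set xs \<subseteq> ?V \<and> length xs = m}"
  define \<Psi> where "\<Psi> x = map (eval_word k \<psi> f (wd x))" for x
  have V: "finite ?V" "?V \<noteq> {}" using ap by (auto simp: sofic_approximation_def)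
  have perm: "eval_word k \<psi> f (wd x) permutes ?V" if "x \<in> carrier Q" for x
    using approx_permutes[OF ap wd(1)[OF that]] .
  have Y: "finite ?Y" using finite_lists_length_eq[OF V(1)] .
  have "approx_on Q T \<delta> ?Y \<Psi>"
    unfolding approx_on_def
  proof (intro conjI ballI impI Y)
    show "?Y \<noteq> {}" using V(2) by (auto intro!: exI[of _ "replicate m n"] simp: set_replicate_conv_if split: if_splits)
  next
    fix x assume x: "x \<in> carrier Q"
    have "\<Psi> x ` ?Y \<subseteq> ?Y"
    proof (rule image_subsetI)
      fix xs assume xs: "xs \<in> ?Y"
      then have "eval_word k \<psi> f (wd x) ` set xs \<subseteq> eval_word k \<psi> f (wd x) ` ?V"
        by (intro image_mono) simp
      then show "\<Psi> x xs \<in> ?Y" using xs permutes_image[OF perm[OF x]] by (simp add: \<Psi>_def)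
    qed
    moreover have "inj_on (\<Psi> x) ?Y"
      using permutes_inj[OF perm[OF x]] by (auto simp: \<Psi>_def intro: inj_on_subset[OF inj_mapI])
    ultimately show "bij_betw (\<Psi> x) ?Y ?Y"
      unfolding bij_betw_def using endo_inj_surj[OF Y] by blast
  next
    fix x y assume xy: "x \<in> T" "y \<in> T" "x \<otimes>\<^bsub>Q\<^esub> y \<in> T"
    then have car: "x \<in> carrier Q" "y \<in> carrier Q" using T(2) by auto
    let ?d = "ham ?V (eval_word k \<psi> f (wd x @ wd y)) (eval_word k \<psi> f (wd (x \<otimes>\<^bsub>Q\<^esub> y)))"
    have "L (wd x @ wd y, wd (x \<otimes>\<^bsub>Q\<^esub> y)) = 0"
      using car wd mult[of "wd x" "wd y"] by (intro inj) auto
    moreover have "(wd x @ wd y, wd (x \<otimes>\<^bsub>Q\<^esub> y)) \<in> P" using xy by (auto simp: P_def)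
    ultimately have d: "?d < \<eta>" using close by force
    have "\<Psi> x \<circ> \<Psi> y = map (eval_word k \<psi> f (wd x @ wd y))"
      by (simp add: \<Psi>_def fun_eq_iff eval_word_append)
    then have "ham ?Y (\<Psi> x \<circ> \<Psi> y) (\<Psi> (x \<otimes>\<^bsub>Q\<^esub> y)) = 1 - (1 - ?d) ^ m"
      by (simp only: \<Psi>_def ham_lists[OF V])
    \<comment> \<open>Bernoulli: (1 - d)^m \<ge> 1 - m d.\<close>
    also have "\<dots> \<le> m * ?d"
      using Bernoulli_inequality[of "- ?d" m] ham_le_1[OF V(1)] by simp
    also have "\<dots> \<le> m * \<eta>" using d by (intro mult_left_mono) auto
    also have "\<dots> < \<delta>" by (rule m\<eta>)
    finally show "ham ?Y (\<Psi> x \<circ> \<Psi> y) (\<Psi> (x \<otimes>\<^bsub>Q\<^esub> y)) < \<delta>" .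
  next
    fix x assume "x \<in> T - {\<one>\<^bsub>Q\<^esub>}"
    then have x: "x \<in> T'" by (simp add: T'_def)
    let ?d = "ham ?V (eval_word k \<psi> f (wd x)) (eval_word k \<psi> f [])"
    have "(wd x, []) \<in> P" using x by (auto simp: P_def)
    then have "c' \<le> ?d" using close[of "wd x" "[]"] c(2)[OF x] c' \<eta>(2) by linarith
    then have "(1 - ?d) ^ m \<le> (1 - c') ^ m"
      using ham_le_1[OF V(1)] by (intro power_mono) auto
    moreover have "ham ?Y (\<Psi> x) id = 1 - (1 - ?d) ^ m"
      using ham_lists[OF V, of m "eval_word k \<psi> f (wd x)" id] by (simp add: \<Psi>_def)
    ultimately show "1 - \<delta> < ham ?Y (\<Psi> x) id" using m by simp
  qed
  moreover obtain h where "bij_betw h ?Y {1..card ?Y}"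
    using finite_same_card_bij[OF Y, of "{1..card ?Y}"] by auto
  ultimately show "\<exists>n \<psi>. sofic_approximation Q T \<delta> n \<psi>"
    using sofic_approximation_relabel[OF _ _ Q T(2)] by blast
qed

section \<open>The normal subgroup of null words and the resulting quotient of Hig\<close>

abbreviation "FP \<equiv> free_product G integer_group"
abbreviation "cls \<equiv> free_product_class G integer_group"

sublocale FP: group FP
  by (rule group_free_product[OF group group_integer_group])

definition null_classes :: "('a + int) list set set"
  where "null_classes = cls ` {w \<in> words. L (w, []) = 0}"

lemma cls_closed: "w \<in> words \<Longrightarrow> cls w \<in> carrier FP"
  by (simp add: carrier_free_product)

lemma cls_append: "v \<in> words \<Longrightarrow> w \<in> words \<Longrightarrow> cls (v @ w) = cls v \<otimes>\<^bsub>FP\<^esub> cls w"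
  by (simp only: free_product_mult_class)

lemma cls_Nil: "cls [] = \<one>\<^bsub>FP\<^esub>"
  by (simp add: free_product_def)

lemma cls_eq_imp_L_eq_0: "w \<in> words \<Longrightarrow> cls v = cls w \<Longrightarrow> L (v, w) = 0"
  using free_product_class_eq_iff free_product_eq_imp_L_eq_0 by blast

text \<open>Equivalent words have distance 0, so being null does not depend on the
  representative.\<close>

lemma cls_mem_null_classes:
  assumes "w \<in> words"
  shows "cls w \<in> null_classes \<longleftrightarrow> L (w, []) = 0"
proof
  assume "cls w \<in> null_classes"
  then obtain v where v: "v \<in> words" "L (v, []) = 0" "cls w = cls v" by (auto simp: null_classes_def)
  then show "L (w, []) = 0" using L_trans_0[OF cls_eq_imp_L_eq_0[OF v(1,3)]] by simp
next
  assume "L (w, []) = 0"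
  with assms show "cls w \<in> null_classes" by (simp only: null_classes_def) blast
qed

lemma inverse_word:
  assumes "w \<in> words"
  obtains v where "v \<in> words" "cls v = inv\<^bsub>FP\<^esub> cls w" "L (v @ w, []) = 0" "L (w @ v, []) = 0"
proof -
  have "inv\<^bsub>FP\<^esub> cls w \<in> carrier FP" using cls_closed[OF assms] by simp
  then obtain v where v: "v \<in> words" "inv\<^bsub>FP\<^esub> cls w = cls v" by (auto simp: carrier_free_product)
  have "cls (v @ w) = cls []" "cls (w @ v) = cls []"
    using FP.l_inv[OF cls_closed[OF assms]] FP.r_inv[OF cls_closed[OF assms]]
    unfolding cls_append[OF v(1) assms] cls_append[OF assms v(1)] cls_Nil v(2) by blast+
  then show ?thesis using that v cls_eq_imp_L_eq_0[of "[]"] by simp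
qed

text \<open>All closure properties come from the congruence \<open>L_append_0\<close>: in v w or u w
  u^{-1} a null factor w may be replaced by the empty word.\<close>

lemma null_classes_normal: "null_classes \<lhd> FP"
  unfolding FP.normal_inv_iff
proof (intro conjI ballI)
  show "subgroup null_classes FP"
  proof (rule FP.subgroupI)
    show "null_classes \<subseteq> carrier FP" unfolding null_classes_def using cls_closed by blast
    show "null_classes \<noteq> {}" using cls_mem_null_classes[of "[]"] by auto
  next
    fix x assume "x \<in> null_classes"
    then obtain w where w: "w \<in> words" "L (w, []) = 0" "x = cls w" by (auto simp: null_classes_def)
    obtain v where v: "v \<in> words" "cls v = inv\<^bsub>FP\<^esub> cls w" "L (v @ w, []) = 0" "L (w @ v, []) = 0"
      using inverse_word[OF w(1)] .
    have "L (v @ [], v @ w) = 0"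
      using L_append_0[of v v "[]" w] v(1) w by (simp add: L_commute[of "[]"])
    then have "L (v, []) = 0" using L_trans_0[OF _ v(3), of v] by simp
    then show "inv\<^bsub>FP\<^esub> x \<in> null_classes" using cls_mem_null_classes[OF v(1)] v(2) w(3) by simp
  next
    fix x y assume "x \<in> null_classes" "y \<in> null_classes"
    then obtain v w where vw: "v \<in> words" "L (v, []) = 0" "x = cls v" "w \<in> words" "L (w, []) = 0" "y = cls w"
      by (auto simp: null_classes_def)
    then have "L (v @ w, [] @ []) = 0" by (intro L_append_0) auto
    then show "x \<otimes>\<^bsub>FP\<^esub> y \<in> null_classes"
      using vw cls_mem_null_classes[of "v @ w"] by (simp add: cls_append)
  qed
next
  fix x y assume "x \<in> carrier FP" "y \<in> null_classes"
  then obtain u w where uw: "u \<in> words" "x = cls u" "w \<in> words" "L (w, []) = 0" "y = cls w"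
    by (auto simp: null_classes_def carrier_free_product)
  obtain v where v: "v \<in> words" "cls v = inv\<^bsub>FP\<^esub> cls u" "L (v @ u, []) = 0" "L (u @ v, []) = 0"
    using inverse_word[OF uw(1)] .
  have "L (u @ (w @ v), u @ ([] @ v)) = 0"
    using uw v by (intro L_append_0) auto
  then have "L (u @ w @ v, []) = 0" using L_trans_0[OF _ v(4), of "u @ w @ v"] by simp
  then have "cls (u @ w @ v) \<in> null_classes"
    using cls_mem_null_classes[of "u @ w @ v"] uw v by simp
  moreover have "cls (u @ w @ v) = x \<otimes>\<^bsub>FP\<^esub> y \<otimes>\<^bsub>FP\<^esub> inv\<^bsub>FP\<^esub> x"
    using uw v cls_closed by (simp add: cls_append FP.m_assoc)
  ultimately show "x \<otimes>\<^bsub>FP\<^esub> y \<otimes>\<^bsub>FP\<^esub> inv\<^bsub>FP\<^esub> x \<in> null_classes" by simp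
qed

lemma relators_subset_null_classes: "hig_relators k G B \<phi> \<subseteq> null_classes"
proof -
  interpret inl: group_hom G FP "free_product_inl G integer_group"
    by unfold_locales (rule free_product_inl_hom[OF group])
  interpret inr: group_hom integer_group FP "free_product_inr G integer_group"
    by (intro group_hom.intro group_hom_axioms.intro group_integer_group FP.group_axioms
        free_product_inr_hom)
  have "hig_t G [^]\<^bsub>FP\<^esub> k = cls [Inr (int k)]"
    using inr.hom_nat_pow[of 1 k] by (simp add: hig_t_def free_product_inr_def)
  then have 1: "hig_t G [^]\<^bsub>FP\<^esub> k \<in> null_classes"
    using cls_mem_null_classes[of "[Inr (int k)]"] L_power by (simp add: InrI)
  have 2: "inv\<^bsub>FP\<^esub> hig_t G \<otimes>\<^bsub>FP\<^esub> free_product_inl G integer_group b \<otimes>\<^bsub>FP\<^esub> hig_t G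
      \<otimes>\<^bsub>FP\<^esub> inv\<^bsub>FP\<^esub> free_product_inl G integer_group (\<phi> b) \<in> null_classes" if b: "b \<in> B" for b
  proof -
    have car: "b \<in> carrier G" "\<phi> b \<in> carrier G" using b A B \<phi> by auto
    let ?b' = "inv\<^bsub>G\<^esub> \<phi> b"
    have "inv\<^bsub>FP\<^esub> hig_t G = cls [Inr (- 1)]"
      using inr.hom_inv[of 1] by (simp add: hig_t_def free_product_inr_def)
    moreover have "inv\<^bsub>FP\<^esub> free_product_inl G integer_group (\<phi> b) = cls [Inl ?b']"
      using inl.hom_inv[OF car(2)] by (simp add: free_product_inl_def)
    ultimately have "inv\<^bsub>FP\<^esub> hig_t G \<otimes>\<^bsub>FP\<^esub> free_product_inl G integer_group b \<otimes>\<^bsub>FP\<^esub> hig_t G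
        \<otimes>\<^bsub>FP\<^esub> inv\<^bsub>FP\<^esub> free_product_inl G integer_group (\<phi> b) =
        cls ([Inr (- 1)] @ [Inl b, Inr 1] @ [Inl ?b'])"
      using car by (simp add: hig_t_def free_product_inl_def free_product_inr_def InlI InrI
          free_product_mult_class)
    moreover have "L ([Inr (- 1)] @ [Inl b, Inr 1] @ [Inl ?b'], []) = 0"
    proof -
      \<comment> \<open>Replacing b t by t \<phi>(b) inside t^{-1} b t \<phi>(b)^{-1} leaves two
        cancelling pairs.\<close>
      have "L ([Inr (- 1)] @ ([Inl b, Inr 1] @ [Inl ?b']), [Inr (- 1)] @ ([Inr 1, Inl (\<phi> b)] @ [Inl ?b'])) = 0"
        using car L_twist[OF b] by (intro L_append_0) (auto simp: InlI InrI)
      moreover have "L ([Inr (- 1), Inr 1], []) = 0" "L ([Inl (\<phi> b), Inl ?b'], []) = 0"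
        using L_trans_0[OF L_mult_right[of "- 1" 1]] L_one_right
          L_trans_0[OF L_mult_left[of "\<phi> b" ?b']] L_one_left car by auto
      then have "L ([Inr (- 1), Inr 1] @ [Inl (\<phi> b), Inl ?b'], [] @ []) = 0"
        using car by (intro L_append_0) (auto simp: InlI InrI)
      ultimately show ?thesis
        using L_trans_0[of "[Inr (- 1), Inl b, Inr 1, Inl ?b']"
            "[Inr (- 1), Inr 1, Inl (\<phi> b), Inl ?b']" "[]"] by simp
    qed
    ultimately show ?thesis
      using cls_mem_null_classes[of "[Inr (- 1)] @ [Inl b, Inr 1] @ [Inl ?b']"] car
      by (simp add: InlI InrI)
  qed
  show ?thesis using 1 2 by (auto simp: hig_relators_def Let_def)
qed

text \<open>The relators are null, so the free product modulo null words factors through Hig. Its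
  soficity is \<open>sofic_if_word_length\<close>, and G embeds because its nontrivial elements have
  length 1.\<close>

lemma sofic_quotient_of_Hig:
  "\<exists>N. N \<lhd> Hig k G B \<phi> \<and> sofic (Hig k G B \<phi> Mod N) \<and>
    inj_on (\<lambda>g. N #>\<^bsub>Hig k G B \<phi>\<^esub> hig_iota k G B \<phi> g) (carrier G)"
proof -
  let ?R = "normal_closure FP (hig_relators k G B \<phi>)" and ?H = "Hig k G B \<phi>"
  interpret K: normal null_classes FP by (rule null_classes_normal)
  have rel: "hig_relators k G B \<phi> \<subseteq> carrier FP"
    using relators_subset_null_classes K.subset by blast
  interpret R: normal ?R FP by (rule normal_closure_normal(1)[OF FP.group_axioms rel])
  have RK: "?R \<subseteq> null_classes"
    using null_classes_normal relators_subset_null_classes by (auto simp: normal_closure_def)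
  define r where "r x = ?R #>\<^bsub>FP\<^esub> x" for x
  have H: "?H = FP Mod ?R" by (simp add: Hig_def)
  interpret H: group ?H unfolding H by (rule R.factorgroup_is_group)
  interpret r: group_hom FP ?H r
    using R.r_coset_hom_Mod by unfold_locales (simp add: H r_def[abs_def])
  have r_surj: "r ` carrier FP = carrier ?H" by (simp add: H carrier_FactGroup r_def)
  \<comment> \<open>Because \<open>?R\<close> lies in \<open>null_classes\<close>, the preimage of
    \<open>N\<close> under \<open>r\<close> is \<open>null_classes\<close> itself; so a word dies in
    the quotient exactly when its length is 0.\<close>
  define N where "N = r ` null_classes"
  have N: "N \<lhd> ?H"
    unfolding N_def by (rule K.surj_hom_normal_subgroup[OF r.group_hom_axioms r_surj])
  interpret N: normal N ?H by (rule N)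
  have r_mem: "r x \<in> N \<longleftrightarrow> x \<in> null_classes" if x: "x \<in> carrier FP" for x
  proof
    assume "r x \<in> N"
    then obtain y where y: "y \<in> null_classes" "r x = r y" by (auto simp: N_def)
    have "x \<in> ?R #>\<^bsub>FP\<^esub> x" by (rule FP.rcos_self[OF x R.subgroup_axioms])
    then have "x \<in> ?R #>\<^bsub>FP\<^esub> y" using y(2) by (simp add: r_def)
    then obtain \<rho> where "\<rho> \<in> ?R" "x = \<rho> \<otimes>\<^bsub>FP\<^esub> y" by (auto simp: r_coset_def)
    then show "x \<in> null_classes" using RK y(1) K.m_closed by auto
  qed (auto simp: N_def)
  define \<theta> where "\<theta> x = N #>\<^bsub>?H\<^esub> r x" for x
  interpret Q: group "?H Mod N" by (rule N.factorgroup_is_group)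
  have "(\<lambda>x. N #>\<^bsub>?H\<^esub> x) \<circ> r \<in> hom FP (?H Mod N)"
    by (rule hom_compose[OF r.homh N.r_coset_hom_Mod])
  then interpret \<theta>: group_hom FP "?H Mod N" \<theta>
    by unfold_locales (simp add: \<theta>_def[abs_def] comp_def)
  have \<theta>_surj: "\<theta> ` carrier FP = carrier (?H Mod N)"
    unfolding carrier_FactGroup r_surj[symmetric] by (auto simp: \<theta>_def)
  have \<theta>_one: "\<theta> x = \<one>\<^bsub>?H Mod N\<^esub> \<longleftrightarrow> x \<in> null_classes" if x: "x \<in> carrier FP" for x
  proof -
    have "N #>\<^bsub>?H\<^esub> r x = N \<longleftrightarrow> r x \<in> N"
      using H.coset_join1[OF _ _ N.subgroup_axioms] H.coset_join2[OF _ N.subgroup_axioms] r.hom_closed[OF x]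
        N.subset by blast
    then show ?thesis using r_mem[OF x] by (simp add: \<theta>_def)
  qed
  \<comment> \<open>With u inverse to w, both v u and u w are null, so v, v u w and w are at mutual
    distance 0.\<close>
  have \<theta>_eq: "L (v, w) = 0" if vw: "v \<in> words" "w \<in> words" "\<theta> (cls v) = \<theta> (cls w)" for v w
  proof -
    obtain u where u: "u \<in> words" "cls u = inv\<^bsub>FP\<^esub> cls w" "L (u @ w, []) = 0" "L (w @ u, []) = 0"
      using inverse_word[OF vw(2)] .
    have vu: "v @ u \<in> words" using vw(1) u(1) by simp
    have "\<theta> (cls (v @ u)) = \<one>\<^bsub>?H Mod N\<^esub>"
    proof -
      have "\<theta> (cls w) \<in> carrier (?H Mod N)" by (rule \<theta>.hom_closed[OF cls_closed[OF vw(2)]])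
      then show ?thesis
        unfolding cls_append[OF vw(1) u(1)] u(2) using cls_closed[OF vw(1)] cls_closed[OF vw(2)] vw(3)
        by (simp only: \<theta>.hom_mult FP.inv_closed \<theta>.hom_inv Q.r_inv)
    qed
    then have "L (v @ u, []) = 0"
      using \<theta>_one[OF cls_closed[OF vu]] cls_mem_null_classes[OF vu] by blast
    then have "L ((v @ u) @ w, [] @ w) = 0" using vw u by (intro L_append_0) auto
    moreover have "L (v @ [], v @ (u @ w)) = 0"
      using vw u by (intro L_append_0) (auto simp: L_commute[of "[]"])
    ultimately show ?thesis using L_trans_0[of v "v @ u @ w" w] by simp
  qed
  have "sofic (?H Mod N)"
  proof (rule sofic_if_word_length[OF Q.group_axioms, of "\<lambda>w. \<theta> (cls w)"])
    show "(\<lambda>w. \<theta> (cls w)) ` words = carrier (?H Mod N)"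
      unfolding \<theta>_surj[symmetric] carrier_free_product by (simp add: image_image)
    show "\<theta> (cls (v @ w)) = \<theta> (cls v) \<otimes>\<^bsub>?H Mod N\<^esub> \<theta> (cls w)" if "v \<in> words" "w \<in> words" for v w
      using that cls_closed by (simp add: cls_append del: mult_FactGroup)
    show "\<theta> (cls w) = \<one>\<^bsub>?H Mod N\<^esub>" if "w \<in> words" "L (w, []) = 0" for w
      using that \<theta>_one cls_closed cls_mem_null_classes by blast
  qed (rule \<theta>_eq)
  moreover have "inj_on (\<lambda>g. N #>\<^bsub>?H\<^esub> hig_iota k G B \<phi> g) (carrier G)"
  proof (rule inj_onI)
    fix g h assume gh: "g \<in> carrier G" "h \<in> carrier G"
      and eq: "N #>\<^bsub>?H\<^esub> hig_iota k G B \<phi> g = N #>\<^bsub>?H\<^esub> hig_iota k G B \<phi> h"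
    have words: "[Inl g] \<in> words" "[Inl h] \<in> words" "[Inl (inv\<^bsub>G\<^esub> h)] \<in> words"
      using gh by (auto simp: InlI)
    have "\<theta> (cls [Inl g]) = \<theta> (cls [Inl h])"
      using eq by (simp add: hig_iota_def free_product_inl_def \<theta>_def r_def)
    then have "L ([Inl g], [Inl h]) = 0" by (rule \<theta>_eq[OF words(1,2)])
    then have "L ([Inl g] @ [Inl (inv\<^bsub>G\<^esub> h)], [Inl h] @ [Inl (inv\<^bsub>G\<^esub> h)]) = 0"
      using words by (intro L_append_0) auto
    moreover have "L ([Inl h] @ [Inl (inv\<^bsub>G\<^esub> h)], []) = 0"
      using L_trans_0[OF L_mult_left[of h "inv\<^bsub>G\<^esub> h"]] L_one_left gh by simp
    moreover have "L ([Inl (g \<otimes>\<^bsub>G\<^esub> inv\<^bsub>G\<^esub> h)], [Inl g] @ [Inl (inv\<^bsub>G\<^esub> h)]) = 0"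
      using L_mult_left[of g "inv\<^bsub>G\<^esub> h"] gh by (simp add: L_commute[of "[Inl (g \<otimes>\<^bsub>G\<^esub> inv\<^bsub>G\<^esub> h)]"])
    ultimately have "L ([Inl (g \<otimes>\<^bsub>G\<^esub> inv\<^bsub>G\<^esub> h)], []) = 0" using L_trans_0 by blast
    then have "g \<otimes>\<^bsub>G\<^esub> inv\<^bsub>G\<^esub> h = \<one>\<^bsub>G\<^esub>" using L_nontrivial[of "g \<otimes>\<^bsub>G\<^esub> inv\<^bsub>G\<^esub> h"] gh by force
    then show "g = h" using gh by (metis G.inv_equality G.inv_inv G.inv_closed)
  qed
  ultimately show ?thesis using N by blast
qed

end

lemma sofic_quotient_of_Hig_if_twisting_perms:
  fixes G :: "('a, 'b) monoid_scheme"
  assumes "group G" "k \<ge> 1" "B \<subseteq> carrier G" "A \<subseteq> carrier G" "\<And>b. b \<in> B \<Longrightarrow> \<phi> b \<in> A"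
    and ex: "\<And>S \<delta> \<epsilon>. finite S \<Longrightarrow> S \<subseteq> carrier G \<Longrightarrow> \<delta> > 0 \<Longrightarrow> \<epsilon> > 0 \<Longrightarrow>
      \<exists>n \<psi> f. sofic_approximation G S \<delta> n \<psi> \<and> twisting_perm k n S A B \<phi> \<epsilon> \<psi> f"
  shows "\<exists>N. N \<lhd> Hig k G B \<phi> \<and> sofic (Hig k G B \<phi> Mod N) \<and>
    inj_on (\<lambda>g. N #>\<^bsub>Hig k G B \<phi>\<^esub> hig_iota k G B \<phi> g) (carrier G)"
proof -
  define D :: "nat \<times> ('a \<Rightarrow> nat \<Rightarrow> nat) \<times> (nat \<Rightarrow> nat) \<Rightarrow> ('a + int) list \<times> ('a + int) list \<Rightarrow> real"
    where "D = (\<lambda>(n, \<psi>, f) (v, w). ham {1..n} (eval_word k \<psi> f v) (eval_word k \<psi> f w))"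
  define good where "good S \<delta> = {(n, \<psi>, f). sofic_approximation G S \<delta> n \<psi> \<and>
    twisting_perm k n S A B \<phi> \<delta> \<psi> f}" for S \<delta>
  \<comment> \<open>A single \<delta> bounds both the quality of the approximation and the twisting
    error; unions of the sets and minima of the tolerances make the family directed.\<close>
  define \<A> where "\<A> = {\<T>. \<exists>S \<delta>. finite S \<and> S \<subseteq> carrier G \<and> \<delta> > 0 \<and> \<T> = good S \<delta>}"
  have goodI: "good S \<delta> \<in> \<A>" if "finite S" "S \<subseteq> carrier G" "\<delta> > 0" for S \<delta>
    unfolding \<A>_def mem_Collect_eq by (rule exI[of _ S], rule exI[of _ \<delta>]) (simp add: that)
  obtain L where L: "\<And>\<T> P \<eta>. \<T> \<in> \<A> \<Longrightarrow> finite P \<Longrightarrow> \<eta> > 0 \<Longrightarrow> \<exists>i\<in>\<T>. \<forall>p\<in>P. \<bar>D i p - L p\<bar> < \<eta>"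
  proof (rule cluster_point[of \<A> D])
    have "good {} 1 \<in> \<A>" by (rule goodI) auto
    then show "\<A> \<noteq> {}" by blast
    show "\<T> \<noteq> {}" if T: "\<T> \<in> \<A>" for \<T>
    proof -
      obtain S \<delta> where S: "finite S" "S \<subseteq> carrier G" "\<delta> > 0" "\<T> = good S \<delta>"
        using T unfolding \<A>_def by blast
      then show ?thesis using ex[OF S(1-3,3)] by (auto simp: good_def)
    qed
    show "\<exists>C\<in>\<A>. C \<subseteq> \<T> \<inter> \<T>'" if T: "\<T> \<in> \<A>" "\<T>' \<in> \<A>" for \<T> \<T>'
    proof -
      obtain S \<delta> where S: "finite S" "S \<subseteq> carrier G" "\<delta> > 0" "\<T> = good S \<delta>"
        using T(1) unfolding \<A>_def by blast
      obtain S' \<delta>' where S': "finite S'" "S' \<subseteq> carrier G" "\<delta>' > 0" "\<T>' = good S' \<delta>'"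
        using T(2) unfolding \<A>_def by blast
      have "finite (S \<union> S')" "S \<union> S' \<subseteq> carrier G" "min \<delta> \<delta>' > 0" using S S' by auto
      then have "good (S \<union> S') (min \<delta> \<delta>') \<in> \<A>" by (rule goodI)
      moreover have "good (S \<union> S') (min \<delta> \<delta>') \<subseteq> \<T> \<inter> \<T>'"
      proof
        fix i assume "i \<in> good (S \<union> S') (min \<delta> \<delta>')"
        then obtain n \<psi> f where i: "i = (n, \<psi>, f)"
          and ap: "sofic_approximation G (S \<union> S') (min \<delta> \<delta>') n \<psi>"
          and tw: "twisting_perm k n (S \<union> S') A B \<phi> (min \<delta> \<delta>') \<psi> f"
          by (cases i) (simp add: good_def)
        show "i \<in> \<T> \<inter> \<T>'"
          unfolding S(4) S'(4) i good_def
          using sofic_approximation_mono[OF ap Un_upper1 min.cobounded1]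
            sofic_approximation_mono[OF ap Un_upper2 min.cobounded2]
            twisting_perm_mono[OF tw Un_upper1 min.cobounded1]
            twisting_perm_mono[OF tw Un_upper2 min.cobounded2] by simp
      qed
      ultimately show ?thesis by blast
    qed
    show "0 \<le> D i p" "D i p \<le> 1" for i p
      by (auto simp: D_def ham_nonneg ham_le_1 split: prod.split)
  qed blast
  interpret limit_length G A B \<phi> k L
  proof (rule limit_length.intro)
    fix S :: "'a set" and P :: "(('a + int) list \<times> ('a + int) list) set" and \<delta> \<eta> :: real
    assume *: "finite S" "S \<subseteq> carrier G" "\<delta> > 0" "finite P" "\<eta> > 0"
    have "good S \<delta> \<in> \<A>" using * by (intro goodI)
    from L[OF this *(4,5)]
    obtain n \<psi> f where "(n, \<psi>, f) \<in> good S \<delta>" "\<forall>p\<in>P. \<bar>D (n, \<psi>, f) p - L p\<bar> < \<eta>" by (metis prod_cases3)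
    then show "\<exists>n \<psi> f. sofic_approximation G S \<delta> n \<psi> \<and> twisting_perm k n S A B \<phi> \<delta> \<psi> f \<and>
        (\<forall>(v, w)\<in>P. \<bar>ham {1..n} (eval_word k \<psi> f v) (eval_word k \<psi> f w) - L (v, w)\<bar> < \<eta>)"
      by (intro exI[of _ n] exI[of _ \<psi>] exI[of _ f]) (auto simp: D_def good_def)
  qed (use assms in auto)
  show ?thesis by (rule sofic_quotient_of_Hig)
qed

lemma (in group) conj_relatorD:
  assumes "t \<in> carrier G" "a \<in> carrier G" "c \<in> carrier G" "inv t \<otimes> a \<otimes> t \<otimes> inv c = \<one>"
  shows "a \<otimes> t = t \<otimes> c"
proof -
  have "inv t \<otimes> a \<otimes> t = c" using assms inv_solve_right'[of \<one> "inv t \<otimes> a \<otimes> t" c] by simp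
  then show ?thesis using assms inv_solve_left'[of c t "a \<otimes> t"] by (simp add: m_assoc)
qed

text \<open>The relators die in the quotient, so the image of t has order dividing k and conjugates
  the image of b to that of \<phi>(b); \<open>sofic_imp_twisting_perm\<close> then applies.\<close>

lemma twisting_perms_if_sofic_quotient_of_Hig:
  fixes G :: "('a, 'b) monoid_scheme"
  assumes G: "group G" and B: "B \<subseteq> carrier G" "\<And>b. b \<in> B \<Longrightarrow> \<phi> b \<in> carrier G"
    and N: "N \<lhd> Hig k G B \<phi>" "sofic (Hig k G B \<phi> Mod N)"
      "inj_on (\<lambda>g. N #>\<^bsub>Hig k G B \<phi>\<^esub> hig_iota k G B \<phi> g) (carrier G)"
    and S: "finite S" "S \<subseteq> carrier G" "\<delta> > 0" "\<epsilon> > 0"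
  shows "\<exists>n \<psi> f. sofic_approximation G S \<delta> n \<psi> \<and> twisting_perm k n S A B \<phi> \<epsilon> \<psi> f"
proof -
  let ?P = "free_product G integer_group" and ?H = "Hig k G B \<phi>"
  let ?i = "free_product_inl G integer_group" and ?t = "hig_t G"
  let ?R = "normal_closure ?P (hig_relators k G B \<phi>)"
  interpret G: group G by fact
  interpret P: group ?P by (rule group_free_product[OF G group_integer_group])
  have i: "?i \<in> hom G ?P" by (rule free_product_inl_hom[OF G])
  then have i_closed: "?i g \<in> carrier ?P" if "g \<in> carrier G" for g
    using that by (rule hom_in_carrier)
  have t: "?t \<in> carrier ?P"
    unfolding hig_t_def by (rule hom_in_carrier[OF free_product_inr_hom[OF group_integer_group]]) simp
  have relators: "?t [^]\<^bsub>?P\<^esub> k \<in> hig_relators k G B \<phi>"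
    "\<And>b. b \<in> B \<Longrightarrow> inv\<^bsub>?P\<^esub> ?t \<otimes>\<^bsub>?P\<^esub> ?i b \<otimes>\<^bsub>?P\<^esub> ?t \<otimes>\<^bsub>?P\<^esub> inv\<^bsub>?P\<^esub> (?i (\<phi> b)) \<in> hig_relators k G B \<phi>"
    by (auto simp: hig_relators_def Let_def)
  have rel: "hig_relators k G B \<phi> \<subseteq> carrier ?P"
    using t i_closed B by (auto simp: hig_relators_def Let_def subset_iff)
  interpret R: normal ?R ?P by (rule normal_closure_normal(1)[OF P.group_axioms rel])
  have R: "hig_relators k G B \<phi> \<subseteq> ?R" by (rule normal_closure_normal(2)[OF P.group_axioms rel])
  define r where "r x = ?R #>\<^bsub>?P\<^esub> x" for x
  have H: "?H = ?P Mod ?R" by (simp add: Hig_def)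
  interpret H: group ?H unfolding H by (rule R.factorgroup_is_group)
  have r_hom: "r \<in> hom ?P ?H" using R.r_coset_hom_Mod by (simp add: H r_def[abs_def])
  interpret N: normal N ?H by (rule N)
  interpret Q: group "?H Mod N" by (rule N.factorgroup_is_group)
  define \<theta> where "\<theta> x = N #>\<^bsub>?H\<^esub> r x" for x
  have \<theta>_hom: "\<theta> \<in> hom ?P (?H Mod N)"
    using hom_compose[OF r_hom N.r_coset_hom_Mod] by (simp add: \<theta>_def[abs_def] comp_def)
  interpret \<theta>: group_hom ?P "?H Mod N" \<theta> by unfold_locales (rule \<theta>_hom)
  have \<theta>_one: "\<theta> x = \<one>\<^bsub>?H Mod N\<^esub>" if "x \<in> hig_relators k G B \<phi>" for x
  proof -
    have "x \<in> ?R" "x \<in> carrier ?P" using that R rel by auto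
    then have "r x = \<one>\<^bsub>?H\<^esub>"
      using P.coset_join2[OF _ R.subgroup_axioms] by (simp add: r_def H)
    moreover have "N #>\<^bsub>?H\<^esub> \<one>\<^bsub>?H\<^esub> = N" by (rule H.coset_mult_one[OF N.subset])
    ultimately show ?thesis by (simp add: \<theta>_def)
  qed
  have comp: "\<theta> \<circ> ?i = (\<lambda>g. N #>\<^bsub>?H\<^esub> hig_iota k G B \<phi> g)"
    by (simp add: fun_eq_iff \<theta>_def r_def hig_iota_def)
  show ?thesis
  proof (rule sofic_imp_twisting_perm[OF G Q.group_axioms N(2), of "\<theta> \<circ> ?i" "\<theta> ?t"])
    show "\<theta> \<circ> ?i \<in> hom G (?H Mod N)" by (rule hom_compose[OF i \<theta>_hom])
    show "inj_on (\<theta> \<circ> ?i) (carrier G)" unfolding comp by (rule N(3))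
    show "\<theta> ?t \<in> carrier (?H Mod N)" by (rule \<theta>.hom_closed[OF t])
    show "\<theta> ?t [^]\<^bsub>?H Mod N\<^esub> k = \<one>\<^bsub>?H Mod N\<^esub>"
      using \<theta>_one[OF relators(1)] by (simp only: \<theta>.hom_nat_pow[OF t])
    fix b assume b: "b \<in> B"
    then have car: "?i b \<in> carrier ?P" "?i (\<phi> b) \<in> carrier ?P" using B i_closed by auto
    note c = \<theta>.hom_closed[OF car(1)] \<theta>.hom_closed[OF car(2)] \<theta>.hom_closed[OF t]
    have "inv\<^bsub>?H Mod N\<^esub> \<theta> ?t \<otimes>\<^bsub>?H Mod N\<^esub> \<theta> (?i b) \<otimes>\<^bsub>?H Mod N\<^esub> \<theta> ?t
        \<otimes>\<^bsub>?H Mod N\<^esub> inv\<^bsub>?H Mod N\<^esub> \<theta> (?i (\<phi> b)) = \<one>\<^bsub>?H Mod N\<^esub>"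
      using \<theta>_one[OF relators(2)[OF b]]
      by (simp only: \<theta>.hom_mult \<theta>.hom_inv P.m_closed P.inv_closed car t)
    then show "(\<theta> \<circ> ?i) b \<otimes>\<^bsub>?H Mod N\<^esub> \<theta> ?t = \<theta> ?t \<otimes>\<^bsub>?H Mod N\<^esub> (\<theta> \<circ> ?i) (\<phi> b)"
      unfolding comp_apply by (rule Q.conj_relatorD[OF c(3,1,2)])
  qed (use S in auto)
qed

theorem theorem1p5:
  fixes G :: "('a, 'b) monoid_scheme" and A B :: "'a set" and \<phi> :: "'a \<Rightarrow> 'a" and k :: nat
  assumes "group G" and "subgroup A G" and "subgroup B G"
    and "\<phi> \<in> iso (G\<lparr>carrier := B\<rparr>) (G\<lparr>carrier := A\<rparr>)"
    and "k \<ge> 1"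
  shows "((\<exists>N. N \<lhd> Hig k G B \<phi> \<and> sofic (Hig k G B \<phi> Mod N) \<and>
            inj_on (\<lambda>g. N #>\<^bsub>Hig k G B \<phi>\<^esub> hig_iota k G B \<phi> g) (carrier G)) \<longleftrightarrow>
          (\<forall>S \<delta> \<epsilon>. finite S \<and> S \<subseteq> carrier G \<and> \<delta> > 0 \<and> \<epsilon> > 0 \<longrightarrow>
            (\<exists>n \<psi>. sofic_approximation G S \<delta> n \<psi> \<and>
              (\<exists>f \<in> carrier (sym_group n). f [^]\<^bsub>sym_group n\<^esub> k = \<one>\<^bsub>sym_group n\<^esub> \<and>
                (\<forall>b \<in> S \<inter> {b \<in> B. \<phi> b \<in> A \<inter> S}.
                  hamming_dist n (\<psi> b \<circ> f) (f \<circ> \<psi> (\<phi> b)) < \<epsilon>))))) \<and>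
         (amenable G \<longrightarrow>
          ((\<exists>N. N \<lhd> Hig k G B \<phi> \<and> sofic (Hig k G B \<phi> Mod N) \<and>
            inj_on (\<lambda>g. N #>\<^bsub>Hig k G B \<phi>\<^esub> hig_iota k G B \<phi> g) (carrier G)) \<longleftrightarrow>
          (\<forall>S \<epsilon>. finite S \<and> S \<subseteq> carrier G \<and> \<epsilon> > 0 \<longrightarrow>
            (\<exists>S' \<delta> N. finite S' \<and> S' \<subseteq> carrier G \<and> S \<subseteq> S' \<and> \<delta> > 0 \<and>
              (\<forall>n \<psi>. n > N \<and> sofic_approximation G S' \<delta> n \<psi> \<longrightarrow>
                (\<exists>f \<in> carrier (sym_group n). f [^]\<^bsub>sym_group n\<^esub> k = \<one>\<^bsub>sym_group n\<^esub> \<and>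
                  (\<forall>b \<in> S \<inter> {b \<in> B. \<phi> b \<in> A \<inter> S}.
                    hamming_dist n (\<psi> b \<circ> f) (f \<circ> \<psi> (\<phi> b)) < \<epsilon>)))))))"
    (is "(?one \<longleftrightarrow> ?two) \<and> (_ \<longrightarrow> (_ \<longleftrightarrow> ?three))")
proof -
  have A: "A \<subseteq> carrier G" and B: "B \<subseteq> carrier G"
    using assms(2,3) by (auto dest: subgroup.subset)
  have \<phi>: "\<phi> b \<in> A" if "b \<in> B" for b
    using assms(4) that by (auto simp: iso_def hom_def)
  have bex: "(\<exists>f \<in> carrier (sym_group n). f [^]\<^bsub>sym_group n\<^esub> k = \<one>\<^bsub>sym_group n\<^esub> \<and>
      (\<forall>b \<in> S \<inter> {b \<in> B. \<phi> b \<in> A \<inter> S}. hamming_dist n (\<psi> b \<circ> f) (f \<circ> \<psi> (\<phi> b)) < \<epsilon>)) \<longleftrightarrow>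
    (\<exists>f. twisting_perm k n S A B \<phi> \<epsilon> \<psi> f)" for n \<psi> S \<epsilon>
    by (auto simp only: twisting_perm_def Bex_def)
  have one_two: "?one \<longleftrightarrow> ?two"
    unfolding bex
  proof (intro iffI allI impI)
    fix S :: "'a set" and \<delta> \<epsilon> :: real
    assume ?one and S: "finite S \<and> S \<subseteq> carrier G \<and> 0 < \<delta> \<and> 0 < \<epsilon>"
    then obtain N where N: "N \<lhd> Hig k G B \<phi>" "sofic (Hig k G B \<phi> Mod N)"
      "inj_on (\<lambda>g. N #>\<^bsub>Hig k G B \<phi>\<^esub> hig_iota k G B \<phi> g) (carrier G)" by blast
    have "\<phi> b \<in> carrier G" if "b \<in> B" for b using \<phi>[OF that] A by blast
    from twisting_perms_if_sofic_quotient_of_Hig[OF assms(1) B this N, of S \<delta> \<epsilon> A] S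
    show "\<exists>n \<psi>. sofic_approximation G S \<delta> n \<psi> \<and> (\<exists>f. twisting_perm k n S A B \<phi> \<epsilon> \<psi> f)" by simp
  next
    assume two: "\<forall>S \<delta> \<epsilon>. finite S \<and> S \<subseteq> carrier G \<and> 0 < \<delta> \<and> 0 < \<epsilon> \<longrightarrow>
      (\<exists>n \<psi>. sofic_approximation G S \<delta> n \<psi> \<and> (\<exists>f. twisting_perm k n S A B \<phi> \<epsilon> \<psi> f))"
    show ?one
    proof (rule sofic_quotient_of_Hig_if_twisting_perms[OF assms(1,5) B A])
      show "\<exists>n \<psi> f. sofic_approximation G S \<delta> n \<psi> \<and> twisting_perm k n S A B \<phi> \<epsilon> \<psi> f"
        if "finite S" "S \<subseteq> carrier G" "\<delta> > 0" "\<epsilon> > 0" for S and \<delta> \<epsilon> :: real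
        using two that by blast
    qed (rule \<phi>)
  qed
  have two_three: "?two \<longleftrightarrow> ?three" if am: "amenable G"
    unfolding bex
  proof (intro iffI allI impI)
    fix S :: "'a set" and \<epsilon> :: real
    assume two: "\<forall>S \<delta> \<epsilon>. finite S \<and> S \<subseteq> carrier G \<and> 0 < \<delta> \<and> 0 < \<epsilon> \<longrightarrow>
      (\<exists>n \<psi>. sofic_approximation G S \<delta> n \<psi> \<and> (\<exists>f. twisting_perm k n S A B \<phi> \<epsilon> \<psi> f))"
      and "finite S \<and> S \<subseteq> carrier G \<and> 0 < \<epsilon>"
    then have S: "finite S" "S \<subseteq> carrier G" "0 < \<epsilon>" by simp_all
    show "\<exists>S' \<delta> N. finite S' \<and> S' \<subseteq> carrier G \<and> S \<subseteq> S' \<and> 0 < \<delta> \<and>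
      (\<forall>n \<psi>. N < n \<and> sofic_approximation G S' \<delta> n \<psi> \<longrightarrow> (\<exists>f. twisting_perm k n S A B \<phi> \<epsilon> \<psi> f))"
      (is ?goal)
    proof (rule amenable_twisting_perm_transfer[OF assms(1) am S])
      show "\<exists>n \<psi> f. sofic_approximation G S' \<delta> n \<psi> \<and> twisting_perm k n S' A B \<phi> \<epsilon>' \<psi> f"
        if "finite S'" "S' \<subseteq> carrier G" "\<delta> > 0" "\<epsilon>' > 0" for S' and \<delta> \<epsilon>' :: real
        using two that by blast
    next
      fix S' \<delta> N
      assume "finite S'" "S' \<subseteq> carrier G" "S \<subseteq> S'" "0 < \<delta>"
        "\<And>n \<psi>. N < n \<Longrightarrow> sofic_approximation G S' \<delta> n \<psi> \<Longrightarrow> \<exists>f. twisting_perm k n S A B \<phi> \<epsilon> \<psi> f"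
      then show ?goal by (intro exI[of _ S'] exI[of _ \<delta>] exI[of _ N]) simp
    qed
  next
    fix S :: "'a set" and \<delta> \<epsilon> :: real
    assume three: "\<forall>S \<epsilon>. finite S \<and> S \<subseteq> carrier G \<and> 0 < \<epsilon> \<longrightarrow>
        (\<exists>S' \<delta> N. finite S' \<and> S' \<subseteq> carrier G \<and> S \<subseteq> S' \<and> 0 < \<delta> \<and>
          (\<forall>n \<psi>. N < n \<and> sofic_approximation G S' \<delta> n \<psi> \<longrightarrow> (\<exists>f. twisting_perm k n S A B \<phi> \<epsilon> \<psi> f)))"
      and "finite S \<and> S \<subseteq> carrier G \<and> 0 < \<delta> \<and> 0 < \<epsilon>"
    then have S: "finite S" "S \<subseteq> carrier G" "0 < \<delta>" "0 < \<epsilon>" by simp_all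
    obtain S' \<delta>' N where S': "finite S'" "S' \<subseteq> carrier G" "S \<subseteq> S'" "0 < \<delta>'"
      and tw: "\<And>n \<psi>. N < n \<Longrightarrow> sofic_approximation G S' \<delta>' n \<psi> \<Longrightarrow> \<exists>f. twisting_perm k n S A B \<phi> \<epsilon> \<psi> f"
      using three S by metis
    \<comment> \<open>Condition (3) only speaks about approximations on more than \<open>N\<close>
      points. Amenability supplies one, chosen good enough both for the premise of (3) and for the
      requirement of (2).\<close>
    have "0 < min \<delta> \<delta>'" using S(3) S'(4) by simp
    from amenable_large_sofic_approximation[OF assms(1) am S'(1,2) this]
    obtain n \<psi> where n: "N < n" and ap: "sofic_approximation G S' (min \<delta> \<delta>') n \<psi>" .
    have "sofic_approximation G S \<delta> n \<psi>"
      by (rule sofic_approximation_mono[OF ap S'(3)]) simp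
    moreover have "\<exists>f. twisting_perm k n S A B \<phi> \<epsilon> \<psi> f"
      by (intro tw n sofic_approximation_mono[OF ap]) auto
    ultimately show "\<exists>n \<psi>. sofic_approximation G S \<delta> n \<psi> \<and> (\<exists>f. twisting_perm k n S A B \<phi> \<epsilon> \<psi> f)"
      by (intro exI[of _ n] exI[of _ \<psi>] conjI)
  qed
  show ?thesis by (intro conjI impI one_two HOL.trans[OF one_two two_three])
qed

end
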